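(* Let $\mathcal{B}$ be a von Neumann algebra with center $\mathcal{Z}(\mathcal{B})$, let $\mathcal{A}$ be a unital commutative C*-subalgebra of $\mathcal{B}$, and let $T\in\mathcal{B}$. Then there is a net $\{P_\lambda\}$ of projections in $\mathcal{B}$ such that (1) for every $A\in\mathcal{A}$, $\|AP_\lambda-P_\lambda A\|\to 0$, and (2) $\displaystyle \mathrm{dist}\left(T,C^{*}(\mathcal{A}\cup\mathcal{Z}(\mathcal{B}))\right)\le 10\,\lim_\lambda\|TP_\lambda-P_\lambda T\|$ (in particular, the limit on the right exists).
   Context: A unital C*-subalgebra of $\mathcal{B}$ contains the identity of $\mathcal{B}$. Projections are self-adjoint idempotents. $C^{*}(\mathcal{X})$ denotes the (norm-closed) C*-subalgebra of $\mathcal{B}$ generated by $\mathcal{X}\subseteq\mathcal{B}$, and $\mathrm{dist}(T,\mathcal{W})=\inf\{\|T-W\|:W\in\mathcal{W}\}$. *)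

theory Defs
  imports "HOL-Analysis.Analysis"
begin

section \<open>Complex Hilbert spaces\<close>

text \<open>
  A complex Hilbert space, over the library's real inner product: \<open>inner\<close> is the real part of
  the complex inner product, so that the norm is the usual one and the real scalar
  multiplication is the restriction of the complex one. The complex inner product is
  linear in its first argument.
\<close>

class complex_hilbert_space = real_inner + complete_space +
  fixes scaleC :: "complex \<Rightarrow> 'a \<Rightarrow> 'a"  (infixr \<open>*\<^sub>C\<close> 75)
    and cinner :: "'a \<Rightarrow> 'a \<Rightarrow> complex"
  assumes scaleC_add_right: "c *\<^sub>C (x + y) = c *\<^sub>C x + c *\<^sub>C y"
    and scaleC_add_left: "(c + d) *\<^sub>C x = c *\<^sub>C x + d *\<^sub>C x"
    and scaleC_scaleC: "c *\<^sub>C (d *\<^sub>C x) = (c * d) *\<^sub>C x"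
    and scaleC_of_real: "complex_of_real r *\<^sub>C x = r *\<^sub>R x"
    and cinner_add_left: "cinner (x + y) z = cinner x z + cinner y z"
    and cinner_scaleC_left: "cinner (c *\<^sub>C x) y = c * cinner x y"
    and cinner_commute: "cinner x y = cnj (cinner y x)"
    and Re_cinner: "Re (cinner x y) = inner x y"

instantiation complex :: complex_hilbert_space
begin

definition scaleC_complex :: "complex \<Rightarrow> complex \<Rightarrow> complex"
  where "scaleC_complex c x = c * x"

definition cinner_complex :: "complex \<Rightarrow> complex \<Rightarrow> complex"
  where "cinner_complex x y = x * cnj y"

instance
  by standard (auto simp: scaleC_complex_def cinner_complex_def algebra_simps scaleR_conv_of_real
      inner_complex_def)

end

lemma cinner_self: "cinner x x = complex_of_real ((norm x)\<^sup>2)"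
  for x :: "'h::complex_hilbert_space"
proof (rule complex_eqI)
  show "Re (cinner x x) = Re (complex_of_real ((norm x)\<^sup>2))"
    by (simp add: Re_cinner power2_norm_eq_inner)
  have "Im (cinner x x) = - Im (cinner x x)"
    by (metis cinner_commute complex_cnj cnj.simps(2))
  then show "Im (cinner x x) = Im (complex_of_real ((norm x)\<^sup>2))"
    by simp
qed

lemma norm_scaleC: "norm (c *\<^sub>C x) = cmod c * norm x"
  for x :: "'h::complex_hilbert_space"
proof -
  have "cinner (c *\<^sub>C x) (c *\<^sub>C x) = c * cnj (c * cinner x x)"
    by (metis cinner_commute cinner_scaleC_left)
  also have "\<dots> = (c * cnj c) * cinner x x"
    by (simp add: cinner_self)
  also have "\<dots> = complex_of_real ((cmod c * norm x)\<^sup>2)"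
    by (simp add: cinner_self complex_norm_square [symmetric] power_mult_distrib)
  finally have "(norm (c *\<^sub>C x))\<^sup>2 = (cmod c * norm x)\<^sup>2"
    by (metis cinner_self of_real_eq_iff)
  then show ?thesis
    by simp
qed

lemma bounded_linear_scaleC: "bounded_linear (\<lambda>x::'h::complex_hilbert_space. c *\<^sub>C x)"
proof (rule bounded_linear_intro [where K = "cmod c"])
  show "c *\<^sub>C (r *\<^sub>R x) = r *\<^sub>R (c *\<^sub>C x)" for r and x :: 'h
    by (simp add: scaleC_scaleC mult.commute flip: scaleC_of_real)
qed (simp_all add: scaleC_add_right norm_scaleC mult.commute)

section \<open>Bounded operators\<close>

text \<open>
  The type \<open>'h \<Rightarrow>\<^sub>L 'h\<close> of the library consists of the bounded real-linear maps; operators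
  in the present sense are those which are complex-linear. Norm, sum and composition are the
  library's.
\<close>

type_synonym 'h opr = "'h \<Rightarrow>\<^sub>L 'h"

definition bounded_ops :: "'h::complex_hilbert_space opr set"
  where "bounded_ops = {T :: 'h opr. \<forall>c x. T (c *\<^sub>C x) = c *\<^sub>C T x}"

definition scale_opr :: "complex \<Rightarrow> 'h::complex_hilbert_space opr \<Rightarrow> 'h opr"
  where "scale_opr c T = Blinfun (\<lambda>x. c *\<^sub>C T x)"

lemma scale_opr_apply [simp]: "scale_opr c T x = c *\<^sub>C T x"
  unfolding scale_opr_def
  by (subst bounded_linear_Blinfun_apply)
    (auto intro: bounded_linear_compose [OF bounded_linear_scaleC] blinfun.bounded_linear_right)

definition adj :: "'h::complex_hilbert_space opr \<Rightarrow> 'h opr"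
  where "adj T = (THE S :: 'h opr. \<forall>x y. cinner (T x) y = cinner x (S y))"

text \<open>Existence is the Riesz representation theorem; uniqueness gives:\<close>

lemma adj_eqI:
  fixes T S :: "'h::complex_hilbert_space opr"
  assumes S: "\<And>x y. cinner (T x) y = cinner x (S y)"
  shows "adj T = S"
  unfolding adj_def
proof (rule the_equality)
  show "\<forall>x y. cinner (T x) y = cinner x (S y)"
    using S by blast
next
  fix R :: "'h opr" assume R: "\<forall>x y. cinner (T x) y = cinner x (R y)"
  show "R = S"
  proof (rule blinfun_eqI)
    fix y
    have "inner x (R y) = inner x (S y)" for x
      using R S by (metis Re_cinner)
    then show "R y = S y"
      by (metis inner_commute vector_eq_rdot)
  qed
qed

definition commutator :: "'h::complex_hilbert_space opr \<Rightarrow> 'h opr \<Rightarrow> 'h opr"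
  where "commutator S T = (S o\<^sub>L T) - (T o\<^sub>L S)"

definition projection :: "'h::complex_hilbert_space opr \<Rightarrow> bool"
  where "projection P \<longleftrightarrow> P \<in> bounded_ops \<and> adj P = P \<and> P o\<^sub>L P = P"

section \<open>Operator algebras\<close>

definition star_subalgebra :: "'h::complex_hilbert_space opr set \<Rightarrow> bool"
  where "star_subalgebra M \<longleftrightarrow>
    M \<subseteq> bounded_ops \<and> 0 \<in> M \<and>
    (\<forall>S\<in>M. \<forall>T\<in>M. S + T \<in> M) \<and>
    (\<forall>c. \<forall>T\<in>M. scale_opr c T \<in> M) \<and>
    (\<forall>S\<in>M. \<forall>T\<in>M. S o\<^sub>L T \<in> M) \<and>
    (\<forall>T\<in>M. adj T \<in> M)"

definition cstar_algebra :: "'h::complex_hilbert_space opr set \<Rightarrow> bool"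
  where "cstar_algebra M \<longleftrightarrow> star_subalgebra M \<and> closed M"

definition von_neumann_algebra :: "'h::complex_hilbert_space opr set \<Rightarrow> bool"
  where "von_neumann_algebra M \<longleftrightarrow>
    star_subalgebra M \<and> id_blinfun \<in> M \<and> closedin strong_operator_topology M"

definition commutative :: "'h::complex_hilbert_space opr set \<Rightarrow> bool"
  where "commutative M \<longleftrightarrow> (\<forall>S\<in>M. \<forall>T\<in>M. S o\<^sub>L T = T o\<^sub>L S)"

definition center :: "'h::complex_hilbert_space opr set \<Rightarrow> 'h opr set"
  where "center M = {Z\<in>M. \<forall>T\<in>M. Z o\<^sub>L T = T o\<^sub>L Z}"

definition cstar_generated :: "'h::complex_hilbert_space opr set \<Rightarrow> 'h opr set \<Rightarrow> 'h opr set"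
  where "cstar_generated B X = \<Inter>{C. cstar_algebra C \<and> X \<subseteq> C \<and> C \<subseteq> B}"

section \<open>Nets\<close>

definition directed_set :: "'i set \<Rightarrow> 'i rel \<Rightarrow> bool"
  where "directed_set D R \<longleftrightarrow>
    D \<noteq> {} \<and> preorder_on D R \<and> (\<forall>i\<in>D. \<forall>j\<in>D. \<exists>k\<in>D. (i, k) \<in> R \<and> (j, k) \<in> R)"

definition tails :: "'i set \<Rightarrow> 'i rel \<Rightarrow> 'i filter"
  where "tails D R = (INF i\<in>D. principal {j\<in>D. (i, j) \<in> R})"

lemma eventually_tails:
  assumes "directed_set D R"
  shows "eventually Q (tails D R) \<longleftrightarrow> (\<exists>i\<in>D. \<forall>j\<in>D. (i, j) \<in> R \<longrightarrow> Q j)"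
proof -
  have "eventually Q (tails D R) \<longleftrightarrow>
      (\<exists>i\<in>D. eventually Q (principal {j\<in>D. (i, j) \<in> R}))"
    unfolding tails_def
  proof (rule eventually_INF_base)
    show "D \<noteq> {}"
      using assms by (simp add: directed_set_def)
  next
    fix a b assume "a \<in> D" "b \<in> D"
    then obtain k where k: "k \<in> D" "(a, k) \<in> R" "(b, k) \<in> R"
      using assms unfolding directed_set_def by blast
    have "trans R"
      using assms by (simp add: directed_set_def preorder_on_def)
    then have "{j\<in>D. (k, j) \<in> R} \<subseteq> {j\<in>D. (a, j) \<in> R} \<inter> {j\<in>D. (b, j) \<in> R}"
      using k by (auto dest: transD)
    then show "\<exists>x\<in>D. principal {j\<in>D. (x, j) \<in> R} \<le>
        inf (principal {j\<in>D. (a, j) \<in> R}) (principal {j\<in>D. (b, j) \<in> R})"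
      using k by auto
  qed
  then show ?thesis
    by (auto simp: eventually_principal)
qed

lemma tails_neq_bot:
  assumes "directed_set D R"
  shows "tails D R \<noteq> bot"
proof -
  have "refl_on D R"
    using assms by (simp add: directed_set_def preorder_on_def)
  then show ?thesis
    using eventually_tails [OF assms, of "\<lambda>_. False"]
    by (auto simp: refl_on_def trivial_limit_def)
qed

text \<open>
  The index type of a net has to be fixed. For nets in a type \<open>'x\<close>, pairs of an element of \<open>'x\<close> and
  a set containing it suffice: if \<open>F\<close> is the filter of those sets in which a given net (on any
  index set) eventually lies, then the net \<open>(x, S) \<mapsto> x\<close> on \<open>{(x, S). S \<in> F \<and> x \<in> S}\<close>, ordered by
  reverse inclusion of the second components, eventually lies in the same sets.
\<close>

type_synonym 'x net_index = "'x \<times> 'x set"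

end

theory Submission
  imports Defs "HOL-Computational_Algebra.Fundamental_Theorem_Algebra"
begin

text \<open>
  Let \<open>s\<close> bound \<open>\<parallel>[T, P]\<parallel>\<close> for all projections \<open>P\<close> which commute up to \<open>\<epsilon>\<close> with a finite set
  \<open>F \<subseteq> A\<close>; it suffices to bound the distance by \<open>6 s\<close>, since the infimum of these \<open>s\<close> is the limit
  along a net of almost optimal projections. Take a partition of unity \<open>1 = \<Sum> \<rho>\<^sup>2\<close> in \<open>A\<close> so fine
  that each element of \<open>F\<close> is nearly scalar on the range projection \<open>f\<close> of each \<open>\<rho>\<close>. Then every
  projection below some \<open>f\<close> qualifies as \<open>P\<close>, and so do the spectral projections of elements of
  \<open>A\<close>. Averaging \<open>T\<close> over the symmetries built from finitely many of the latter gives \<open>X\<close> with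
  \<open>\<parallel>T - X\<parallel> \<le> 2 s\<close> which commutes with each \<open>f\<close>, nearly commutes with each \<open>\<rho>\<close>, and inherits the
  commutator bound for the projections below \<open>f\<close>. If \<open>h\<close> is the real or imaginary part of \<open>X\<close> and
  two parts \<open>q, q' \<le> f\<close> of its spectrum differ by more than \<open>2 s\<close>, then \<open>q' B q = 0\<close>: otherwise
  a partial isometry \<open>v\<close> from \<open>q\<close> to \<open>q'\<close> exists, and the projection onto its graph violates the
  bound. Comparing central supports, \<open>h\<close> is within \<open>2 s\<close> (up to an arbitrarily small error) of a
  central \<open>z\<close> on \<open>f\<close>; hence \<open>h\<close> is within \<open>2 s\<close> of \<open>\<Sum> z \<rho>\<^sup>2 \<in> C\<^sup>*(A \<union> Z(B))\<close>.

  The argument only uses the real structure of the Hilbert space: \<open>inner\<close> and real-linear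
  operators, with the imaginary unit as a central operator.
\<close>

section \<open>The algebra of operators\<close>

text \<open>The spectral projections of \<open>A\<close> need not lie in \<open>A\<close>. They may
  serve as projections \<open>P\<close> and as averaging symmetries, but not in the approximant;
  hence the central elements are glued by squares of continuous functions, and range projections
  only mark where an estimate is made. To keep the number of pieces out of the constant, the terms
  are sandwiched as \<rho> Y \<rho>, so that the sum is bounded by the largest Y. The price is that
  h must nearly commute with every \<rho>, and for this finitely many spectral projections are
  enough.

  The threshold 2 s is that of a two by two matrix: if h is diagonal with entries a and b on the
  span of y and v y, its commutator with the projection all of whose entries are 1/2 has norm (b -
  a) / 2. Central elements are unavoidable, since a jump of h between parts with q' B q = 0 is
  invisible to commutators with projections of \<open>B\<close>; such parts are separated by a
  central projection.

  The constant 6 is 2 for T - X and 2 for each of the real and imaginary parts of X.\<close>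

text \<open>
  A copy of \<open>'a \<Rightarrow>\<^sub>L 'a\<close> on which composition is the multiplication of a ring. The class
  \<open>ring_1\<close> is out of reach, since the space may be trivial.
\<close>

typedef (overloaded) 'a oper = "UNIV :: ('a::real_normed_vector \<Rightarrow>\<^sub>L 'a) set"
  morphisms blinfun_of Oper
  by simp

setup_lifting type_definition_oper

instantiation oper :: (real_normed_vector) real_normed_algebra
begin

lift_definition zero_oper :: "'a oper" is 0 .
lift_definition plus_oper :: "'a oper \<Rightarrow> 'a oper \<Rightarrow> 'a oper" is "(+)" .
lift_definition minus_oper :: "'a oper \<Rightarrow> 'a oper \<Rightarrow> 'a oper" is "(-)" .
lift_definition uminus_oper :: "'a oper \<Rightarrow> 'a oper" is uminus .
lift_definition scaleR_oper :: "real \<Rightarrow> 'a oper \<Rightarrow> 'a oper" is scaleR .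
lift_definition times_oper :: "'a oper \<Rightarrow> 'a oper \<Rightarrow> 'a oper" is "(o\<^sub>L)" .
lift_definition norm_oper :: "'a oper \<Rightarrow> real" is norm .
definition dist_oper :: "'a oper \<Rightarrow> 'a oper \<Rightarrow> real"
  where "dist_oper X Y = norm (X - Y)"
definition sgn_oper :: "'a oper \<Rightarrow> 'a oper"
  where "sgn_oper X = inverse (norm X) *\<^sub>R X"
definition uniformity_oper :: "('a oper \<times> 'a oper) filter"
  where "uniformity_oper = (INF e\<in>{0<..}. principal {(x, y). dist x y < e})"
definition open_oper :: "'a oper set \<Rightarrow> bool"
  where "open_oper S = (\<forall>x\<in>S. \<forall>\<^sub>F (x', y) in uniformity. x' = x \<longrightarrow> y \<in> S)"

instance
proof
  show "norm (X * Y) \<le> norm X * norm Y" for X Y :: "'a oper"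
    by transfer (rule norm_blinfun_compose)
  show "norm (X + Y) \<le> norm X + norm Y" for X Y :: "'a oper"
    by transfer (rule norm_triangle_ineq)
qed (unfold dist_oper_def sgn_oper_def uniformity_oper_def open_oper_def,
  (rule refl | (transfer, auto simp: algebra_simps 
    blinfun.bilinear_simps intro!: blinfun_eqI))+)

end

instantiation oper :: (real_normed_vector) monoid_mult
begin

lift_definition one_oper :: "'a oper" is id_blinfun .

instance
  by standard (transfer, auto intro!: blinfun_eqI)+

end

instance oper :: (banach) banach
proof
  fix X :: "nat \<Rightarrow> 'a oper"
  assume "Cauchy X"
  then have "Cauchy (\<lambda>n. blinfun_of (X n))"
    by (simp add: Cauchy_def dist_norm minus_oper.rep_eq norm_oper.rep_eq)
  then obtain L where L: "(\<lambda>n. blinfun_of (X n)) \<longlonglongrightarrow> L"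
    using Cauchy_convergent convergent_def by blast
  have "X \<longlonglongrightarrow> Oper L"
    using L by (simp add: LIMSEQ_def dist_norm norm_oper.rep_eq minus_oper.rep_eq Oper_inverse)
  then show "convergent X"
    by (auto simp: convergent_def)
qed

lift_definition ap :: "'a::real_normed_vector oper \<Rightarrow> 'a \<Rightarrow> 'a" is blinfun_apply .

lemma ap_simps [simp]:
  "ap (X + Y) x = ap X x + ap Y x" "ap (X - Y) x = ap X x - ap Y x"
  "ap (- X) x = - ap X x" "ap (r *\<^sub>R X) x = r *\<^sub>R ap X x" "ap 0 x = 0"
  "ap (X * Y) x = ap X (ap Y x)" "ap 1 x = x"
  by (transfer, simp add: blinfun.bilinear_simps)+

lemma bounded_linear_ap: "bounded_linear (ap X)"
  by transfer (rule blinfun.bounded_linear_right)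

lemmas ap_linear [simp] =
  linear_add [OF bounded_linear.linear [OF bounded_linear_ap]]
  linear_diff [OF bounded_linear.linear [OF bounded_linear_ap]]
  linear_0 [OF bounded_linear.linear [OF bounded_linear_ap]]
  linear_neg [OF bounded_linear.linear [OF bounded_linear_ap]]
  linear_scale [OF bounded_linear.linear [OF bounded_linear_ap]]

lemma norm_ap: "norm (ap X x) \<le> norm X * norm x"
  by transfer (rule norm_blinfun)

lemma oper_eqI: "(\<And>x. ap X x = ap Y x) \<Longrightarrow> X = Y"
  by transfer (rule blinfun_eqI)

lemma oper_norm_bound: "0 \<le> b \<Longrightarrow> (\<And>x. norm (ap X x) \<le> b * norm x) \<Longrightarrow> norm X \<le> b"
  by transfer (rule norm_blinfun_bound)

lemma ex_oper:
  assumes "bounded_linear f"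
  shows "\<exists>X. \<forall>x. ap X x = f x"
  using assms by (metis Oper_inverse UNIV_I ap.rep_eq bounded_linear_Blinfun_apply)

lemma norm_one_le: "norm (1 :: 'a::real_normed_vector oper) \<le> 1"
  by (rule oper_norm_bound) auto

lemma continuous_ap: "continuous_on S (ap X)"
  by (rule linear_continuous_on [OF bounded_linear_ap])

section \<open>Orthogonal projection and the adjoint\<close>

text \<open>A minimising sequence is Cauchy by the parallelogram law, since midpoints stay in
  \<open>M\<close>; minimality along each line through the limit gives orthogonality.\<close>

lemma closed_subspace_orthogonal:
  fixes M :: "'a::{real_inner,banach} set"
  assumes M: "subspace M" "closed M"
  obtains y where "y \<in> M" "\<And>m. m \<in> M \<Longrightarrow> inner (x - y) m = 0"
proof -
  define d where "d = infdist x M"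
  have ne: "M \<noteq> {}"
    using M(1) subspace_0 by blast
  have d0: "0 \<le> d"
    by (simp add: d_def infdist_nonneg)
  have dle: "d \<le> norm (x - m)" if "m \<in> M" for m
    using infdist_le [OF that, of x] by (simp add: d_def dist_norm)
  have "\<exists>m\<in>M. norm (x - m) < d + inverse (Suc n)" for n
  proof -
    have "Inf (dist x ` M) < d + inverse (Suc n)"
      using ne by (simp add: d_def infdist_def)
    then obtain r where "r \<in> dist x ` M" "r < d + inverse (Suc n)"
      using cInf_lessD ne by (metis image_is_empty)
    then show ?thesis
      by (auto simp: dist_norm)
  qed
  then obtain s where s: "\<And>n. s n \<in> M" "\<And>n. norm (x - s n) < d + inverse (Suc n)"
    by metis
  have par: "(norm (s n - s m))\<^sup>2 \<le> 2 * (norm (x - s n))\<^sup>2 + 2 * (norm (x - s m))\<^sup>2 - 4 * d\<^sup>2" for n m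
  proof -
    have mid: "(1/2) *\<^sub>R (s n + s m) \<in> M"
      using M(1) s(1) by (simp add: subspace_add subspace_scale)
    have "d\<^sup>2 \<le> (norm (x - (1/2) *\<^sub>R (s n + s m)))\<^sup>2"
      by (rule power_mono [OF dle [OF mid] d0])
    moreover have "(norm (s n - s m))\<^sup>2 + 4 * (norm (x - (1/2) *\<^sub>R (s n + s m)))\<^sup>2 =
        2 * (norm (x - s n))\<^sup>2 + 2 * (norm (x - s m))\<^sup>2"
      by (simp add: power2_norm_eq_inner inner_simps inner_commute algebra_simps)
    ultimately show ?thesis
      by linarith
  qed
  have lim: "(\<lambda>n. norm (x - s n)) \<longlonglongrightarrow> d"
  proof (rule tendsto_sandwich)
    show "\<forall>\<^sub>F n in sequentially. d \<le> norm (x - s n)"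
      using dle s(1) by simp
    show "\<forall>\<^sub>F n in sequentially. norm (x - s n) \<le> d + inverse (real (Suc n))"
      using s(2) by (simp add: less_imp_le)
    show "(\<lambda>n. d + inverse (real (Suc n))) \<longlonglongrightarrow> d"
      using LIMSEQ_inverse_real_of_nat_add by blast
    show "(\<lambda>n. d) \<longlonglongrightarrow> d"
      by simp
  qed
  have "Cauchy s"
  proof (rule CauchyI)
    fix e :: real
    assume e: "0 < e"
    have "(\<lambda>n. (norm (x - s n))\<^sup>2) \<longlonglongrightarrow> d\<^sup>2"
      by (intro tendsto_intros lim)
    then have "\<forall>\<^sub>F n in sequentially. (norm (x - s n))\<^sup>2 < d\<^sup>2 + e\<^sup>2 / 4"
      by (rule order_tendstoD) (use e in simp)
    then obtain N where N: "\<And>n. n \<ge> N \<Longrightarrow> (norm (x - s n))\<^sup>2 < d\<^sup>2 + e\<^sup>2 / 4"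
      by (auto simp: eventually_sequentially)
    have "norm (s m - s n) < e" if "m \<ge> N" "n \<ge> N" for m n
    proof -
      have "(norm (s m - s n))\<^sup>2 < e\<^sup>2"
        using par [of m n] N [OF that(1)] N [OF that(2)] by linarith
      then show ?thesis
        using e by (simp add: power_less_imp_less_base)
    qed
    then show "\<exists>M. \<forall>m\<ge>M. \<forall>n\<ge>M. norm (s m - s n) < e"
      by blast
  qed
  then obtain y where y: "s \<longlonglongrightarrow> y"
    using Cauchy_convergent convergent_def by blast
  have yM: "y \<in> M"
    using M(2) s(1) y closed_sequentially by blast
  have "(\<lambda>n. norm (x - s n)) \<longlonglongrightarrow> norm (x - y)"
    by (intro tendsto_intros y)
  then have nd: "norm (x - y) = d"
    using lim LIMSEQ_unique by blast
  have "inner (x - y) m = 0" if m: "m \<in> M" for m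
  proof (cases "m = 0")
    case False
    \<comment> \<open>The value of \<open>t\<close> at which
      \<open>norm (x - (y + t *\<^sub>R m))\<close> is least.\<close>
    define t where "t = inner (x - y) m / inner m m"
    have mm: "inner m m > 0"
      using False by simp
    have "y + t *\<^sub>R m \<in> M"
      using M(1) yM m by (simp add: subspace_add subspace_scale)
    then have "d\<^sup>2 \<le> (norm (x - (y + t *\<^sub>R m)))\<^sup>2"
      by (intro power_mono dle d0)
    also have "\<dots> = d\<^sup>2 - 2 * t * inner (x - y) m + t\<^sup>2 * inner m m"
      unfolding nd [symmetric] by (simp only: power2_norm_eq_inner)
        (simp add: inner_simps inner_commute power2_eq_square algebra_simps)
    also have "\<dots> = d\<^sup>2 - (inner (x - y) m)\<^sup>2 / inner m m"
      using mm by (simp add: t_def power2_eq_square field_simps)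
    finally have "(inner (x - y) m)\<^sup>2 / inner m m \<le> 0"
      by simp
    then show ?thesis
      using mm by (simp add: divide_le_0_iff)
  qed simp
  then show thesis
    using that yM by blast
qed

text \<open>The component \<open>w\<close> of some \<open>u\<close> outside the kernel is orthogonal
  to the kernel, and each \<open>x\<close> differs from a multiple of \<open>w\<close> by an element
  of the kernel.\<close>

lemma riesz:
  fixes f :: "'a::{real_inner,banach} \<Rightarrow> real"
  assumes f: "bounded_linear f"
  shows "\<exists>y. \<forall>x. f x = inner x y"
proof (cases "\<forall>x. f x = 0")
  case False
  then obtain u where u: "f u \<noteq> 0"
    by blast
  interpret bounded_linear f by (rule f)
  have "subspace {x. f x = 0}"
    by (auto simp: subspace_def add scale)
  moreover have "closed {x. f x = 0}"
    using linear_continuous_on [OF f, of UNIV] by (intro closed_Collect_eq) auto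
  ultimately obtain v where v: "f v = 0" "\<And>m. f m = 0 \<Longrightarrow> inner (u - v) m = 0"
    using closed_subspace_orthogonal [of "{x. f x = 0}" u] by auto
  define w where "w = u - v"
  have fw: "f w \<noteq> 0"
    using u v(1) by (simp add: w_def diff)
  then have w0: "inner w w \<noteq> 0"
    by (auto simp: zero)
  have "f x = inner x ((f w / inner w w) *\<^sub>R w)" for x
  proof -
    have "f (x - (f x / f w) *\<^sub>R w) = 0"
      using fw by (simp add: diff scale)
    then have "inner w (x - (f x / f w) *\<^sub>R w) = 0"
      using v(2) by (simp add: w_def)
    then show ?thesis
      using fw w0 by (simp add: inner_simps inner_commute field_simps)
  qed
  then show ?thesis
    by blast
qed (auto intro!: exI [of _ 0])

lemma ex_adjoint:
  fixes X :: "'a::{real_inner,banach} oper"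
  shows "\<exists>Y. \<forall>x y. inner (ap X x) y = inner x (ap Y y)"
proof -
  have "\<exists>z. \<forall>x. inner (ap X x) y = inner x z" for y
    by (rule riesz) (intro bounded_linear_compose [OF bounded_linear_inner_left bounded_linear_ap])
  then obtain g where g: "\<And>x y. inner (ap X x) y = inner x (g y)"
    by metis
  have "bounded_linear g"
  proof (rule bounded_linear_intro)
    show "g (x + y) = g x + g y" for x y
      by (rule vector_eq_rdot [THEN iffD1]) (metis g inner_add_left inner_add_right inner_commute)
    show "g (r *\<^sub>R x) = r *\<^sub>R g x" for r x
      by (rule vector_eq_rdot [THEN iffD1]) (metis g inner_scaleR_left inner_scaleR_right inner_commute)
    \<comment> \<open>Boundedness comes from testing the defining identity at the vector
      \<open>g y\<close> itself.\<close>
    show "norm (g y) \<le> norm y * norm X" for y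
    proof (cases "g y = 0")
      case False
      have "norm (g y) * norm (g y) = inner (ap X (g y)) y"
        by (simp add: g flip: power2_norm_eq_inner power2_eq_square)
      also have "\<dots> \<le> norm (ap X (g y)) * norm y"
        by (rule norm_cauchy_schwarz)
      also have "\<dots> \<le> (norm X * norm (g y)) * norm y"
        by (intro mult_right_mono norm_ap) auto
      finally show ?thesis
        using False by (simp add: mult.commute mult.left_commute)
    qed simp
  qed
  then show ?thesis
    using ex_oper [of g] g by metis
qed

text \<open>The adjoint for the real inner product; on complex-linear operators it agrees with
  \<open>adj\<close>, as \<open>adj_blinfun_of\<close> shows.\<close>

definition star :: "'a::{real_inner,banach} oper \<Rightarrow> 'a oper"
  where "star X = (SOME Y. \<forall>x y. inner (ap X x) y = inner x (ap Y y))"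

lemma inner_star: "inner (ap X x) y = inner x (ap (star X) y)"
  unfolding star_def by (rule someI_ex [OF ex_adjoint, rule_format])

lemma inner_star': "inner x (ap X y) = inner (ap (star X) x) y"
  by (metis inner_commute inner_star)

lemma star_eqI: "(\<And>x y. inner (ap X x) y = inner x (ap Y y)) \<Longrightarrow> star X = Y"
  by (rule oper_eqI, rule vector_eq_rdot [THEN iffD1]) (metis inner_commute inner_star)

lemma star_star [simp]: "star (star X) = X"
  by (rule star_eqI) (simp add: inner_star')

lemma star_simps [simp]:
  "star (X + Y) = star X + star Y" "star (X - Y) = star X - star Y"
  "star (X * Y) = star Y * star X" "star (r *\<^sub>R X) = r *\<^sub>R star X"
  "star (- X) = - star X" "star 0 = 0" "star 1 = 1"
  by (rule star_eqI; simp add: inner_simps inner_star)+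

lemma star_eq_0_iff [simp]: "star X = 0 \<longleftrightarrow> X = 0"
  by (metis star_simps(6) star_star)

lemma norm_star [simp]: "norm (star X) = norm X"
proof -
  have "norm (star X) \<le> norm X" for X :: "'a oper"
  proof (rule oper_norm_bound)
    fix y
    show "norm (ap (star X) y) \<le> norm X * norm y"
    proof (cases "ap (star X) y = 0")
      case False
      have "norm (ap (star X) y) * norm (ap (star X) y) = inner (ap X (ap (star X) y)) y"
        by (simp add: inner_star flip: power2_norm_eq_inner power2_eq_square)
      also have "\<dots> \<le> norm (ap X (ap (star X) y)) * norm y"
        by (rule norm_cauchy_schwarz)
      also have "\<dots> \<le> (norm X * norm (ap (star X) y)) * norm y"
        by (intro mult_right_mono norm_ap) auto
      finally show ?thesis
        using False by (simp add: mult.commute mult.left_commute)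
    qed simp
  qed simp
  then show ?thesis
    by (metis antisym star_star)
qed

lemma norm_ap_squared: "(norm (ap X x))\<^sup>2 = inner (ap (star X * X) x) x"
  by (simp add: power2_norm_eq_inner inner_star' )

lemma norm_star_mult: "norm (star X * X) = (norm X)\<^sup>2"
proof (rule antisym)
  show "norm (star X * X) \<le> (norm X)\<^sup>2"
    using norm_mult_ineq [of "star X" X] by (simp add: power2_eq_square)
  have "norm X \<le> sqrt (norm (star X * X))"
  proof (rule oper_norm_bound)
    fix x
    have "(norm (ap X x))\<^sup>2 \<le> norm (ap (star X * X) x) * norm x"
      unfolding norm_ap_squared by (rule norm_cauchy_schwarz)
    also have "\<dots> \<le> (norm (star X * X) * norm x) * norm x"
      by (intro mult_right_mono norm_ap) auto
    also have "\<dots> = (sqrt (norm (star X * X)) * norm x)\<^sup>2"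
      by (simp add: power_mult_distrib power2_eq_square)
    finally show "norm (ap X x) \<le> sqrt (norm (star X * X)) * norm x"
      by (rule power2_le_imp_le) simp
  qed simp
  then show "(norm X)\<^sup>2 \<le> norm (star X * X)"
    by (simp add: real_le_rsqrt sqrt_ge_absD)
qed

definition proj :: "'a::{real_inner,banach} oper \<Rightarrow> bool"
  where "proj P \<longleftrightarrow> star P = P \<and> P * P = P"

lemma norm_proj_le: "proj P \<Longrightarrow> norm P \<le> 1"
  using norm_star_mult [of P] by (cases "norm P = 0") (auto simp: proj_def power2_eq_square)

lemma proj_compl: "proj P \<Longrightarrow> proj (1 - P)"
  by (simp add: proj_def algebra_simps)

lemma proj_mult: "proj P \<Longrightarrow> proj Q \<Longrightarrow> P * Q = Q * P \<Longrightarrow> proj (P * Q)"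
  unfolding proj_def by (metis mult.assoc star_simps(3))

lemma norm_ap_proj_le: "proj P \<Longrightarrow> norm (ap P x) \<le> norm x"
  using norm_ap [of P x] norm_proj_le [of P] mult_right_mono [of "norm P" 1 "norm x"] by auto

lemma ex_proj:
  fixes M :: "'a::{real_inner,banach} set"
  assumes M: "subspace M" "closed M"
  obtains P where "proj P" "\<And>x. ap P x \<in> M" "\<And>x. x \<in> M \<Longrightarrow> ap P x = x"
    "\<And>x m. m \<in> M \<Longrightarrow> inner (x - ap P x) m = 0"
proof -
  obtain p where p: "\<And>x. p x \<in> M" "\<And>x m. m \<in> M \<Longrightarrow> inner (x - p x) m = 0"
  proof -
    have "\<exists>y. y \<in> M \<and> (\<forall>m\<in>M. inner (x - y) m = 0)" for x
      using closed_subspace_orthogonal [OF M, of x] by metis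
    then show thesis
      using that by metis
  qed
  have uniq: "p x = y" if "y \<in> M" "\<And>m. m \<in> M \<Longrightarrow> inner (x - y) m = 0" for x y
  proof -
    have "p x - y \<in> M"
      using M(1) p(1) that(1) by (rule subspace_diff)
    then have "inner (x - y) (p x - y) - inner (x - p x) (p x - y) = 0"
      using p(2) that(2) by simp
    then have "inner (p x - y) (p x - y) = 0"
      by (simp add: inner_simps)
    then show ?thesis
      by simp
  qed
  have "bounded_linear p"
  proof (rule bounded_linear_intro)
    show "p (x + y) = p x + p y" for x y
    proof (rule uniq)
      show "inner (x + y - (p x + p y)) m = 0" if "m \<in> M" for m
        using p(2) [OF that, of x] p(2) [OF that, of y] by (simp add: inner_simps)
    qed (simp add: M(1) p(1) subspace_add)
    show "p (r *\<^sub>R x) = r *\<^sub>R p x" for r x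
    proof (rule uniq)
      show "inner (r *\<^sub>R x - r *\<^sub>R p x) m = 0" if "m \<in> M" for m
        using p(2) [OF that, of x] by (simp add: inner_simps)
    qed (simp add: M(1) p(1) subspace_scale)
    show "norm (p x) \<le> norm x * 1" for x
    proof (cases "p x = 0")
      case False
      have "norm (p x) * norm (p x) = inner x (p x)"
        using p(2) [OF p(1), of x x] by (simp add: inner_simps flip: power2_norm_eq_inner power2_eq_square)
      also have "\<dots> \<le> norm x * norm (p x)"
        by (rule norm_cauchy_schwarz)
      finally show ?thesis
        using False by simp
    qed simp
  qed
  then obtain P where P: "\<And>x. ap P x = p x"
    using ex_oper by metis
  have fixp: "p x = x" if "x \<in> M" for x
    using uniq that by simp
  have "inner (p x) y = inner x (p y)" for x y
  proof -
    have "inner (x - p x) (p y) = 0" "inner (y - p y) (p x) = 0"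
      using p by auto
    then show ?thesis
      by (simp add: inner_simps inner_commute)
  qed
  then have "star P = P"
    by (intro star_eqI) (simp add: P)
  moreover have "P * P = P"
    by (rule oper_eqI) (simp add: P fixp p(1))
  ultimately show thesis
    using that [of P] P p fixp by (simp add: proj_def)
qed

section \<open>Continuous functions of a self-adjoint operator\<close>

definition poly_oper :: "real poly \<Rightarrow> 'a::real_normed_vector oper \<Rightarrow> 'a oper"
  where "poly_oper p X = fold_coeffs (\<lambda>a Y. a *\<^sub>R 1 + X * Y) p 0"

lemma poly_oper_0 [simp]: "poly_oper 0 X = 0"
  by (simp add: poly_oper_def)

lemma poly_oper_pCons [simp]: "poly_oper (pCons a p) X = a *\<^sub>R 1 + X * poly_oper p X"
  by (cases "p = 0"; cases "a = 0") (auto simp: poly_oper_def)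

lemma poly_oper_add [simp]: "poly_oper (p + q) X = poly_oper p X + poly_oper q X"
  by (induction p q rule: poly_induct2) (auto simp: algebra_simps)

lemma poly_oper_smult [simp]: "poly_oper (smult c p) X = c *\<^sub>R poly_oper p X"
  by (induction p) (auto simp: algebra_simps)

lemma poly_oper_minus [simp]: "poly_oper (- p) X = - poly_oper p X"
  using poly_oper_smult [of "-1" p X] by simp

lemma poly_oper_diff [simp]: "poly_oper (p - q) X = poly_oper p X - poly_oper q X"
  using poly_oper_add [of p "- q" X] by simp

lemma poly_oper_mult [simp]: "poly_oper (p * q) X = poly_oper p X * poly_oper q X"
  by (induction p) (auto simp: algebra_simps)

lemma poly_oper_commute: "Y * X = X * Y \<Longrightarrow> Y * poly_oper p X = poly_oper p X * Y"
proof (induction p)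
  case (pCons a p)
  have "Y * (X * poly_oper p X) = X * (Y * poly_oper p X)"
    using pCons.prems by (metis mult.assoc)
  then show ?case
    using pCons by (simp add: algebra_simps)
qed simp

lemma star_poly_oper: "star (poly_oper p X) = poly_oper p (star X)"
proof (induction p)
  case (pCons a p)
  then show ?case
    using poly_oper_commute [of "star X" "star X" p] by simp
qed simp

section \<open>Lower and upper bounds for polynomials of a self-adjoint operator\<close>

definition bounded_below :: "'a::real_normed_vector oper \<Rightarrow> bool"
  where "bounded_below X \<longleftrightarrow> (\<exists>c>0. \<forall>x. c * norm x \<le> norm (ap X x))"

lemma bounded_below_mult:
  assumes "bounded_below X" "bounded_below Y"
  shows "bounded_below (X * Y)"
proof -
  obtain c d where c: "c > 0" "\<And>x. c * norm x \<le> norm (ap X x)"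
    and d: "d > 0" "\<And>x. d * norm x \<le> norm (ap Y x)"
    using assms unfolding bounded_below_def by blast
  have "(c * d) * norm x \<le> norm (ap (X * Y) x)" for x
  proof -
    have "c * (d * norm x) \<le> c * norm (ap Y x)"
      using c(1) d(2) by (simp add: mult_left_mono)
    also have "\<dots> \<le> norm (ap X (ap Y x))"
      by (rule c)
    finally show ?thesis
      by (simp add: mult.assoc)
  qed
  moreover have "c * d > 0"
    using c(1) d(1) by simp
  ultimately show ?thesis
    unfolding bounded_below_def by blast
qed

lemma cpoly_add: "poly (map_poly complex_of_real (p + q)) z =
    poly (map_poly complex_of_real p) z + poly (map_poly complex_of_real q) z"
  by (induction p q rule: poly_induct2) (auto simp: map_poly_pCons algebra_simps)

lemma cpoly_smult: "poly (map_poly complex_of_real (smult c p)) z =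
    of_real c * poly (map_poly complex_of_real p) z"
  by (induction p) (auto simp: map_poly_pCons algebra_simps)

lemma cpoly_mult: "poly (map_poly complex_of_real (p * q)) z =
    poly (map_poly complex_of_real p) z * poly (map_poly complex_of_real q) z"
  by (induction p) (auto simp: map_poly_pCons cpoly_add cpoly_smult algebra_simps)

lemma cpoly_of_real: "poly (map_poly complex_of_real p) (of_real t) = of_real (poly p t)"
  by (induction p) (auto simp: map_poly_pCons)

text \<open>A real root of the complexified polynomial splits off a linear factor. For a non-real
  root \<open>z\<close>, the remainder modulo the real quadratic with roots \<open>z\<close> and its
  conjugate has degree below 2 and vanishes at \<open>z\<close>, hence is zero.\<close>

lemma real_poly_factor:
  fixes p :: "real poly"
  assumes "degree p > 0"
  obtains (linear) a q where "p = [:- a, 1:] * q" "poly p a = 0"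
    | (quadratic) a b q where "b \<noteq> 0" "p = [:a\<^sup>2 + b\<^sup>2, - 2 * a, 1:] * q"
proof -
  have "degree (map_poly complex_of_real p) = degree p"
    using assms by (intro map_poly_degree_eq) auto
  then have "\<not> constant (poly (map_poly complex_of_real p))"
    using assms by (simp add: constant_degree)
  then obtain z where z: "poly (map_poly complex_of_real p) z = 0"
    using fundamental_theorem_of_algebra by blast
  show thesis
  proof (cases "Im z = 0")
    case True
    then have "z = of_real (Re z)"
      by (simp add: complex_eq_iff)
    then have "poly p (Re z) = 0"
      using z by (metis cpoly_of_real of_real_eq_0_iff)
    then show thesis
      using linear by (metis dvdE poly_eq_0_iff_dvd)
  next
    case False
    define a b where "a = Re z" and "b = Im z"
    define s where "s = [:a\<^sup>2 + b\<^sup>2, - 2 * a, 1:]"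
    define m where "m = p mod s"
    have zs: "poly (map_poly complex_of_real s) z = 0"
      by (simp add: s_def map_poly_pCons a_def b_def complex_eq_iff power2_eq_square algebra_simps)
    have "degree m < 2"
      using degree_mod_less' [of s p] by (cases "m = 0") (auto simp: m_def s_def)
    then obtain c d where m: "m = [:c, d:]"
      by (cases m; cases "degree m = 0")
        (auto simp: degree_pCons_eq_if split: if_splits elim: degree_eq_zeroE)
    have "p = (p div s) * s + m"
      by (simp add: m_def)
    then have "poly (map_poly complex_of_real m) z = 0"
      using z zs by (metis add_0 cpoly_add cpoly_mult mult_zero_right)
    then have "of_real c + z * of_real d = 0"
      by (simp add: m map_poly_pCons)
    then have "d = 0" "c = 0"
      using False by (auto simp: complex_eq_iff)
    then have "p = s * (p div s)"
      using \<open>p = (p div s) * s + m\<close> m by (simp add: mult.commute)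
    then show thesis
      using quadratic False by (simp add: s_def b_def a_def)
  qed
qed

text \<open>Induction over real factors. A root \<open>a\<close> lies outside the interval, so X - a
  is bounded below by \<bar>a\<bar> - norm X; an irreducible factor is (X - a)^2 + b^2, whose
  quadratic form is at least b^2.\<close>

lemma bounded_below_poly_oper:
  fixes X :: "'a::{real_inner,banach} oper"
  assumes X: "star X = X"
  shows "(\<And>t. \<bar>t\<bar> \<le> norm X \<Longrightarrow> poly p t \<noteq> 0) \<Longrightarrow> bounded_below (poly_oper p X)"
proof (induction "degree p" arbitrary: p rule: less_induct)
  case less
  show ?case
  proof (cases "degree p > 0")
    case False
    then obtain a where a: "p = [:a:]"
      by (auto elim: degree_eq_zeroE)
    then have "a \<noteq> 0"
      using less.prems [of 0] by simp
    then show ?thesis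
      by (auto simp: bounded_below_def a intro!: exI [of _ "\<bar>a\<bar>"])
  next
    case True
    then have p0: "p \<noteq> 0"
      by auto
    from True show ?thesis
    proof (cases rule: real_poly_factor)
      case (linear a q)
      have "q \<noteq> 0"
        using p0 linear by auto
      then have "degree q < degree p"
        unfolding linear(1) by (subst degree_mult_eq) auto
      moreover have "poly q t \<noteq> 0" if "\<bar>t\<bar> \<le> norm X" for t
        using less.prems [OF that] linear(1) by auto
      ultimately have "bounded_below (poly_oper q X)"
        using less.hyps by blast
      moreover have "bounded_below (poly_oper [:- a, 1:] X)"
        unfolding bounded_below_def
      proof (intro exI conjI allI)
        show "0 < \<bar>a\<bar> - norm X"
          using less.prems [of a] linear(2) by linarith
        fix x
        have "norm (a *\<^sub>R x) \<le> norm (ap X x - a *\<^sub>R x) + norm (ap X x)"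
          by (metis norm_minus_commute norm_triangle_sub add.commute)
        then show "(\<bar>a\<bar> - norm X) * norm x \<le> norm (ap (poly_oper [:- a, 1:] X) x)"
          using norm_ap [of X x] by (simp add: algebra_simps)
      qed
      ultimately show ?thesis
        unfolding linear(1) poly_oper_mult by (intro bounded_below_mult)
    next
      case (quadratic a b q)
      have "q \<noteq> 0"
        using p0 quadratic by auto
      then have "degree q < degree p"
        unfolding quadratic(2) by (subst degree_mult_eq) auto
      moreover have "poly q t \<noteq> 0" if "\<bar>t\<bar> \<le> norm X" for t
        using less.prems [OF that] quadratic(2) by auto
      ultimately have "bounded_below (poly_oper q X)"
        using less.hyps by blast
      moreover have "bounded_below (poly_oper [:a\<^sup>2 + b\<^sup>2, - 2 * a, 1:] X)"
        unfolding bounded_below_def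
      proof (intro exI conjI allI)
        show "0 < b\<^sup>2"
          using quadratic(1) by simp
        fix x
        let ?Y = "poly_oper [:a\<^sup>2 + b\<^sup>2, - 2 * a, 1:] X"
        have two: "(a * 2) *\<^sub>R X = a *\<^sub>R X + a *\<^sub>R X"
          by (metis mult_2_right scaleR_add_left)
        have Y: "?Y = star (X - a *\<^sub>R 1) * (X - a *\<^sub>R 1) + b\<^sup>2 *\<^sub>R 1"
          by (simp add: X two algebra_simps power2_eq_square)
        have "b\<^sup>2 * norm x * norm x \<le> (norm (ap (X - a *\<^sub>R 1) x))\<^sup>2 + b\<^sup>2 * (norm x)\<^sup>2"
          by (simp add: power2_eq_square [of "norm x"])
        also have "\<dots> = inner (ap ?Y x) x"
          unfolding norm_ap_squared Y by (simp add: inner_simps power2_norm_eq_inner)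
        also have "\<dots> \<le> norm (ap ?Y x) * norm x"
          by (rule norm_cauchy_schwarz)
        finally show "b\<^sup>2 * norm x \<le> norm (ap ?Y x)"
          by (cases "x = 0") auto
      qed
      ultimately show ?thesis
        unfolding quadratic(2) poly_oper_mult by (intro bounded_below_mult)
    qed
  qed
qed

lemma norm_diff_scaleR_squared:
  "(norm (u - r *\<^sub>R v))\<^sup>2 = (norm u)\<^sup>2 - 2 * r * inner u v + r\<^sup>2 * (norm v)\<^sup>2"
  by (simp only: power2_norm_eq_inner)
    (simp add: inner_simps inner_commute power2_eq_square algebra_simps)

text \<open>If the norm \<open>N\<close> of Y = p(X) exceeded \<open>M\<close>, then p^2 - N^2 would
  have no zero on the interval and Y^2 - N^2 would be bounded below. But a vector that almost
  attains the norm of the self-adjoint \<open>Y\<close> is almost an eigenvector of Y^2 for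
  N^2.\<close>

lemma norm_poly_oper_le:
  fixes X :: "'a::{real_inner,banach} oper"
  assumes X: "star X = X" and M: "\<And>t. \<bar>t\<bar> \<le> norm X \<Longrightarrow> \<bar>poly p t\<bar> \<le> M"
  shows "norm (poly_oper p X) \<le> M"
proof (rule ccontr)
  define Y N where "Y = poly_oper p X" and "N = norm Y"
  assume "\<not> norm (poly_oper p X) \<le> M"
  then have MN: "M < N"
    by (simp add: Y_def N_def)
  have M0: "0 \<le> M"
    using M [of 0] by (simp add: order.trans [OF abs_ge_zero])
  have Y: "star Y = Y"
    by (simp add: Y_def star_poly_oper X)
  have bb: "bounded_below (poly_oper (p * p - [:N\<^sup>2:]) X)"
  proof (rule bounded_below_poly_oper [OF X])
    fix t :: real
    assume "\<bar>t\<bar> \<le> norm X"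
    then have "\<bar>poly p t\<bar> < N"
      using M [of t] MN by linarith
    then have "(poly p t)\<^sup>2 < N\<^sup>2"
      using power_strict_mono [of "\<bar>poly p t\<bar>" N 2] by simp
    then show "poly (p * p - [:N\<^sup>2:]) t \<noteq> 0"
      by (simp add: power2_eq_square)
  qed
  have "poly_oper (p * p - [:N\<^sup>2:]) X = Y * Y - N\<^sup>2 *\<^sub>R 1"
    by (simp add: Y_def)
  with bb obtain c where c: "c > 0" "\<And>x. c * norm x \<le> norm (ap (Y * Y - N\<^sup>2 *\<^sub>R 1) x)"
    unfolding bounded_below_def by metis
  \<comment> \<open>Chosen so that N^2 (N^2 - b^2) \<le> c^2 while b < N: a vector with
    \<open>b * norm x < norm (ap Y x)\<close> then violates the lower bound \<open>c\<close>. The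
    maximum with 0 takes care of large \<open>c\<close>.\<close>
  define b where "b = sqrt (max 0 (N\<^sup>2 - c\<^sup>2 / N\<^sup>2))"
  have N0: "N > 0"
    using M0 MN by linarith
  have b2: "b\<^sup>2 = max 0 (N\<^sup>2 - c\<^sup>2 / N\<^sup>2)"
    by (simp add: b_def)
  have "b\<^sup>2 < N\<^sup>2"
    unfolding b2 using N0 c(1) by simp
  then have "b < N"
    using N0 by (simp add: power2_less_imp_less)
  then have "\<not> norm Y \<le> b"
    by (simp add: N_def)
  then obtain x where x: "b * norm x < norm (ap Y x)"
    using oper_norm_bound [of b Y] by (auto simp: b_def not_le [symmetric])
  have "c\<^sup>2 * (norm x)\<^sup>2 \<le> (norm (ap (Y * Y - N\<^sup>2 *\<^sub>R 1) x))\<^sup>2"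
    using power_mono [OF c(2) [of x], of 2] c(1) by (simp add: power_mult_distrib)
  also have "\<dots> = (norm (ap Y (ap Y x)))\<^sup>2 - 2 * N\<^sup>2 * (norm (ap Y x))\<^sup>2 + N\<^sup>2 * N\<^sup>2 * (norm x)\<^sup>2"
  proof -
    have "inner (ap Y (ap Y x)) x = (norm (ap Y x))\<^sup>2"
      by (simp add: norm_ap_squared Y)
    then show ?thesis
      using norm_diff_scaleR_squared [of "ap Y (ap Y x)" "N\<^sup>2" x]
      by (simp add: power2_eq_square [of "N\<^sup>2"])
  qed
  also have "\<dots> \<le> N\<^sup>2 * (norm (ap Y x))\<^sup>2 - 2 * N\<^sup>2 * (norm (ap Y x))\<^sup>2 + N\<^sup>2 * N\<^sup>2 * (norm x)\<^sup>2"
    using power_mono [OF norm_ap [of Y "ap Y x"], of 2] by (simp add: N_def power_mult_distrib)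
  also have "\<dots> = N\<^sup>2 * (N\<^sup>2 * (norm x)\<^sup>2 - (norm (ap Y x))\<^sup>2)"
    by (simp add: algebra_simps)
  also have "\<dots> < N\<^sup>2 * (N\<^sup>2 * (norm x)\<^sup>2 - (b * norm x)\<^sup>2)"
  proof -
    have "(b * norm x)\<^sup>2 < (norm (ap Y x))\<^sup>2"
      using x by (intro power_strict_mono) (auto simp: b_def)
    then show ?thesis
      using N0 by simp
  qed
  also have "\<dots> = N\<^sup>2 * (N\<^sup>2 - b\<^sup>2) * (norm x)\<^sup>2"
    by (simp add: algebra_simps power_mult_distrib)
  also have "\<dots> \<le> c\<^sup>2 * (norm x)\<^sup>2"
  proof (rule mult_right_mono)
    have "N\<^sup>2 - b\<^sup>2 \<le> c\<^sup>2 / N\<^sup>2"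
      unfolding b2 by auto
    then show "N\<^sup>2 * (N\<^sup>2 - b\<^sup>2) \<le> c\<^sup>2"
      using N0 by (simp add: field_simps)
  qed simp
  finally show False
    by simp
qed

section \<open>The continuous functional calculus on the interval bounded by the norm\<close>

abbreviation spec_range :: "'a::real_normed_vector oper \<Rightarrow> real set"
  where "spec_range X \<equiv> {- norm X..norm X}"

text \<open>A relation precedes the function \<open>calc\<close> because the rules for sums and
  products come from combining approximating sequences; that \<open>Y\<close> depends only on the
  values of \<open>f\<close> on the interval follows from \<open>calc_rel_norm_le\<close>.\<close>

definition calc_rel :: "'a::real_normed_vector oper \<Rightarrow> (real \<Rightarrow> real) \<Rightarrow> 'a oper \<Rightarrow> bool"
  where "calc_rel X f Y \<longleftrightarrow>
    (\<exists>p. uniform_limit (spec_range X) (\<lambda>n. poly (p n)) f sequentially \<and>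
         (\<lambda>n. poly_oper (p n) X) \<longlonglongrightarrow> Y)"

definition calc :: "'a::real_normed_vector oper \<Rightarrow> (real \<Rightarrow> real) \<Rightarrow> 'a oper"
  where "calc X f = (SOME Y. calc_rel X f Y)"

lemma calc_rel_norm_le:
  fixes X :: "'a::{real_inner,banach} oper"
  assumes X: "star X = X" and Y: "calc_rel X f Y" and M: "\<And>t. \<bar>t\<bar> \<le> norm X \<Longrightarrow> \<bar>f t\<bar> \<le> M"
  shows "norm Y \<le> M"
proof (rule field_le_epsilon)
  fix e :: real
  assume e: "e > 0"
  obtain p where p: "uniform_limit (spec_range X) (\<lambda>n. poly (p n)) f sequentially"
    and lim: "(\<lambda>n. poly_oper (p n) X) \<longlonglongrightarrow> Y"
    using Y by (auto simp: calc_rel_def)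
  have "\<forall>\<^sub>F n in sequentially. \<forall>t\<in>spec_range X. dist (poly (p n) t) (f t) < e"
    using p e by (auto simp: uniform_limit_iff)
  then have "\<forall>\<^sub>F n in sequentially. norm (poly_oper (p n) X) \<le> M + e"
  proof (rule eventually_mono)
    fix n
    assume n: "\<forall>t\<in>spec_range X. dist (poly (p n) t) (f t) < e"
    show "norm (poly_oper (p n) X) \<le> M + e"
    proof (rule norm_poly_oper_le [OF X])
      fix t :: real
      assume t: "\<bar>t\<bar> \<le> norm X"
      then have "t \<in> spec_range X"
        by auto
      then have "\<bar>poly (p n) t - f t\<bar> < e"
        using n by (auto simp: dist_norm)
      then show "\<bar>poly (p n) t\<bar> \<le> M + e"
        using M [OF t] by linarith
    qed
  qed
  then show "norm Y \<le> M + e"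
    by (rule tendsto_upperbound [OF tendsto_norm [OF lim]]) simp
qed

lemma poly_fun:
  "poly (p + q) = (\<lambda>t. poly p t + poly q t)" "poly (p - q) = (\<lambda>t. poly p t - poly q t)"
  "poly (p * q) = (\<lambda>t. poly p t * poly q t)" for p q :: "real poly"
  by auto

lemma calc_rel_diff:
  assumes "calc_rel X f Y" "calc_rel X g Z"
  shows "calc_rel X (\<lambda>t. f t - g t) (Y - Z)"
proof -
  obtain p q where
    "uniform_limit (spec_range X) (\<lambda>n. poly (p n)) f sequentially" "(\<lambda>n. poly_oper (p n) X) \<longlonglongrightarrow> Y"
    "uniform_limit (spec_range X) (\<lambda>n. poly (q n)) g sequentially" "(\<lambda>n. poly_oper (q n) X) \<longlonglongrightarrow> Z"
    using assms by (auto simp: calc_rel_def)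
  then show ?thesis
    unfolding calc_rel_def
    by (intro exI [of _ "\<lambda>n. p n - q n"])
      (simp add: poly_fun uniform_limit_minus tendsto_diff)
qed

lemma calc_rel_unique:
  fixes X :: "'a::{real_inner,banach} oper"
  assumes X: "star X = X" and "calc_rel X f Y" "calc_rel X g Z"
    and "\<And>t. \<bar>t\<bar> \<le> norm X \<Longrightarrow> f t = g t"
  shows "Y = Z"
  using calc_rel_norm_le [OF X calc_rel_diff [OF assms(2,3)], of 0] assms(4) by simp

lemma calc_rel_add:
  assumes "calc_rel X f Y" "calc_rel X g Z"
  shows "calc_rel X (\<lambda>t. f t + g t) (Y + Z)"
proof -
  obtain p q where
    "uniform_limit (spec_range X) (\<lambda>n. poly (p n)) f sequentially" "(\<lambda>n. poly_oper (p n) X) \<longlonglongrightarrow> Y"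
    "uniform_limit (spec_range X) (\<lambda>n. poly (q n)) g sequentially" "(\<lambda>n. poly_oper (q n) X) \<longlonglongrightarrow> Z"
    using assms by (auto simp: calc_rel_def)
  then show ?thesis
    unfolding calc_rel_def
    by (intro exI [of _ "\<lambda>n. p n + q n"])
      (simp add: poly_fun uniform_limit_add tendsto_add)
qed

lemma calc_rel_mult:
  assumes "calc_rel X f Y" "calc_rel X g Z"
    and cont: "continuous_on (spec_range X) f" "continuous_on (spec_range X) g"
  shows "calc_rel X (\<lambda>t. f t * g t) (Y * Z)"
proof -
  obtain p q where pq:
    "uniform_limit (spec_range X) (\<lambda>n. poly (p n)) f sequentially" "(\<lambda>n. poly_oper (p n) X) \<longlonglongrightarrow> Y"
    "uniform_limit (spec_range X) (\<lambda>n. poly (q n)) g sequentially" "(\<lambda>n. poly_oper (q n) X) \<longlonglongrightarrow> Z"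
    using assms by (auto simp: calc_rel_def)
  have "bounded (f ` spec_range X)" "bounded (g ` spec_range X)"
    using cont by (auto intro!: compact_imp_bounded compact_continuous_image)
  then have "uniform_limit (spec_range X) (\<lambda>n t. poly (p n) t * poly (q n) t) (\<lambda>t. f t * g t) sequentially"
    using pq by (intro uniform_limit_intros)
  then show ?thesis
    using pq unfolding calc_rel_def
    by (intro exI [of _ "\<lambda>n. p n * q n"]) (simp add: poly_fun tendsto_mult)
qed

lemma calc_rel_poly: "calc_rel X (poly p) (poly_oper p X)"
  unfolding calc_rel_def by (rule exI [of _ "\<lambda>_. p"]) (auto intro: uniform_limit_intros)

lemma Weierstrass_poly:
  fixes f :: "real \<Rightarrow> real"
  assumes "compact S" "continuous_on S f" "0 < e"
  shows "\<exists>p. \<forall>t\<in>S. \<bar>f t - poly p t\<bar> < e"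
proof -
  obtain g where g: "real_polynomial_function g" "\<And>t. t \<in> S \<Longrightarrow> \<bar>f t - g t\<bar> < e"
    using Stone_Weierstrass_real_polynomial_function [OF assms] by blast
  then obtain a n where "g = (\<lambda>x. \<Sum>i\<le>n. a i * x ^ i)"
    by (auto simp: real_polynomial_function_iff_sum)
  then have "g = poly (\<Sum>i\<le>n. monom (a i) i)"
    by (auto simp: poly_sum poly_monom)
  then show ?thesis
    using g(2) by blast
qed

text \<open>Weierstrass polynomials converge uniformly to \<open>f\<close>, and
  \<open>norm_poly_oper_le\<close> turns this into a Cauchy sequence of operators.\<close>

lemma calc_rel_calc:
  fixes X :: "'a::{real_inner,banach} oper"
  assumes X: "star X = X" and cont: "continuous_on (spec_range X) f"
  shows "calc_rel X f (calc X f)"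
  unfolding calc_def
proof (rule someI_ex)
  have "\<exists>p. \<forall>t\<in>spec_range X. \<bar>f t - poly p t\<bar> < inverse (real (Suc n))" for n
    by (rule Weierstrass_poly [OF _ cont]) auto
  then obtain p where p: "\<And>n t. t \<in> spec_range X \<Longrightarrow> \<bar>f t - poly (p n) t\<bar> < inverse (real (Suc n))"
    by metis
  have small: "\<exists>N. \<forall>n\<ge>N. inverse (real (Suc n)) < e" if e: "e > 0" for e :: real
  proof -
    obtain N where N: "inverse (real (Suc N)) < e"
      using reals_Archimedean [OF e] by auto
    have "inverse (real (Suc n)) < e" if "n \<ge> N" for n
    proof -
      have "inverse (real (Suc n)) \<le> inverse (real (Suc N))"
        using that by (intro le_imp_inverse_le) auto
      then show ?thesis
        using N by linarith
    qed
    then show ?thesis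
      by blast
  qed
  have unif: "uniform_limit (spec_range X) (\<lambda>n. poly (p n)) f sequentially"
    unfolding uniform_limit_iff eventually_sequentially
  proof (intro allI impI)
    fix e :: real
    assume "e > 0"
    then obtain N where "\<forall>n\<ge>N. inverse (real (Suc n)) < e"
      using small by blast
    then have "\<forall>n\<ge>N. \<forall>t\<in>spec_range X. dist (poly (p n) t) (f t) < e"
      using p by (metis abs_minus_commute dist_real_def less_trans)
    then show "\<exists>N. \<forall>n\<ge>N. \<forall>t\<in>spec_range X. dist (poly (p n) t) (f t) < e"
      by blast
  qed
  have "Cauchy (\<lambda>n. poly_oper (p n) X)"
  proof (rule CauchyI)
    fix e :: real
    assume e: "e > 0"
    then obtain N where N: "\<And>n. n \<ge> N \<Longrightarrow> inverse (real (Suc n)) < e / 3"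
      using small [of "e / 3"] by auto
    have "norm (poly_oper (p m) X - poly_oper (p n) X) < e" if mn: "m \<ge> N" "n \<ge> N" for m n
    proof -
      have "norm (poly_oper (p m - p n) X) \<le> 2 * e / 3"
      proof (rule norm_poly_oper_le [OF X])
        fix t :: real
        assume "\<bar>t\<bar> \<le> norm X"
        then have "t \<in> spec_range X"
          by auto
        then have "\<bar>f t - poly (p m) t\<bar> < e / 3" "\<bar>f t - poly (p n) t\<bar> < e / 3"
          using p [of t m] p [of t n] N [OF mn(1)] N [OF mn(2)] by (meson less_trans)+
        then show "\<bar>poly (p m - p n) t\<bar> \<le> 2 * e / 3"
          unfolding poly_diff by linarith
      qed
      then show ?thesis
        using e by simp
    qed
    then show "\<exists>M. \<forall>m\<ge>M. \<forall>n\<ge>M. norm (poly_oper (p m) X - poly_oper (p n) X) < e"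
      by blast
  qed
  then show "\<exists>Y. calc_rel X f Y"
    using unif Cauchy_convergent unfolding calc_rel_def convergent_def by blast
qed

context
  fixes X :: "'a::{real_inner,banach} oper"
  assumes X: "star X = X"
begin

lemma calc_eqI:
  assumes "calc_rel X g Y" "continuous_on (spec_range X) f" "\<And>t. \<bar>t\<bar> \<le> norm X \<Longrightarrow> f t = g t"
  shows "calc X f = Y"
  using calc_rel_unique [OF X calc_rel_calc [OF X assms(2)] assms(1)] assms(3) by blast

lemma calc_add:
  assumes "continuous_on (spec_range X) f" "continuous_on (spec_range X) g"
  shows "calc X (\<lambda>t. f t + g t) = calc X f + calc X g"
  by (rule calc_eqI [OF calc_rel_add]) (auto intro: calc_rel_calc X continuous_intros assms)

lemma calc_diff:
  assumes "continuous_on (spec_range X) f" "continuous_on (spec_range X) g"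
  shows "calc X (\<lambda>t. f t - g t) = calc X f - calc X g"
  by (rule calc_eqI [OF calc_rel_diff]) (auto intro: calc_rel_calc X continuous_intros assms)

lemma calc_mult:
  assumes "continuous_on (spec_range X) f" "continuous_on (spec_range X) g"
  shows "calc X (\<lambda>t. f t * g t) = calc X f * calc X g"
  by (rule calc_eqI [OF calc_rel_mult]) (auto intro: calc_rel_calc X continuous_intros assms)

lemma calc_cong:
  assumes "continuous_on (spec_range X) f" "\<And>t. \<bar>t\<bar> \<le> norm X \<Longrightarrow> f t = g t"
  shows "calc X f = calc X g"
proof -
  have "continuous_on (spec_range X) g"
    using assms by (subst continuous_on_cong [of _ _ g f]) auto
  then show ?thesis
    by (rule calc_eqI [OF calc_rel_calc [OF X]]) (auto simp: assms)
qed

lemma calc_const: "calc X (\<lambda>t. c) = c *\<^sub>R 1"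
  by (rule calc_eqI [OF calc_rel_poly [of X "[:c:]", simplified]]) (auto intro: continuous_intros)

lemma calc_id: "calc X (\<lambda>t. t) = X"
  by (rule calc_eqI [OF calc_rel_poly [of X "[:0, 1:]", simplified]]) (auto intro: continuous_intros)

lemma calc_cmult:
  assumes "continuous_on (spec_range X) f"
  shows "calc X (\<lambda>t. c * f t) = c *\<^sub>R calc X f"
  by (subst calc_mult) (auto intro: continuous_intros assms simp: calc_const)

lemma norm_calc_le:
  assumes "continuous_on (spec_range X) f" "\<And>t. \<bar>t\<bar> \<le> norm X \<Longrightarrow> \<bar>f t\<bar> \<le> M"
  shows "norm (calc X f) \<le> M"
  using calc_rel_norm_le [OF X calc_rel_calc [OF X assms(1)]] assms(2) by blast

text \<open>Symmetry, commutation and membership in an algebra pass in this way from polynomials to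
  continuous functions.\<close>

lemma calc_in_closed:
  assumes "closed C" "\<And>p. poly_oper p X \<in> C" "continuous_on (spec_range X) f"
  shows "calc X f \<in> C"
  using calc_rel_calc [OF X assms(3)] assms(1,2) closed_sequentially unfolding calc_rel_def by metis

lemma star_calc:
  assumes "continuous_on (spec_range X) f"
  shows "star (calc X f) = calc X f"
proof -
  have "bounded_linear (star :: 'a oper \<Rightarrow> _)"
    by (rule bounded_linear_intro [of _ 1]) auto
  then have "continuous_on UNIV (star :: 'a oper \<Rightarrow> _)"
    by (rule linear_continuous_on)
  then have "closed {Y :: 'a oper. star Y = Y}"
    by (intro closed_Collect_eq continuous_intros) auto
  then show ?thesis
    using calc_in_closed [of "{Y. star Y = Y}"] assms by (simp add: star_poly_oper X)
qed

lemma calc_commute: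
  assumes "Y * X = X * Y" "continuous_on (spec_range X) f"
  shows "Y * calc X f = calc X f * Y"
proof -
  have "closed {Z. Y * Z = Z * Y}"
    by (intro closed_Collect_eq continuous_intros)
  then show ?thesis
    using calc_in_closed [of "{Z. Y * Z = Z * Y}"] assms by (simp add: poly_oper_commute)
qed

text \<open>On the interval \<open>f\<close> is the square of a continuous function, so
  \<open>calc X f\<close> has the form \<open>star Y * Y\<close>.\<close>

lemma calc_nonneg:
  assumes "continuous_on (spec_range X) f" "\<And>t. \<bar>t\<bar> \<le> norm X \<Longrightarrow> 0 \<le> f t"
  shows "0 \<le> inner (ap (calc X f) x) x"
proof -
  let ?g = "\<lambda>t. sqrt (f t)"
  have g: "continuous_on (spec_range X) ?g"
    by (intro continuous_intros assms)
  have "calc X f = calc X (\<lambda>t. ?g t * ?g t)"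
    using assms by (intro calc_cong) auto
  also have "\<dots> = star (calc X ?g) * calc X ?g"
    unfolding star_calc [OF g] by (rule calc_mult [OF g g])
  finally show ?thesis
    by (metis norm_ap_squared zero_le_power2)
qed

end

section \<open>Norm estimates by reducing projections and quadratic forms\<close>

lemma norm_proj_split: "proj P \<Longrightarrow> (norm x)\<^sup>2 = (norm (ap P x))\<^sup>2 + (norm (ap (1 - P) x))\<^sup>2"
proof -
  assume P: "proj P"
  then have "ap P (ap P x) = ap P x"
    by (simp add: proj_def flip: ap_simps(6))
  then have "inner (ap P x) (ap P x) = inner (ap P x) x"
    using P by (metis inner_star proj_def)
  then show ?thesis
    by (simp add: power2_norm_eq_inner inner_diff_left inner_diff_right inner_commute)
qed

text \<open>\<open>Z\<close> is block diagonal with respect to \<open>P\<close>, so by Pythagoras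
  its norm is the larger of those of the two blocks. Estimates on successive pieces therefore do not
  add up.\<close>

lemma norm_le_split:
  assumes P: "proj P" and comm: "P * Z = Z * P"
    and "norm (Z * P) \<le> M" "norm (Z * (1 - P)) \<le> M"
  shows "norm Z \<le> M"
proof (rule oper_norm_bound)
  show M: "0 \<le> M"
    using assms(3) norm_ge_zero order_trans by blast
  fix x
  have PP: "P * P = P"
    using P by (simp add: proj_def)
  have part: "(norm (ap (Z * Q) x))\<^sup>2 \<le> M\<^sup>2 * (norm (ap Q x))\<^sup>2"
    if "norm (Z * Q) \<le> M" "Q * Q = Q" for Q
  proof -
    have "norm (ap (Z * Q) (ap Q x)) \<le> M * norm (ap Q x)"
      using norm_ap [of "Z * Q" "ap Q x"] mult_right_mono [OF that(1), of "norm (ap Q x)"] by simp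
    moreover have "ap (Z * Q) (ap Q x) = ap (Z * Q) x"
      by (metis ap_simps(6) that(2))
    ultimately show ?thesis
      by (metis norm_ge_zero power_mono power_mult_distrib)
  qed
  have "(norm (ap Z x))\<^sup>2 = (norm (ap (P * Z) x))\<^sup>2 + (norm (ap ((1 - P) * Z) x))\<^sup>2"
    using norm_proj_split [OF P, of "ap Z x"] by simp
  also have "\<dots> = (norm (ap (Z * P) x))\<^sup>2 + (norm (ap (Z * (1 - P)) x))\<^sup>2"
    by (simp add: comm left_diff_distrib right_diff_distrib)
  also have "\<dots> \<le> M\<^sup>2 * (norm (ap P x))\<^sup>2 + M\<^sup>2 * (norm (ap (1 - P) x))\<^sup>2"
    using assms(3,4) by (intro add_mono part) (auto simp: PP algebra_simps)
  also have "\<dots> = (M * norm x)\<^sup>2"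
    using norm_proj_split [OF P, of x] by (simp add: algebra_simps power_mult_distrib)
  finally show "norm (ap Z x) \<le> M * norm x"
    by (rule power2_le_imp_le) (simp add: M)
qed

text \<open>Polarization: four times \<open>inner (ap Y x) y\<close> is a difference of two values
  of the form, and \<open>y\<close> is taken as the multiple of \<open>ap Y x\<close> which has the
  length of \<open>x\<close>.\<close>

lemma norm_selfadjoint_le:
  fixes Y :: "'a::{real_inner,banach} oper"
  assumes Y: "star Y = Y" and M: "0 \<le> M"
    and form: "\<And>x. \<bar>inner (ap Y x) x\<bar> \<le> M * (norm x)\<^sup>2"
  shows "norm Y \<le> M"
proof (rule oper_norm_bound [OF M])
  fix x
  show "norm (ap Y x) \<le> M * norm x"
  proof (cases "ap Y x = 0")
    case False
    then have x0: "norm x > 0"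
      by auto
    define y where "y = (norm x / norm (ap Y x)) *\<^sub>R ap Y x"
    have ny: "norm y = norm x"
      using False by (simp add: y_def)
    have "4 * inner (ap Y x) y = inner (ap Y (x + y)) (x + y) - inner (ap Y (x - y)) (x - y)"
      using inner_star' [of y Y x]
      by (simp add: Y inner_simps inner_commute [of "ap Y y"] inner_commute [of y "ap Y x"])
    also have "\<dots> \<le> M * (norm (x + y))\<^sup>2 + M * (norm (x - y))\<^sup>2"
      using form [of "x + y"] form [of "x - y"] by linarith
    also have "\<dots> = M * (2 * (norm x)\<^sup>2 + 2 * (norm y)\<^sup>2)"
      by (simp add: power2_norm_eq_inner inner_simps inner_commute algebra_simps)
    finally have "inner (ap Y x) y \<le> M * (norm x)\<^sup>2"
      by (simp add: ny)
    moreover have "inner (ap Y x) y = norm x * norm (ap Y x)"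
      using False by (simp add: y_def power2_eq_square flip: power2_norm_eq_inner)
    ultimately show ?thesis
      using x0 by (simp add: power2_eq_square mult.left_commute)
  qed (simp add: M)
qed

text \<open>The link from spectral projections, which control quadratic forms, to the operator norm
  on a reducing subspace.\<close>

lemma norm_le_of_form_bounds:
  fixes X E :: "'a::{real_inner,banach} oper"
  assumes X: "star X = X" and E: "proj E" "E * X = X * E" and M: "0 \<le> M"
    and up: "\<And>x. inner (ap X (ap E x)) (ap E x) \<le> (s + M) * (norm (ap E x))\<^sup>2"
    and lo: "\<And>x. (s - M) * (norm (ap E x))\<^sup>2 \<le> inner (ap X (ap E x)) (ap E x)"
  shows "norm ((X - s *\<^sub>R 1) * E) \<le> M"
proof (rule norm_selfadjoint_le [OF _ M])
  have E': "star E = E" "E * E = E"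
    using E(1) by (auto simp: proj_def)
  show "star ((X - s *\<^sub>R 1) * E) = (X - s *\<^sub>R 1) * E"
    by (simp add: X E E' algebra_simps)
  fix x
  have EE: "(X - s *\<^sub>R 1) * E = E * ((X - s *\<^sub>R 1) * E)"
    using E(2) E'(2) by (simp add: algebra_simps) (metis mult.assoc)
  have "inner (ap ((X - s *\<^sub>R 1) * E) x) x = inner (ap E (ap ((X - s *\<^sub>R 1) * E) x)) x"
    by (metis EE ap_simps(6))
  also have "\<dots> = inner (ap ((X - s *\<^sub>R 1) * E) x) (ap E x)"
    using E'(1) by (metis inner_star)
  also have "\<dots> = inner (ap X (ap E x)) (ap E x) - s * (norm (ap E x))\<^sup>2"
    by (simp add: inner_simps power2_norm_eq_inner)
  finally have "\<bar>inner (ap ((X - s *\<^sub>R 1) * E) x) x\<bar> \<le> M * (norm (ap E x))\<^sup>2"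
    using up [of x] lo [of x] by (simp add: abs_le_iff algebra_simps)
  also have "\<dots> \<le> M * (norm x)\<^sup>2"
    using M norm_ap_proj_le [OF E(1), of x] by (intro mult_left_mono power_mono) auto
  finally show "\<bar>inner (ap ((X - s *\<^sub>R 1) * E) x) x\<bar> \<le> M * (norm x)\<^sup>2" .
qed

section \<open>Range projections\<close>

lemma subspace_closure:
  fixes S :: "'a::real_normed_vector set"
  assumes S: "subspace S"
  shows "subspace (closure S)"
  unfolding subspace_def
proof (intro conjI ballI allI)
  show "0 \<in> closure S"
    using S closure_subset subspace_0 by blast
  fix x y
  assume "x \<in> closure S" "y \<in> closure S"
  then obtain f g where "\<And>n. f n \<in> S" "f \<longlonglongrightarrow> x" "\<And>n. g n \<in> S" "g \<longlonglongrightarrow> y"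
    unfolding closure_sequential by metis
  then show "x + y \<in> closure S"
    unfolding closure_sequential using S
    by (intro exI [of _ "\<lambda>n. f n + g n"]) (auto intro: tendsto_add subspace_add)
next
  fix r x
  assume "x \<in> closure S"
  then obtain f where "\<And>n. f n \<in> S" "f \<longlonglongrightarrow> x"
    unfolding closure_sequential by metis
  then show "r *\<^sub>R x \<in> closure S"
    unfolding closure_sequential using S
    by (intro exI [of _ "\<lambda>n. r *\<^sub>R f n"]) (auto intro: tendsto_scaleR subspace_scale)
qed

definition rproj :: "'a::{real_inner,banach} oper \<Rightarrow> 'a oper"
  where "rproj X = (SOME P. proj P \<and> P * X = X \<and> (\<forall>x. ap P x \<in> closure (range (ap X))))"

lemma rproj: "proj (rproj X)" "rproj X * X = X" "ap (rproj X) x \<in> closure (range (ap X))"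
proof -
  have "subspace (range (ap X))"
    by (intro linear_subspace_image bounded_linear.linear [OF bounded_linear_ap]) auto
  then obtain P where "proj P" "\<And>x. ap P x \<in> closure (range (ap X))"
    "\<And>x. x \<in> closure (range (ap X)) \<Longrightarrow> ap P x = x"
    using ex_proj [OF subspace_closure closed_closure] by metis
  moreover from this have "P * X = X"
    by (intro oper_eqI) (metis ap_simps(6) closure_subset rangeI subsetD)
  ultimately have "\<exists>P. proj P \<and> P * X = X \<and> (\<forall>x. ap P x \<in> closure (range (ap X)))"
    by blast
  from someI_ex [OF this] show "proj (rproj X)" "rproj X * X = X"
    "ap (rproj X) x \<in> closure (range (ap X))"
    by (auto simp: rproj_def)
qed

text \<open>Kernels are closed, so vanishing on the range extends to its closure. Identities for
  \<open>X\<close> are carried over to its range projection by this lemma.\<close>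

lemma rproj_annihilate:
  assumes "Y * X = 0"
  shows "Y * rproj X = 0"
proof (rule oper_eqI)
  fix x
  have "closed {y. ap Y y = 0}"
    by (intro closed_Collect_eq continuous_ap continuous_intros)
  moreover have "range (ap X) \<subseteq> {y. ap Y y = 0}"
    using assms by (auto simp flip: ap_simps(6))
  ultimately have "closure (range (ap X)) \<subseteq> {y. ap Y y = 0}"
    by (rule closure_minimal [rotated])
  then show "ap (Y * rproj X) x = ap 0 x"
    using rproj(3) by auto
qed

lemma mult_rproj: "star X = X \<Longrightarrow> X * rproj X = X"
  using rproj(1,2) [of X] by (metis proj_def star_simps(3))

lemma rproj_0 [simp]: "rproj 0 = 0"
  using rproj_annihilate [of 1 0] by simp

text \<open>Multiplying by \<open>star W\<close> on the right leaves a sum of two positive operators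
  that is 0, so both vanish. Consequently the range projection of such a sum of squares lies above
  the ranges of \<open>U\<close> and \<open>V\<close> and can serve as a join of two
  projections.\<close>

lemma star_square_annihilate:
  assumes "W * (U * star U + V * star V) = 0"
  shows "W * U = 0"
proof -
  have "star (W * U) = 0"
  proof (rule oper_eqI)
    fix x
    have "W * (U * star U + V * star V) * star W = 0"
      using assms by simp
    then have "star (star (W * U)) * star (W * U) + star (star (W * V)) * star (W * V) = 0"
      by (simp add: algebra_simps)
    then have "inner (ap (star (star (W * U)) * star (W * U)) x) x
        + inner (ap (star (star (W * V)) * star (W * V)) x) x = 0"
      by (metis ap_simps(1,5) inner_add_left inner_zero_left)
    then have "(norm (ap (star (W * U)) x))\<^sup>2 + (norm (ap (star (W * V)) x))\<^sup>2 = 0"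
      by (simp only: norm_ap_squared)
    then show "ap (star (W * U)) x = ap 0 x"
      by (simp add: sum_power2_eq_zero_iff)
  qed
  then show ?thesis
    by (metis star_eq_0_iff)
qed

lemma rproj_sum_squares: "rproj (U * star U + V * star V) * U = U"
proof -
  have "(1 - rproj (U * star U + V * star V)) * (U * star U + V * star V) = 0"
    by (simp add: left_diff_distrib rproj(2) del: distrib_left)
  then have "(1 - rproj (U * star U + V * star V)) * U = 0"
    by (rule star_square_annihilate)
  then show ?thesis
    by (simp add: left_diff_distrib)
qed

text \<open>
  The kernel projection of a self-adjoint \<open>X\<close> is the strong limit of \<open>(1 - c X\<^sup>2)\<^sup>n\<close>
  as soon as \<open>c \<parallel>X\<parallel>\<^sup>2 \<le> 1\<close>.
\<close>

definition ker_poly :: "'a::real_normed_vector oper \<Rightarrow> real poly"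
  where "ker_poly X = [:1, 0, - inverse (1 + (norm X)\<^sup>2):]"

lemma ker_poly_tendsto:
  fixes X :: "'a::{real_inner,banach} oper"
  assumes X: "star X = X"
  shows "(\<lambda>n. ap (poly_oper (ker_poly X ^ n) X) x) \<longlonglongrightarrow> ap (1 - rproj X) x"
proof -
  define c where "c = inverse (1 + (norm X)\<^sup>2)"
  define D where "D = (\<lambda>n. poly_oper (ker_poly X ^ n) X)"
  have c: "c > 0"
    by (simp add: c_def add_pos_nonneg)
  have kp: "poly (ker_poly X) t = 1 - c * t\<^sup>2" for t
    by (simp add: ker_poly_def c_def power2_eq_square)
  have ct: "0 \<le> c * t\<^sup>2 \<and> c * t\<^sup>2 \<le> 1" if "\<bar>t\<bar> \<le> norm X" for t
  proof -
    have "t\<^sup>2 \<le> 1 + (norm X)\<^sup>2"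
      using power_mono [OF that, of 2] by simp
    then have "c * t\<^sup>2 \<le> c * (1 + (norm X)\<^sup>2)"
      using c by (intro mult_left_mono) auto
    also have "\<dots> = 1"
      using c unfolding c_def by simp
    finally show ?thesis
      using c by simp
  qed
  have D1: "norm (D n) \<le> 1" for n
    unfolding D_def
  proof (rule norm_poly_oper_le [OF X])
    fix t :: real
    assume "\<bar>t\<bar> \<le> norm X"
    then show "\<bar>poly (ker_poly X ^ n) t\<bar> \<le> 1"
      using ct [of t] by (simp add: kp power_abs power_le_one)
  qed
  \<comment> \<open>On the range of \<open>X\<close> the powers decay in norm: with s = c t^2,
    Bernoulli's inequality gives (1 - s)^n (1 + n s) \<le> (1 - s^2)^n \<le> 1, which bounds t^2 (1
    - s)^n by 1 / (n c).\<close>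
  have DX: "norm (D n * X) \<le> sqrt (inverse (real n * c))" if n: "n > 0" for n
  proof -
    have "norm (poly_oper (ker_poly X ^ n * [:0, 1:]) X) \<le> sqrt (inverse (real n * c))"
    proof (rule norm_poly_oper_le [OF X])
      fix t :: real
      assume t: "\<bar>t\<bar> \<le> norm X"
      define s where "s = c * t\<^sup>2"
      have s: "0 \<le> s" "s \<le> 1"
        using ct [OF t] by (auto simp: s_def)
      have "(1 - s) ^ n * (1 + real n * s) \<le> (1 - s) ^ n * (1 + s) ^ n"
        using s by (intro mult_left_mono Bernoulli_inequality) auto
      also have "\<dots> = (1 - s\<^sup>2) ^ n"
        by (simp add: power2_eq_square algebra_simps flip: power_mult_distrib)
      also have "\<dots> \<le> 1"
        using s by (intro power_le_one) (auto simp: power_le_one)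
      finally have "(1 - s) ^ n * (1 + real n * s) \<le> 1" .
      moreover have "(1 - s) ^ n * (real n * s) \<le> (1 - s) ^ n * (1 + real n * s)"
        using s by (intro mult_left_mono) auto
      ultimately have "(1 - s) ^ n * (real n * s) \<le> 1"
        by linarith
      then have "t\<^sup>2 * (1 - s) ^ n \<le> inverse (real n * c)"
        using n c by (simp add: s_def field_simps)
      moreover have "t\<^sup>2 * ((1 - s) ^ n)\<^sup>2 \<le> t\<^sup>2 * (1 - s) ^ n"
        using s by (intro mult_left_mono) (auto simp: power2_eq_square intro!: mult_left_le power_le_one)
      ultimately have "(t * (1 - s) ^ n)\<^sup>2 \<le> inverse (real n * c)"
        by (simp add: power_mult_distrib)
      then have "\<bar>t * (1 - s) ^ n\<bar> \<le> sqrt (inverse (real n * c))"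
        by (simp add: real_le_rsqrt)
      then show "\<bar>poly (ker_poly X ^ n * [:0, 1:]) t\<bar> \<le> sqrt (inverse (real n * c))"
        by (simp add: kp s_def mult.commute)
    qed
    then show ?thesis
      using poly_oper_commute [of X X "ker_poly X ^ n"] by (simp add: D_def)
  qed
  have lim0: "(\<lambda>n. norm (D n * X)) \<longlonglongrightarrow> 0"
  proof (rule tendsto_sandwich [where f = "\<lambda>_. 0"])
    show "\<forall>\<^sub>F n in sequentially. norm (D n * X) \<le> sqrt (inverse (real n * c))"
      using DX eventually_gt_at_top by (rule eventually_mono [rotated])
    show "(\<lambda>n. sqrt (inverse (real n * c))) \<longlonglongrightarrow> 0"
    proof -
      have "(\<lambda>n. sqrt (inverse (real n) * inverse c)) \<longlonglongrightarrow> sqrt (0 * inverse c)"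
        by (intro tendsto_intros lim_inverse_n)
      then show ?thesis
        by simp
    qed
  qed auto
  \<comment> \<open>Decay on the range itself extends to the closure because every
    \<open>D n\<close> is a contraction.\<close>
  have range0: "(\<lambda>n. ap (D n) (ap (rproj X) x)) \<longlonglongrightarrow> 0"
    unfolding LIMSEQ_iff
  proof (intro allI impI)
    fix e :: real
    assume e: "e > 0"
    obtain y where y: "norm (ap (rproj X) x - ap X y) < e / 2"
      using rproj(3) [of X x] e unfolding closure_approachable
      by (metis half_gt_zero dist_norm norm_minus_commute rangeE)
    have "(\<lambda>n. norm (D n * X) * norm y) \<longlonglongrightarrow> 0 * norm y"
      by (intro tendsto_intros lim0)
    then have "\<forall>\<^sub>F n in sequentially. norm (D n * X) * norm y < e / 2"
      by (rule order_tendstoD) (use e in simp)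
    then obtain N where N: "\<And>n. n \<ge> N \<Longrightarrow> norm (D n * X) * norm y < e / 2"
      by (auto simp: eventually_sequentially)
    have "norm (ap (D n) (ap (rproj X) x) - 0) < e" if "n \<ge> N" for n
    proof -
      have "ap (D n) (ap (rproj X) x) = ap (D n) (ap (rproj X) x - ap X y) + ap (D n * X) y"
        by simp
      also have "norm \<dots> \<le> norm (D n) * norm (ap (rproj X) x - ap X y) + norm (D n * X) * norm y"
        by (intro order_trans [OF norm_triangle_ineq] add_mono norm_ap)
      also have "\<dots> \<le> norm (ap (rproj X) x - ap X y) + norm (D n * X) * norm y"
        using D1 [of n] by (intro add_mono) (auto intro: mult_left_le_one_le)
      also have "\<dots> < e"
        using y N [OF that] by linarith
      finally show ?thesis
        by simp
    qed
    then show "\<exists>N. \<forall>n\<ge>N. norm (ap (D n) (ap (rproj X) x) - 0) < e"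
      by blast
  qed
  have "D n * (1 - rproj X) = 1 - rproj X" for n
  proof (induction n)
    case (Suc n)
    have "poly_oper (ker_poly X) X * (1 - rproj X) = 1 - rproj X"
      by (simp add: ker_poly_def algebra_simps mult_rproj X)
    then show ?case
      using Suc by (simp add: D_def mult.assoc)
  qed (simp add: D_def one_pCons)
  then have "ap (D n) (ap (1 - rproj X) x) = ap (1 - rproj X) x" for n
    by (metis ap_simps(6))
  moreover have "ap (D n) x = ap (D n) (ap (rproj X) x) + ap (D n) (ap (1 - rproj X) x)" for n
    by simp
  ultimately have "(\<lambda>n. ap (D n) x) = (\<lambda>n. ap (D n) (ap (rproj X) x) + ap (1 - rproj X) x)"
    by presburger
  then show ?thesis
    using tendsto_add [OF range0 tendsto_const [of "ap (1 - rproj X) x"]] by (simp add: D_def)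
qed

text \<open>The kernel projection is a strong limit of polynomials in \<open>X\<close>, and each of
  these commutes with \<open>Y\<close>.\<close>

lemma rproj_commute:
  assumes X: "star X = X" and comm: "Y * X = X * Y"
  shows "Y * rproj X = rproj X * Y"
proof -
  have "Y * (1 - rproj X) = (1 - rproj X) * Y"
  proof (rule oper_eqI)
    fix x
    have "(\<lambda>n. ap Y (ap (poly_oper (ker_poly X ^ n) X) x)) \<longlonglongrightarrow> ap Y (ap (1 - rproj X) x)"
      by (intro bounded_linear.tendsto [OF bounded_linear_ap] ker_poly_tendsto X)
    moreover have "ap Y (ap (poly_oper (ker_poly X ^ n) X) x)
        = ap (poly_oper (ker_poly X ^ n) X) (ap Y x)" for n
      by (metis ap_simps(6) comm poly_oper_commute)
    ultimately have "(\<lambda>n. ap (poly_oper (ker_poly X ^ n) X) (ap Y x)) \<longlonglongrightarrow> ap Y (ap (1 - rproj X) x)"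
      by simp
    then show "ap (Y * (1 - rproj X)) x = ap ((1 - rproj X) * Y) x"
      using ker_poly_tendsto [OF X, of "ap Y x"] LIMSEQ_unique by fastforce
  qed
  then show ?thesis
    by (simp add: algebra_simps)
qed

section \<open>Spectral projections\<close>

text \<open>The projection onto the kernel of the positive part of X - t, that is, the spectral
  projection for values up to and including \<open>t\<close>.\<close>

definition spec_proj :: "'a::{real_inner,banach} oper \<Rightarrow> real \<Rightarrow> 'a oper"
  where "spec_proj X t = 1 - rproj (calc X (\<lambda>u. max (u - t) 0))"

context
  fixes X :: "'a::{real_inner,banach} oper"
  assumes X: "star X = X"
begin

lemma spec_proj_proj: "proj (spec_proj X t)"
  by (simp add: spec_proj_def proj_compl rproj(1))

lemma pos_part_spec_proj: "calc X (\<lambda>u. max (u - t) 0) * spec_proj X t = 0"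
  by (simp add: spec_proj_def right_diff_distrib mult_rproj star_calc X continuous_intros)

text \<open>The positive parts of t - X and of X - t have product 0, so the former annihilates the
  range projection of the latter.\<close>

lemma neg_part_spec_proj: "calc X (\<lambda>u. max (t - u) 0) * (1 - spec_proj X t) = 0"
proof -
  have "calc X (\<lambda>u. max (t - u) 0) * calc X (\<lambda>u. max (u - t) 0)
      = calc X (\<lambda>u. max (t - u) 0 * max (u - t) 0)"
    by (subst calc_mult) (auto intro!: continuous_intros simp: X)
  also have "\<dots> = calc X (\<lambda>u. 0)"
    by (rule calc_cong [OF X], intro continuous_intros) auto
  also have "\<dots> = 0"
    by (simp add: calc_const X)
  finally show ?thesis
    by (simp add: spec_proj_def rproj_annihilate)
qed

lemma spec_proj_commute: "Y * X = X * Y \<Longrightarrow> Y * spec_proj X t = spec_proj X t * Y"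
  using rproj_commute [OF star_calc calc_commute, OF X _ X, of "\<lambda>u. max (u - t) 0" Y]
  by (simp add: spec_proj_def algebra_simps continuous_intros)

lemma calc_pos_neg:
  "X = t *\<^sub>R 1 + calc X (\<lambda>u. max (u - t) 0) - calc X (\<lambda>u. max (t - u) 0)"
proof -
  have "calc X (\<lambda>u. t + max (u - t) 0 - max (t - u) 0)
      = t *\<^sub>R 1 + calc X (\<lambda>u. max (u - t) 0) - calc X (\<lambda>u. max (t - u) 0)"
    by (subst calc_diff calc_add; auto intro!: continuous_intros simp: X calc_const)+
  moreover have "calc X (\<lambda>u. t + max (u - t) 0 - max (t - u) 0) = calc X (\<lambda>u. u)"
    by (rule calc_cong [OF X], intro continuous_intros) auto
  ultimately show ?thesis
    by (simp add: calc_id X)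
qed

lemma spec_proj_upper:
  "inner (ap X (ap (spec_proj X t) x)) (ap (spec_proj X t) x) \<le> t * (norm (ap (spec_proj X t) x))\<^sup>2"
proof -
  let ?y = "ap (spec_proj X t) x"
  have "ap (calc X (\<lambda>u. max (u - t) 0)) ?y = 0"
    by (metis ap_simps(5,6) pos_part_spec_proj)
  then have "ap X ?y = t *\<^sub>R ?y - ap (calc X (\<lambda>u. max (t - u) 0)) ?y"
    using arg_cong [OF calc_pos_neg [of t], of "\<lambda>Z. ap Z ?y"] by (simp del: ap_linear)
  moreover have "0 \<le> inner (ap (calc X (\<lambda>u. max (t - u) 0)) ?y) ?y"
    by (rule calc_nonneg [OF X]) (auto intro!: continuous_intros)
  ultimately show ?thesis
    by (simp add: inner_diff_left power2_norm_eq_inner)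
qed

lemma spec_proj_lower:
  "t * (norm (ap (1 - spec_proj X t) x))\<^sup>2 \<le>
    inner (ap X (ap (1 - spec_proj X t) x)) (ap (1 - spec_proj X t) x)"
proof -
  let ?y = "ap (1 - spec_proj X t) x"
  have "ap (calc X (\<lambda>u. max (t - u) 0)) ?y = 0"
    by (metis ap_simps(5,6) neg_part_spec_proj)
  then have "ap X ?y = t *\<^sub>R ?y + ap (calc X (\<lambda>u. max (u - t) 0)) ?y"
    using arg_cong [OF calc_pos_neg [of t], of "\<lambda>Z. ap Z ?y"]
    by (simp only: ap_simps add_0_right diff_0_right)
  moreover have "0 \<le> inner (ap (calc X (\<lambda>u. max (u - t) 0)) ?y) ?y"
    by (rule calc_nonneg [OF X]) (auto intro!: continuous_intros)
  ultimately show ?thesis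
    by (simp add: inner_add_left power2_norm_eq_inner)
qed

end

section \<open>Algebras of operators closed in the strong topology\<close>

text \<open>\<open>strong_closed\<close> speaks of basic neighbourhoods instead of sequences, since
  it must also yield suprema of directed families of projections.\<close>

locale strong_algebra =
  fixes B :: "'a::{real_inner,banach} oper set"
  assumes one [simp]: "1 \<in> B"
    and add [simp]: "X \<in> B \<Longrightarrow> Y \<in> B \<Longrightarrow> X + Y \<in> B"
    and scaleR [simp]: "X \<in> B \<Longrightarrow> r *\<^sub>R X \<in> B"
    and mult [simp]: "X \<in> B \<Longrightarrow> Y \<in> B \<Longrightarrow> X * Y \<in> B"
    and star [simp]: "X \<in> B \<Longrightarrow> star X \<in> B"
    and strong_closed:
      "(\<And>F e. finite F \<Longrightarrow> 0 < e \<Longrightarrow> \<exists>Y\<in>B. \<forall>x\<in>F. norm (ap Y x - ap X x) < e) \<Longrightarrow> X \<in> B"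
begin

lemma zero [simp]: "0 \<in> B"
  using scaleR [OF one, of 0] by simp

lemma uminus [simp]: "X \<in> B \<Longrightarrow> - X \<in> B"
  using scaleR [of X "-1"] by simp

lemma diff [simp]: "X \<in> B \<Longrightarrow> Y \<in> B \<Longrightarrow> X - Y \<in> B"
  using add [of X "- Y"] by simp

lemma strong_limit:
  assumes "\<And>n. Y n \<in> B" "\<And>x. (\<lambda>n. ap (Y n) x) \<longlonglongrightarrow> ap X x"
  shows "X \<in> B"
proof (rule strong_closed)
  fix F :: "'a set" and e :: real
  assume F: "finite F" and e: "0 < e"
  have "\<forall>x\<in>F. \<forall>\<^sub>F n in sequentially. norm (ap (Y n) x - ap X x) < e"
    using assms(2) e by (auto simp: tendsto_iff dist_norm)
  then have "\<forall>\<^sub>F n in sequentially. \<forall>x\<in>F. norm (ap (Y n) x - ap X x) < e"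
    using F by (simp add: eventually_ball_finite)
  then obtain n where "\<forall>x\<in>F. norm (ap (Y n) x - ap X x) < e"
    using eventually_happens trivial_limit_sequentially by blast
  then show "\<exists>Y\<in>B. \<forall>x\<in>F. norm (ap Y x - ap X x) < e"
    using assms(1) by blast
qed

lemma norm_closed: "closed B"
proof (unfold closed_sequential_limits, intro allI impI)
  fix Y X
  assume Y: "(\<forall>n. Y n \<in> B) \<and> Y \<longlonglongrightarrow> X"
  have "(\<lambda>n. ap (Y n) x) \<longlonglongrightarrow> ap X x" for x
  proof -
    have "bounded_linear (\<lambda>Z. ap Z x)"
      by (rule bounded_linear_intro [of _ "norm x"]) (auto simp: norm_ap)
    from bounded_linear.tendsto [OF this] show ?thesis
      using Y by blast
  qed
  then show "X \<in> B"
    using Y strong_limit by blast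
qed

lemma poly_oper_in: "X \<in> B \<Longrightarrow> poly_oper p X \<in> B"
  by (induction p) auto

lemma calc_in:
  "X \<in> B \<Longrightarrow> star X = X \<Longrightarrow> continuous_on (spec_range X) f \<Longrightarrow> calc X f \<in> B"
  by (intro calc_in_closed norm_closed poly_oper_in)

lemma rproj_in: "X \<in> B \<Longrightarrow> star X = X \<Longrightarrow> rproj X \<in> B"
proof -
  assume X: "X \<in> B" "star X = X"
  have "1 - rproj X \<in> B"
    by (rule strong_limit [OF _ ker_poly_tendsto [OF X(2)]]) (simp add: poly_oper_in X)
  then show "rproj X \<in> B"
    using diff [OF one] by fastforce
qed

lemma spec_proj_in: "X \<in> B \<Longrightarrow> star X = X \<Longrightarrow> spec_proj X t \<in> B"
  unfolding spec_proj_def by (intro diff one rproj_in calc_in star_calc continuous_intros)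

text \<open>The supremum \<open>c\<close> projects onto the closure of the union \<open>L\<close> of
  the ranges, which is a subspace by directedness; \<open>r * p = p\<close> says that
  \<open>p\<close> lies below \<open>r\<close>. On any finite set of vectors some member of the
  family is close to \<open>c\<close>.\<close>

lemma directed_sup_proj:
  assumes PB: "\<And>p. p \<in> \<P> \<Longrightarrow> p \<in> B \<and> proj p" and ne: "\<P> \<noteq> {}"
    and dir: "\<And>p q. p \<in> \<P> \<Longrightarrow> q \<in> \<P> \<Longrightarrow> \<exists>r\<in>\<P>. r * p = p \<and> r * q = q"
  obtains c where "c \<in> B" "proj c" "\<And>p. p \<in> \<P> \<Longrightarrow> c * p = p"
    "\<And>Y. (\<And>p. p \<in> \<P> \<Longrightarrow> Y * p = 0) \<Longrightarrow> Y * c = 0"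
proof -
  define L where "L = {x. \<exists>p\<in>\<P>. ap p x = x}"
  have pL: "ap p x \<in> L" if "p \<in> \<P>" for p x
  proof -
    have "p * p = p"
      using PB [OF that] by (simp add: proj_def)
    then have "ap p (ap p x) = ap p x"
      by (metis ap_simps(6))
    then show ?thesis
      using that by (auto simp: L_def)
  qed
  have join: "\<exists>r\<in>\<P>. \<forall>x\<in>F. ap r x = x" if "finite F" "F \<subseteq> L" for F
    using that
  proof (induction F)
    case empty
    then show ?case
      using ne by blast
  next
    case (insert x F)
    then obtain r p where r: "r \<in> \<P>" "\<forall>y\<in>F. ap r y = y" and p: "p \<in> \<P>" "ap p x = x"
      by (auto simp: L_def)
    then obtain s where s: "s \<in> \<P>" "s * r = r" "s * p = p"
      using dir by blast
    have "ap s x = x"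
      using p(2) s(3) by (metis ap_simps(6))
    moreover have "ap s y = y" if "y \<in> F" for y
      using r(2) s(2) that by (metis ap_simps(6))
    ultimately show ?case
      using s(1) by blast
  qed
  have "subspace L"
    unfolding subspace_def
  proof (intro conjI ballI allI)
    show "0 \<in> L"
      using ne by (auto simp: L_def)
    fix x y
    assume xy: "x \<in> L" "y \<in> L"
    then obtain r where "r \<in> \<P>" "\<forall>z\<in>{x, y}. ap r z = z"
      using join [of "{x, y}"] by auto
    then show "x + y \<in> L"
      unfolding L_def by (intro CollectI bexI [of _ r]) simp_all
  next
    fix x c
    assume "x \<in> L"
    then show "c *\<^sub>R x \<in> L"
      by (auto simp: L_def)
  qed
  then obtain c where c: "proj c" "\<And>x. ap c x \<in> closure L" "\<And>x. x \<in> closure L \<Longrightarrow> ap c x = x"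
    using ex_proj [OF subspace_closure closed_closure] by metis
  have cp: "c * p = p" if "p \<in> \<P>" for p
    by (rule oper_eqI) (use c(3) closure_subset pL [OF that] in auto)
  have pc: "p * c = p" if "p \<in> \<P>" for p
    using cp [OF that] PB [OF that] c(1) by (metis proj_def star_simps(3))
  have "c \<in> B"
  proof (rule strong_closed)
    fix F :: "'a set" and e :: real
    assume F: "finite F" and e: "0 < e"
    have "\<exists>m\<in>L. norm (ap c x - m) < e / 2" for x
      using c(2) [of x] e unfolding closure_approachable
      by (metis half_gt_zero dist_norm norm_minus_commute)
    then obtain m where m: "\<And>x. m x \<in> L" "\<And>x. norm (ap c x - m x) < e / 2"
      by metis
    obtain r where r: "r \<in> \<P>" "\<And>x. x \<in> F \<Longrightarrow> ap r (m x) = m x"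
      using join [of "m ` F"] F m(1) by auto
    have "norm (ap r x - ap c x) < e" if "x \<in> F" for x
    proof -
      have "ap r x = ap r (ap c x)"
        using pc [OF r(1)] by (metis ap_simps(6))
      then have "ap r x - ap c x = ap r (ap c x - m x) - (ap c x - m x)"
        using r(2) [OF that] by simp
      also have "norm \<dots> \<le> norm (ap r (ap c x - m x)) + norm (ap c x - m x)"
        by (rule norm_triangle_ineq4)
      also have "\<dots> \<le> norm (ap c x - m x) + norm (ap c x - m x)"
        using PB [OF r(1)] by (simp add: norm_ap_proj_le del: ap_linear)
      finally show ?thesis
        using m(2) [of x] by linarith
    qed
    then show "\<exists>Y\<in>B. \<forall>x\<in>F. norm (ap Y x - ap c x) < e"
      using PB [OF r(1)] by blast
  qed
  moreover have "Y * c = 0" if "\<And>p. p \<in> \<P> \<Longrightarrow> Y * p = 0" for Y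
  proof (rule oper_eqI)
    fix x
    have "closed {y. ap Y y = 0}"
      by (intro closed_Collect_eq continuous_ap continuous_intros)
    moreover have "L \<subseteq> {y. ap Y y = 0}"
      using that unfolding L_def by clarsimp (metis ap_simps(5,6))
    ultimately have "closure L \<subseteq> {y. ap Y y = 0}"
      by (rule closure_minimal [rotated])
    then show "ap (Y * c) x = ap 0 x"
      using c(2) by auto
  qed
  ultimately show thesis
    using that c(1) cp by blast
qed

text \<open>\<open>c\<close> projects onto the closed span of the ranges of all
  \<open>X * q\<close>. This subspace is encoded by the operators \<open>Y\<close> annihilating it,
  and \<open>c\<close> is the supremum of the projections of \<open>B\<close> killed by all such
  \<open>Y\<close>. Invariance of the subspace under \<open>B\<close> makes \<open>c\<close>
  central.\<close>

lemma central_support: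
  assumes q: "q \<in> B"
  obtains c where "c \<in> B" "proj c" "\<And>X. X \<in> B \<Longrightarrow> c * X = X * c" "c * q = q"
    "\<And>Y. (\<And>X. X \<in> B \<Longrightarrow> Y * X * q = 0) \<Longrightarrow> Y * c = 0"
proof -
  define \<P> where "\<P> = {p \<in> B. proj p \<and> (\<forall>Y. (\<forall>X\<in>B. Y * X * q = 0) \<longrightarrow> Y * p = 0)}"
  have rproj_mem: "rproj (U * star U + V * star V) \<in> \<P>"
    if "U \<in> B" "V \<in> B" "\<And>Y. \<forall>X\<in>B. Y * X * q = 0 \<Longrightarrow> Y * U = 0 \<and> Y * V = 0" for U V
  proof -
    have "Y * rproj (U * star U + V * star V) = 0" if "\<forall>X\<in>B. Y * X * q = 0" for Y
      using \<open>\<And>Y. \<forall>X\<in>B. Y * X * q = 0 \<Longrightarrow> Y * U = 0 \<and> Y * V = 0\<close> [OF that]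
      by (intro rproj_annihilate) (simp add: distrib_left flip: mult.assoc)
    then show ?thesis
      using that(1,2) by (simp add: \<P>_def rproj(1) rproj_in)
  qed
  obtain c where c: "c \<in> B" "proj c" "\<And>p. p \<in> \<P> \<Longrightarrow> c * p = p"
    "\<And>Y. (\<And>p. p \<in> \<P> \<Longrightarrow> Y * p = 0) \<Longrightarrow> Y * c = 0"
  proof (rule directed_sup_proj [of \<P>])
    show "\<P> \<noteq> {}"
      by (auto simp: \<P>_def proj_def intro!: exI [of _ 0])
    fix p p'
    assume "p \<in> \<P>" "p' \<in> \<P>"
    then have "rproj (p * star p + p' * star p') \<in> \<P>"
      by (intro rproj_mem) (auto simp: \<P>_def)
    moreover have "rproj (p * star p + p' * star p') * p' = p'"
      using rproj_sum_squares [of p' p] by (simp add: add.commute)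
    ultimately show "\<exists>r\<in>\<P>. r * p = p \<and> r * p' = p'"
      using rproj_sum_squares by blast
  qed (auto simp: \<P>_def)
  \<comment> \<open>An element of \<open>B\<close> killed by all those \<open>Y\<close> has its
    range below \<open>c\<close>, because the range projection belongs to the family.\<close>
  have fix1: "c * U = U" if "U \<in> B" "\<And>Y. \<forall>X\<in>B. Y * X * q = 0 \<Longrightarrow> Y * U = 0" for U
  proof -
    have "c * rproj (U * star U + 0 * star 0) = rproj (U * star U + 0 * star 0)"
      using that by (intro c(3) rproj_mem) auto
    then show ?thesis
      using rproj_sum_squares [of U 0] by (metis mult.assoc)
  qed
  have "c * q = q"
    using fix1 [OF q] by (metis mult_1_right one)
  have inv: "c * X * c = X * c" if X: "X \<in> B" for X
  proof -
    have "((1 - c) * X) * c = 0"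
    proof (rule c(4))
      fix p
      assume p: "p \<in> \<P>"
      have "c * (X * p) = X * p"
      proof (rule fix1)
        show "X * p \<in> B"
          using X p by (auto simp: \<P>_def)
        fix Y
        assume "\<forall>X\<in>B. Y * X * q = 0"
        then have "\<forall>X'\<in>B. (Y * X) * X' * q = 0"
          using X by (metis mult mult.assoc)
        then show "Y * (X * p) = 0"
          using p by (simp add: \<P>_def flip: mult.assoc)
      qed
      then show "(1 - c) * X * p = 0"
        by (simp add: left_diff_distrib mult.assoc)
    qed
    then show ?thesis
      by (simp add: left_diff_distrib)
  qed
  have "c * X = X * c" if X: "X \<in> B" for X
  proof -
    \<comment> \<open>The adjoint of the invariance for \<open>star X\<close> is the invariance of
      the complement under \<open>X\<close>.\<close>
    have "star (c * star X * c) = star (star X * c)"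
      using inv [OF star [OF X]] by simp
    then have "c * X * c = c * X"
      using c(2) by (simp add: proj_def mult.assoc)
    then show ?thesis
      using inv [OF X] by simp
  qed
  moreover have "Y * c = 0" if "\<And>X. X \<in> B \<Longrightarrow> Y * X * q = 0" for Y
    using that by (intro c(4)) (auto simp: \<P>_def)
  ultimately show thesis
    using that c(1,2) \<open>c * q = q\<close> by blast
qed

end

section \<open>Projections with a large commutator\<close>

lemma star_mult_eq_0: "star X * X = 0 \<Longrightarrow> X = 0" for X :: "'a::{real_inner,banach} oper"
  using norm_star_mult [of X] by simp

lemma commute_mult: "X * Z = Z * X \<Longrightarrow> Y * Z = Z * Y \<Longrightarrow> X * Y * Z = Z * (X * Y)"
  for X :: "'a::real_normed_vector oper"
  by (metis mult.assoc)

lemma projD: "proj P \<Longrightarrow> star P = P" "proj P \<Longrightarrow> P * P = P"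
  by (auto simp: proj_def)

lemma proj_fixes: "proj P \<Longrightarrow> P * X = X \<Longrightarrow> star X * P = star X"
  by (metis projD(1) star_simps(3))

context strong_algebra
begin

text \<open>A polar part of q' Y q, cut off away from 0: on the spectral projection \<open>g\<close>
  of \<open>N\<close> above \<open>t\<close>, the inverse square root of \<open>N\<close> is
  bounded, and X R is isometric on the range of \<open>g\<close>.\<close>

lemma partial_isometry:
  assumes q: "q \<in> B" "proj q" and q': "q' \<in> B" "proj q'" and Y: "Y \<in> B" "q' * Y * q \<noteq> 0"
  obtains v where "v \<in> B" "proj (star v * v)" "v \<noteq> 0" "q' * v = v" "v * q = v"
proof -
  define X N where "X = q' * Y * q" and "N = star X * X"
  define r t where "r = norm N" and "t = r / 2"
  have XB: "X \<in> B" and NB: "N \<in> B"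
    using q q' Y by (auto simp: X_def N_def)
  have N: "star N = N"
    by (simp add: N_def)
  have "X \<noteq> 0"
    using Y(2) by (simp add: X_def)
  then have "r > 0"
    using norm_star_mult [of X] by (simp add: r_def N_def)
  then have t: "t > 0" "t < r"
    by (auto simp: t_def)
  \<comment> \<open>Above \<open>t\<close>, \<open>f\<close> is the inverse square root. The
    function \<open>k\<close> satisfies u k(u) = max (u - t) 0, which places \<open>g\<close> below
    the closed range of \<open>N\<close> and hence below \<open>q\<close>.\<close>
  define f where "f = (\<lambda>u. 1 / sqrt (max u t))"
  define k where "k = (\<lambda>u. max (u - t) 0 / max u t)"
  have cf: "continuous_on (spec_range N) f"
    unfolding f_def using t by (intro continuous_intros) (auto simp: max_def)
  have ck: "continuous_on (spec_range N) k"
    unfolding k_def using t by (intro continuous_intros) (auto simp: max_def)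
  define R where "R = calc N f"
  define P where "P = calc N (\<lambda>u. max (u - t) 0)"
  define g where "g = rproj P"
  have P: "star P = P" "P \<in> B"
    unfolding P_def by (intro star_calc calc_in N NB continuous_intros)+
  have R: "star R = R" "R \<in> B"
    unfolding R_def by (intro star_calc calc_in N NB cf)+
  have g: "proj g" "g \<in> B" and g1: "1 - g = spec_proj N t"
    using rproj(1) rproj_in [OF P(2,1)] by (auto simp: g_def spec_proj_def P_def)
  have "R * N * R = calc N (\<lambda>u. f u * u * f u)"
    using calc_mult [OF N cf, of "\<lambda>u. u"] calc_mult [OF N _ cf, of "\<lambda>u. f u * u"]
    by (simp add: R_def calc_id N cf continuous_intros)
  moreover have "1 - calc N (\<lambda>u. f u * u * f u) = calc N (\<lambda>u. 1 - f u * u * f u)"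
    using calc_diff [OF N, of "\<lambda>u. 1" "\<lambda>u. f u * u * f u"]
    by (simp add: calc_const N cf continuous_intros)
  moreover have "\<dots> = calc N (\<lambda>u. (1 / t) * max (t - u) 0)"
  proof (rule calc_cong [OF N])
    show "1 - f u * u * f u = (1 / t) * max (t - u) 0" for u
      using t by (auto simp: f_def max_def field_simps)
  qed (intro continuous_intros cf)
  moreover have "\<dots> = (1 / t) *\<^sub>R calc N (\<lambda>u. max (t - u) 0)"
    by (intro calc_cmult N continuous_intros)
  ultimately have "(1 - R * N * R) * g = (1 / t) *\<^sub>R (calc N (\<lambda>u. max (t - u) 0) * (1 - spec_proj N t))"
    by (simp flip: g1)
  then have RNR: "R * N * R * g = g"
    using neg_part_spec_proj [OF N, of t] by (simp add: left_diff_distrib)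
  define v where "v = X * R * g"
  have "star v * v = g * (R * N * R * g)"
    by (simp add: v_def N_def R projD(1) [OF g(1)] mult.assoc)
  then have vv: "star v * v = g"
    by (simp add: RNR projD(2) [OF g(1)])
  \<comment> \<open>Otherwise g = 0 and the form of \<open>N\<close> is bounded by \<open>t\<close>,
    which is smaller than its norm.\<close>
  have "v \<noteq> 0"
  proof
    assume "v = 0"
    then have "spec_proj N t = 1"
      using vv g1 by simp
    then have up: "inner (ap N x) x \<le> t * (norm x)\<^sup>2" for x
      using spec_proj_upper [OF N, of t x] by simp
    have "norm N \<le> t"
    proof (rule norm_selfadjoint_le [OF N])
      fix x
      have "inner (ap N x) x \<ge> 0"
        unfolding N_def norm_ap_squared [symmetric] by simp
      then show "\<bar>inner (ap N x) x\<bar> \<le> t * (norm x)\<^sup>2"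
        using up by simp
    qed (use t in simp)
    then show False
      using t by (simp add: r_def)
  qed
  have "P = calc N (\<lambda>u. u * k u)"
    unfolding P_def using t
    by (intro calc_cong N continuous_intros) (auto simp: k_def max_def)
  also have "\<dots> = N * calc N k"
    using calc_mult [OF N _ ck, of "\<lambda>u. u"] by (simp add: calc_id N continuous_intros)
  finally have PN: "P = N * calc N k" .
  have "(1 - q) * star X = 0"
    using q(2) by (simp add: X_def projD left_diff_distrib flip: mult.assoc)
  then have "(1 - q) * P = 0"
    by (simp add: PN N_def flip: mult.assoc)
  then have "(1 - q) * g = 0"
    unfolding g_def by (rule rproj_annihilate)
  then have "g * q = g"
    using proj_fixes [OF q(2), of g] by (simp add: left_diff_distrib projD [OF g(1)])
  then have "v * q = v"
    by (simp add: v_def mult.assoc)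
  moreover have "q' * v = v"
    using q'(2) by (simp add: v_def X_def projD(2) flip: mult.assoc)
  ultimately show thesis
    using that [of v] vv g XB R \<open>v \<noteq> 0\<close> by (simp add: v_def)
qed

text \<open>
  If \<open>v\<close> maps \<open>q\<close> partially isometrically into \<open>q'\<close>, the projection onto the graph of \<open>v\<close>
  maps \<open>\<xi> + v \<xi>\<close> to itself and \<open>v \<xi> - \<xi>\<close> to \<open>0\<close>.
\<close>

lemma commutator_gap:
  assumes h: "star h = h"
    and q: "q \<in> B" "proj q" "h * q = q * h" and q': "q' \<in> B" "proj q'" "h * q' = q' * h"
    and qq': "q * q' = q' * q"
    and up: "\<And>x. inner (ap h (ap q x)) (ap q x) \<le> a * (norm (ap q x))\<^sup>2"
    and lo: "\<And>x. b * (norm (ap q' x))\<^sup>2 \<le> inner (ap h (ap q' x)) (ap q' x)"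
    and f: "f * q = q" "f * q' = q'"
    and small: "\<And>P. P \<in> B \<Longrightarrow> proj P \<Longrightarrow> f * P = P \<Longrightarrow> norm (h * P - P * h) \<le> s"
    and ab: "b - a > 2 * s"
    and Y: "Y \<in> B"
  shows "q' * Y * q = 0"
proof (rule ccontr)
  assume "q' * Y * q \<noteq> 0"
  then obtain v where v: "v \<in> B" "proj (star v * v)" "v \<noteq> 0" "q' * v = v" "v * q = v"
    using partial_isometry [OF q(1,2) q'(1,2) Y] by blast
  have "norm (h * 0 - 0 * h) \<le> s"
    by (rule small) (auto simp: proj_def)
  then have "s \<ge> 0"
    by simp
  \<comment> \<open>On a vector in both ranges the form of \<open>h\<close> would be at most
    \<open>a\<close> and at least \<open>b\<close> times the squared length, although b > a.\<close>
  have orth: "q * q' = 0"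
  proof (rule oper_eqI)
    fix x
    let ?y = "ap (q * q') x"
    have y: "ap q ?y = ?y" "ap q' ?y = ?y"
      using qq' by (metis ap_simps(6) mult.assoc projD(2) q(2) q'(2))+
    have "b * (norm ?y)\<^sup>2 \<le> a * (norm ?y)\<^sup>2"
      using up [of ?y] lo [of ?y] unfolding y by linarith
    then have "(b - a) * (norm ?y)\<^sup>2 \<le> 0"
      by (simp add: algebra_simps)
    then have "(norm ?y)\<^sup>2 \<le> 0"
      using ab \<open>s \<ge> 0\<close> by (simp add: mult_le_0_iff)
    then show "ap (q * q') x = ap 0 x"
      by simp
  qed
  define g w where "g = star v * v" and "w = g + v"
  \<comment> \<open>Since star w w = 2 g, the factor 1/2 makes this a projection.\<close>
  define P where "P = (1 / 2) *\<^sub>R (w * star w)"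
  have g: "star g = g" "g * g = g"
    using v(2) by (auto simp: g_def projD)
  have gq: "g * q = g"
    by (simp add: g_def mult.assoc v(5))
  have qg: "q * g = g"
    by (metis g(1) gq projD(1) q(2) star_simps(3))
  have gv: "g * v = 0"
    by (metis gq mult.assoc mult_zero_left mult_zero_right orth v(4))
  have vg': "star v * g = 0"
    by (metis g(1) gv star_simps(3,6))
  have "star (v * (1 - g)) * (v * (1 - g)) = (1 - g) * g * (1 - g)"
    by (simp add: g mult.assoc) (simp add: g_def mult.assoc)
  also have "\<dots> = 0"
    by (simp add: algebra_simps g)
  finally have vg: "v * g = v"
    using star_mult_eq_0 [of "v * (1 - g)"] by (simp add: right_diff_distrib)
  have ww: "star w * w = 2 *\<^sub>R g"
    by (simp add: w_def g gv vg' distrib_left distrib_right flip: g_def scaleR_2)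
  have wg: "w * g = w"
    by (simp add: w_def distrib_right g vg)
  have "w * star w * (w * star w) = w * (star w * w) * star w"
    by (simp add: mult.assoc)
  also have "\<dots> = 2 *\<^sub>R (w * star w)"
    by (simp add: ww wg)
  finally have P: "proj P"
    by (simp add: proj_def P_def)
  have "w \<in> B"
    using v(1) by (simp add: w_def g_def)
  then have PB: "P \<in> B"
    by (simp add: P_def)
  have "f * w = w"
    unfolding w_def using f by (metis distrib_left mult.assoc qg v(4))
  then have "f * P = P"
    by (simp add: P_def flip: mult.assoc)
  then have C: "norm (h * P - P * h) \<le> s"
    using small P PB by blast
  obtain x where x: "ap v x \<noteq> 0"
    using v(3) oper_eqI [of v 0] by auto
  define y where "y = ap g x"
  define z where "z = ap v y"
  have z: "z = ap v x"
    using vg by (metis ap_simps(6) y_def z_def)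
  have gy: "ap g y = y"
    using g(2) by (metis ap_simps(6) y_def)
  have qy: "ap q y = y"
    using qg by (metis ap_simps(6) y_def)
  have q'z: "ap q' z = z"
    using v(4) by (metis ap_simps(6) z_def)
  have nz: "(norm z)\<^sup>2 = (norm y)\<^sup>2"
    by (metis z_def norm_ap_squared g_def gy power2_norm_eq_inner)
  have cross: "inner (ap q u) (ap q' u') = 0" for u u'
    by (metis orth ap_simps(5,6) inner_star inner_zero_right projD(1) q(2))
  have yz: "inner y z = 0"
    using cross [of y z] by (simp add: qy q'z)
  have hq: "ap h y = ap q (ap h y)"
    using q(3) qy by (metis ap_simps(6))
  have hq': "ap h z = ap q' (ap h z)"
    using q'(3) q'z by (metis ap_simps(6))
  have hyz: "inner (ap h y) z = 0"
    using cross [of "ap h y" z] q'z hq by simp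
  have hzy: "inner (ap h z) y = 0"
    using cross [of y "ap h z"] qy hq' by (simp add: inner_commute)
  have wy: "ap w y = y + z"
    by (simp add: w_def gy z_def)
  have "ap P (ap w y) = (1 / 2) *\<^sub>R ap w (ap (star w * w) y)"
    by (simp add: P_def)
  also have "\<dots> = ap w y"
    by (simp only: ww ap_simps ap_linear gy) simp
  finally have Pw: "ap P (y + z) = y + z"
    by (simp only: wy)
  have "ap (star w) (z - y) = (ap (g * v) y - ap g y) + (ap (star v * v) y - ap (star v * g) y)"
    by (simp add: w_def g z_def gy)
  also have "\<dots> = 0"
    unfolding gv vg' g_def [symmetric] gy by simp
  finally have Pd: "ap P (z - y) = 0"
    by (simp only: P_def ap_simps) simp
  \<comment> \<open>The commutator is tested between a vector fixed by \<open>P\<close> and one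
    killed by \<open>P\<close>. Mixed terms vanish because \<open>h\<close> preserves the orthogonal
    ranges of \<open>q\<close> and \<open>q'\<close>. Both vectors have sqrt 2 times the length of
    \<open>y\<close>, whence the factor 2 in 2 s.\<close>
  have "inner (ap (h * P - P * h) (y + z)) (z - y)
      = inner (ap h (ap P (y + z))) (z - y) - inner (ap P (ap h (y + z))) (z - y)"
    by (simp only: ap_simps inner_diff_left)
  also have "\<dots> = inner (ap h (y + z)) (z - y) - inner (ap h (y + z)) (ap P (z - y))"
    by (simp only: Pw inner_star [of P] projD(1) [OF P])
  also have "\<dots> = inner (ap h z) z - inner (ap h y) y"
    unfolding Pd by (simp add: inner_add_left inner_diff_right hyz hzy)
  also have "\<dots> \<ge> (b - a) * (norm y)\<^sup>2"
    using up [of y] lo [of z] by (simp add: qy q'z nz algebra_simps)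
  finally have lower: "(b - a) * (norm y)\<^sup>2 \<le> inner (ap (h * P - P * h) (y + z)) (z - y)" .
  have "inner (ap (h * P - P * h) (y + z)) (z - y)
      \<le> norm (ap (h * P - P * h) (y + z)) * norm (z - y)"
    by (rule norm_cauchy_schwarz)
  also have "\<dots> \<le> s * norm (y + z) * norm (z - y)"
    by (intro mult_right_mono order_trans [OF norm_ap] C) auto
  also have "\<dots> = 2 * s * (norm y)\<^sup>2"
  proof -
    have "(norm (y + z))\<^sup>2 = 2 * (norm y)\<^sup>2" "(norm (z - y))\<^sup>2 = 2 * (norm y)\<^sup>2"
      using nz yz by (simp_all add: power2_norm_eq_inner inner_simps inner_commute)
    then have "norm (y + z) = sqrt (2 * (norm y)\<^sup>2)" "norm (z - y) = sqrt (2 * (norm y)\<^sup>2)"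
      by (metis norm_ge_zero real_sqrt_unique)+
    then show ?thesis
      by simp
  qed
  finally have "(b - a) * (norm y)\<^sup>2 \<le> 2 * s * (norm y)\<^sup>2"
    using lower by linarith
  moreover have "(norm y)\<^sup>2 > 0"
    using nz x z by auto
  ultimately show False
    using ab by simp
qed

text \<open>
  Scanning \<open>t\<close> upwards in steps of \<open>d\<close>, the central support \<open>c\<close> of the part of \<open>f\<close> on which
  \<open>h \<le> t\<close> is split off, and \<open>z\<close> takes the value \<open>t\<close> there. By \<open>commutator_gap\<close>, \<open>h\<close> does not
  exceed \<open>t + 2 s + d\<close> on \<open>c f\<close>.
\<close>

lemma central_approx_step:
  assumes h: "h \<in> B" "star h = h" and f: "f \<in> B" "proj f" "h * f = f * h"
    and small: "\<And>P. P \<in> B \<Longrightarrow> proj P \<Longrightarrow> f * P = P \<Longrightarrow> norm (h * P - P * h) \<le> s"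
    and d: "0 < d"
  shows "e \<in> B \<Longrightarrow> proj e \<Longrightarrow> (\<And>X. X \<in> B \<Longrightarrow> e * X = X * e) \<Longrightarrow>
      (\<And>x. (t - d) * (norm (ap (e * f) x))\<^sup>2 \<le> inner (ap h (ap (e * f) x)) (ap (e * f) x)) \<Longrightarrow>
      norm h < t - d + real m * d \<Longrightarrow>
      \<exists>z\<in>B. (\<forall>X\<in>B. z * X = X * z) \<and> norm ((h - z) * (e * f)) \<le> 2 * s + d"
proof (induction m arbitrary: e t)
  case 0
  have s: "0 \<le> s"
    using small [of 0] by (simp add: proj_def)
  \<comment> \<open>On the range of e f the form of \<open>h\<close> is at least t - d, which now
    exceeds \<open>norm h\<close>; so nothing is left to scan.\<close>
  have "e * f = 0"
  proof (rule oper_eqI)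
    fix x
    let ?y = "ap (e * f) x"
    have "inner (ap h ?y) ?y \<le> norm (ap h ?y) * norm ?y"
      by (rule norm_cauchy_schwarz)
    also have "\<dots> \<le> norm h * norm ?y * norm ?y"
      by (intro mult_right_mono norm_ap) simp
    finally have "(t - d) * (norm ?y)\<^sup>2 \<le> norm h * (norm ?y)\<^sup>2"
      using "0.prems"(4) [of x] by (simp add: power2_eq_square)
    then have "(t - d - norm h) * (norm ?y)\<^sup>2 \<le> 0"
      by (simp add: left_diff_distrib)
    then have "(norm ?y)\<^sup>2 \<le> 0"
      using "0.prems"(5) by (simp add: mult_le_0_iff)
    then show "ap (e * f) x = ap 0 x"
      by simp
  qed
  then show ?case
    using s d by (intro bexI [of _ 0]) auto
next
  case (Suc m)
  note e = Suc.prems(1-3)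
  \<comment> \<open>The slack \<open>d\<close> makes the gap between t and t + M strictly larger
    than 2 s and also covers the values of \<open>h\<close> between t - d and t.\<close>
  define M where "M = 2 * s + d"
  have s: "0 \<le> s"
    using small [of 0] by (simp add: proj_def)
  have M: "0 \<le> M" "d \<le> M" "2 * s < M"
    using s d by (auto simp: M_def)
  define E where "E = spec_proj h t"
  have E: "E \<in> B" "proj E" "h * E = E * h"
    unfolding E_def by (intro spec_proj_in spec_proj_proj spec_proj_commute h refl)+
  have fE: "f * E = E * f"
    unfolding E_def by (rule spec_proj_commute [OF h(2)]) (simp add: f)
  define q where "q = E * f"
  have q: "q \<in> B" "proj q" "h * q = q * h"
    using E f fE by (auto simp: q_def intro!: proj_mult) (metis mult.assoc)
  obtain c where c: "c \<in> B" "proj c" "\<And>X. X \<in> B \<Longrightarrow> c * X = X * c" "c * q = q"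
    "\<And>Y. (\<And>X. X \<in> B \<Longrightarrow> Y * X * q = 0) \<Longrightarrow> Y * c = 0"
    using central_support [OF q(1)] by blast
  define e' where "e' = e * (1 - c)"
  have e': "e' \<in> B" "proj e'"
    using e c proj_compl [OF c(2)] by (auto simp: e'_def intro!: proj_mult)
  have e'c: "e' * X = X * e'" if "X \<in> B" for X
  proof -
    have "(1 - c) * X = X * (1 - c)"
      using c(3) [OF that] by (simp add: algebra_simps)
    then show ?thesis
      unfolding e'_def using e(3) [OF that] by (metis mult.assoc)
  qed
  \<comment> \<open>Since \<open>c\<close> dominates \<open>q\<close>, the part outside
    \<open>c\<close> meets no spectral values up to \<open>t\<close>, so the scan continues there
    from t + d.\<close>
  have "\<exists>z\<in>B. (\<forall>X\<in>B. z * X = X * z) \<and> norm ((h - z) * (e' * f)) \<le> 2 * s + d"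
  proof (rule Suc.IH [OF e' e'c, of "t + d"])
    show "norm h < t + d - d + real m * d"
      using Suc.prems(5) by (simp add: algebra_simps)
    fix x
    have "E * (e' * f) = e' * q"
      using e'c [OF E(1)] by (metis mult.assoc q_def)
    also have "\<dots> = e * ((1 - c) * q)"
      by (simp add: e'_def mult.assoc)
    also have "\<dots> = 0"
      by (simp add: left_diff_distrib c(4))
    finally have "(1 - E) * (e' * f) = e' * f"
      by (simp add: left_diff_distrib)
    then have "ap (1 - E) (ap (e' * f) x) = ap (e' * f) x"
      by (metis ap_simps(6))
    then show "(t + d - d) * (norm (ap (e' * f) x))\<^sup>2 \<le> inner (ap h (ap (e' * f) x)) (ap (e' * f) x)"
      using spec_proj_lower [OF h(2), of t "ap (e' * f) x"] by (simp add: E_def)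
  qed
  then obtain z' where z': "z' \<in> B" "\<And>X. X \<in> B \<Longrightarrow> z' * X = X * z'" "norm ((h - z') * (e' * f)) \<le> M"
    by (auto simp: M_def)
  \<comment> \<open>As \<open>c\<close> is central, the value \<open>t\<close> on \<open>c\<close>
    and the inductive \<open>z'\<close> off \<open>c\<close> combine to a central element, and
    \<open>norm_le_split\<close> lets the two pieces be estimated separately.\<close>
  define z where "z = t *\<^sub>R c + z' * (1 - c)"
  have zB: "z \<in> B"
    by (simp add: z_def c(1) z'(1))
  have zc: "z * X = X * z" if X: "X \<in> B" for X
  proof -
    have "(1 - c) * X = X * (1 - c)"
      using c(3) [OF X] by (simp add: algebra_simps)
    then have "z' * (1 - c) * X = X * (z' * (1 - c))"
      by (rule commute_mult [OF z'(2) [OF X]])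
    then show ?thesis
      by (simp add: z_def distrib_left distrib_right c(3) [OF X])
  qed
  define Z where "Z = (h - z) * (e * f)"
  have ZB: "Z \<in> B"
    by (simp add: Z_def h zB e f)
  define Q where "Q = e * c * f"
  have ec: "e * c = c * e"
    using e(3) [OF c(1)] .
  have ecf: "e * c * f = f * (e * c)"
    by (intro commute_mult e(3) c(3) f(1))
  have Q: "Q \<in> B" "proj Q"
    unfolding Q_def using e(1) c(1) f(1) proj_mult [OF proj_mult [OF e(2) c(2) ec] f(2) ecf]
    by simp_all
  have "Q * f = f * Q"
    unfolding Q_def by (intro commute_mult e(3) c(3) f(1) refl)
  then have fQ: "f * Q = Q"
    by (simp add: Q_def mult.assoc projD(2) f(2))
  have hQ: "Q * h = h * Q"
    unfolding Q_def by (intro commute_mult e(3) c(3) h(1) f(3) [symmetric])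
  have "norm Z \<le> M"
  proof (rule norm_le_split [OF c(2) c(3) [OF ZB]])
    have "z * c = t *\<^sub>R c"
      using c(2) by (simp add: z_def projD distrib_right left_diff_distrib mult.assoc)
    then have zcQ: "(h - z) * c = (h - t *\<^sub>R 1) * c"
      by (simp add: left_diff_distrib)
    have "Z * c = (h - z) * c * (e * f)"
      using c(3) [of "e * f"] e f by (simp add: Z_def mult.assoc)
    also have "\<dots> = (h - t *\<^sub>R 1) * Q"
      by (simp add: zcQ) (simp add: Q_def ec mult.assoc)
    finally have Zc: "Z * c = (h - t *\<^sub>R 1) * Q" .
    have eQ: "e * f * Q = Q"
      using fQ projD(2) [OF e(2)] unfolding Q_def by (metis mult.assoc)
    show "norm (Z * c) \<le> M"
      unfolding Zc
    proof (rule norm_le_of_form_bounds [OF h(2) Q(2) hQ M(1)])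
      fix x
      have "ap (e * f) (ap Q x) = ap Q x"
        by (metis ap_simps(6) eQ)
      then have "(t - d) * (norm (ap Q x))\<^sup>2 \<le> inner (ap h (ap Q x)) (ap Q x)"
        using Suc.prems(4) [of "ap Q x"] by simp
      moreover have "(t - M) * (norm (ap Q x))\<^sup>2 \<le> (t - d) * (norm (ap Q x))\<^sup>2"
        using M(2) by (intro mult_right_mono) auto
      ultimately show "(t - M) * (norm (ap Q x))\<^sup>2 \<le> inner (ap h (ap Q x)) (ap Q x)"
        by linarith
    next
      define G where "G = spec_proj h (t + M)"
      have G: "G \<in> B" "proj G"
        unfolding G_def by (intro spec_proj_in spec_proj_proj h)+
      have Gcomm: "Y * G = G * Y" if "Y * h = h * Y" for Y
        unfolding G_def by (rule spec_proj_commute [OF h(2) that])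
      \<comment> \<open>The part of \<open>Q\<close> where \<open>h\<close> exceeds t + M. It
        vanishes: \<open>commutator_gap\<close> gives q' B q = 0, the annihilation property of the
        central support gives q' c = 0, and q' lies below \<open>c\<close>.\<close>
      define q' where "q' = Q * (1 - G)"
      have q'G: "q' = (1 - G) * Q"
        using Gcomm [OF hQ] by (simp add: q'_def algebra_simps)
      have q': "q' \<in> B" "proj q'"
        using Q G proj_compl [OF G(2)] q'G q'_def by (auto simp: q'_def intro!: proj_mult)
      have hG: "h * G = G * h"
        by (rule Gcomm) simp
      have hq': "h * q' = q' * h"
        unfolding q'_def using hQ hG
        by (simp add: right_diff_distrib left_diff_distrib) (metis mult.assoc)
      have qQ: "Q * q = q * Q"
      proof -
        have "f * q = q * f"
          unfolding q_def using fE by (metis mult.assoc)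
        then show ?thesis
          unfolding Q_def by (intro commute_mult e(3) c(3) q(1))
      qed
      have qG: "q * G = G * q"
        by (rule Gcomm) (simp add: q(3))
      have "q' * Y * q = 0" if "Y \<in> B" for Y
      proof (rule commutator_gap [OF h(2) q q' hq'])
        show "q * q' = q' * q"
          unfolding q'_def using qQ qG
          by (simp add: right_diff_distrib left_diff_distrib) (metis mult.assoc)
        show "f * q = q"
          using fE f(2) by (simp add: q_def) (metis mult.assoc projD(2))
        show "f * q' = q'"
          unfolding q'_def using fQ by (metis mult.assoc)
        show "2 * s < (t + M) - t"
          using M by simp
        fix x
        have "ap E (ap q x) = ap q x"
          by (metis E(2) ap_simps(6) mult.assoc projD(2) q_def)
        then show "inner (ap h (ap q x)) (ap q x) \<le> t * (norm (ap q x))\<^sup>2"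
          using spec_proj_upper [OF h(2), of t "ap q x"] by (simp add: E_def)
        have "ap (1 - G) (ap q' x) = ap q' x"
          by (metis G(2) ap_simps(6) mult.assoc proj_compl projD(2) q'G)
        then show "(t + M) * (norm (ap q' x))\<^sup>2 \<le> inner (ap h (ap q' x)) (ap q' x)"
          using spec_proj_lower [OF h(2), of "t + M" "ap q' x"] by (simp add: G_def)
      qed (use small that in auto)
      then have "q' * c = 0"
        by (rule c(5))
      moreover have "q' * c = q'"
      proof -
        have "c * Q = Q"
          unfolding Q_def using ec projD(2) [OF c(2)] by (metis mult.assoc)
        then have "c * q' = q'"
          by (simp add: q'_def flip: mult.assoc)
        then show ?thesis
          using c(3) [OF q'(1)] by simp
      qed
      ultimately have "G * Q = Q"
        using q'G by (simp add: left_diff_distrib)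
      then have "ap G (ap Q x) = ap Q x" for x
        by (metis ap_simps(6))
      then show "inner (ap h (ap Q x)) (ap Q x) \<le> (t + M) * (norm (ap Q x))\<^sup>2" for x
        using spec_proj_upper [OF h(2), of "t + M" "ap Q x"] by (simp add: G_def)
    qed
    have "(h - z) * (1 - c) = (h - z') * (1 - c)"
      using c(2) by (simp add: z_def projD algebra_simps)
    moreover have "Z * (1 - c) = (h - z) * (1 - c) * (e * f)"
      using c(3) [of "e * f"] e f by (simp add: Z_def mult.assoc right_diff_distrib left_diff_distrib)
    moreover have "(1 - c) * (e * f) = e' * f"
      using ec by (simp add: e'_def left_diff_distrib right_diff_distrib flip: mult.assoc)
    ultimately have "Z * (1 - c) = (h - z') * (e' * f)"
      by (simp add: mult.assoc)
    then show "norm (Z * (1 - c)) \<le> M"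
      using z'(3) by simp
  qed
  then show ?case
    using zB zc by (auto simp: Z_def M_def)
qed

lemma central_approx:
  assumes h: "h \<in> B" "star h = h" and f: "f \<in> B" "proj f" "h * f = f * h"
    and small: "\<And>P. P \<in> B \<Longrightarrow> proj P \<Longrightarrow> f * P = P \<Longrightarrow> norm (h * P - P * h) \<le> s"
    and d: "0 < d"
  shows "\<exists>z\<in>B. (\<forall>X\<in>B. z * X = X * z) \<and> norm ((h - z) * f) \<le> 2 * s + d"
proof -
  obtain m where m: "2 * norm h < real m * d"
    using reals_Archimedean3 [OF d] by blast
  have "\<exists>z\<in>B. (\<forall>X\<in>B. z * X = X * z) \<and> norm ((h - z) * (1 * f)) \<le> 2 * s + d"
  proof (rule central_approx_step [OF h f small d])
    \<comment> \<open>The scan starts from the trivial lower bound - norm h, hence at t = d - norm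
      h, and \<open>m\<close> steps of size \<open>d\<close> carry it past norm h.\<close>
    show "norm h < (d - norm h) - d + real m * d"
      using m by simp
    fix x
    let ?y = "ap (1 * f) x"
    have "- inner (ap h ?y) ?y \<le> norm (ap h ?y) * norm ?y"
      using Cauchy_Schwarz_ineq2 [of "ap h ?y" ?y] by linarith
    also have "\<dots> \<le> norm h * norm ?y * norm ?y"
      by (intro mult_right_mono norm_ap) simp
    finally show "((d - norm h) - d) * (norm ?y)\<^sup>2 \<le> inner (ap h ?y) ?y"
      by (simp add: power2_eq_square)
  qed (auto simp: proj_def)
  then show ?thesis
    by simp
qed

end

section \<open>Commutative subalgebras\<close>

text \<open>The commutator with \<open>P\<close> is half of that with the symmetry 2 P - 1, whose
  norm is at most 1; this saves a factor 2 over the triangle inequality.\<close>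

lemma norm_commutator_proj_le:
  assumes P: "proj P"
  shows "norm (X * P - P * X) \<le> norm X"
proof -
  let ?u = "2 *\<^sub>R P - 1"
  have "star ?u * ?u = 1"
    using P by (simp add: projD algebra_simps scaleR_2)
  then have "(norm ?u)\<^sup>2 \<le> 1"
    using norm_star_mult [of ?u] norm_one_le by metis
  then have u: "norm ?u \<le> 1"
    by (simp add: abs_square_le_1)
  have "2 *\<^sub>R (X * P - P * X) = X * ?u - ?u * X"
    by (simp add: algebra_simps)
  then have "2 * norm (X * P - P * X) = norm (X * ?u - ?u * X)"
    by (metis norm_scaleR abs_numeral)
  also have "\<dots> \<le> norm X * norm ?u + norm ?u * norm X"
    by (intro order_trans [OF norm_triangle_ineq4] add_mono norm_mult_ineq)
  also have "\<dots> \<le> 2 * norm X"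
    using mult_right_mono [OF u, of "norm X"] by (simp add: mult.commute)
  finally show ?thesis
    by simp
qed

text \<open>The squared lengths of the vectors \<rho> x add up to that of \<open>x\<close>, so a
  Cauchy-Schwarz estimate gives \<open>M\<close> whatever the number of terms.\<close>

lemma norm_sum_sandwich_le:
  fixes \<rho>s :: "'a::{real_inner,banach} oper list"
  assumes \<rho>: "\<And>\<rho>. \<rho> \<in> set \<rho>s \<Longrightarrow> star \<rho> = \<rho>" and one: "sum_list (map (\<lambda>\<rho>. \<rho> * \<rho>) \<rho>s) = 1"
    and Y: "\<And>\<rho>. \<rho> \<in> set \<rho>s \<Longrightarrow> norm (Y \<rho>) \<le> M" and M: "0 \<le> M"
  shows "norm (sum_list (map (\<lambda>\<rho>. \<rho> * Y \<rho> * \<rho>) \<rho>s)) \<le> M"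
proof (rule oper_norm_bound [OF M])
  fix x
  have squares: "inner (ap (sum_list (map (\<lambda>\<rho>. \<rho> * \<rho>) \<rho>s)) x) x = sum_list (map (\<lambda>\<rho>. (norm (ap \<rho> x))\<^sup>2) \<rho>s)"
    if "\<And>\<rho>. \<rho> \<in> set \<rho>s \<Longrightarrow> star \<rho> = \<rho>" for \<rho>s x
    using that by (induction \<rho>s) (auto simp: inner_add_left norm_ap_squared)
  have nx: "sum_list (map (\<lambda>\<rho>. (norm (ap \<rho> x))\<^sup>2) \<rho>s) = (norm x)\<^sup>2" for x
    using squares [of \<rho>s x] \<rho> one by (simp add: power2_norm_eq_inner)
  define Z where "Z = (\<lambda>\<rho>s. sum_list (map (\<lambda>\<rho>. \<rho> * Y \<rho> * \<rho>) \<rho>s))"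
  have step: "2 * inner (ap (Z \<rho>s) x) y \<le>
      M\<^sup>2 * sum_list (map (\<lambda>\<rho>. (norm (ap \<rho> x))\<^sup>2) \<rho>s) + sum_list (map (\<lambda>\<rho>. (norm (ap \<rho> y))\<^sup>2) \<rho>s)"
    if "\<And>\<rho>. \<rho> \<in> set \<rho>s \<Longrightarrow> star \<rho> = \<rho> \<and> norm (Y \<rho>) \<le> M" for \<rho>s y
    using that
  proof (induction \<rho>s)
    case (Cons \<rho> \<rho>s)
    have "inner (ap (\<rho> * Y \<rho> * \<rho>) x) y = inner (ap (Y \<rho>) (ap \<rho> x)) (ap \<rho> y)"
      using Cons.prems by (simp add: inner_star [of \<rho>])
    also have "\<dots> \<le> norm (ap (Y \<rho>) (ap \<rho> x)) * norm (ap \<rho> y)"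
      by (rule norm_cauchy_schwarz)
    also have "\<dots> \<le> (M * norm (ap \<rho> x)) * norm (ap \<rho> y)"
      using Cons.prems by (intro mult_right_mono order_trans [OF norm_ap]) auto
    finally have "2 * inner (ap (\<rho> * Y \<rho> * \<rho>) x) y \<le> (M * norm (ap \<rho> x))\<^sup>2 + (norm (ap \<rho> y))\<^sup>2"
      using sum_squares_bound [of "M * norm (ap \<rho> x)" "norm (ap \<rho> y)"] by linarith
    moreover have "2 * inner (ap (Z \<rho>s) x) y \<le>
        M\<^sup>2 * sum_list (map (\<lambda>\<rho>. (norm (ap \<rho> x))\<^sup>2) \<rho>s) + sum_list (map (\<lambda>\<rho>. (norm (ap \<rho> y))\<^sup>2) \<rho>s)"
      using Cons by auto
    ultimately show ?case
      by (simp add: Z_def inner_add_left algebra_simps power_mult_distrib)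
  qed (simp add: Z_def)
  \<comment> \<open>With the image itself as second vector, half of the left side cancels the last
    term.\<close>
  have "2 * inner (ap (Z \<rho>s) x) (ap (Z \<rho>s) x) \<le> M\<^sup>2 * (norm x)\<^sup>2 + (norm (ap (Z \<rho>s) x))\<^sup>2"
    using step [of \<rho>s "ap (Z \<rho>s) x"] \<rho> Y by (simp add: nx)
  then have "(norm (ap (Z \<rho>s) x))\<^sup>2 \<le> (M * norm x)\<^sup>2"
    by (simp add: power_mult_distrib flip: power2_norm_eq_inner)
  then have "norm (ap (Z \<rho>s) x) \<le> M * norm x"
    by (rule power2_le_imp_le) (simp add: M)
  then show "norm (ap (sum_list (map (\<lambda>\<rho>. \<rho> * Y \<rho> * \<rho>) \<rho>s)) x) \<le> M * norm x"
    by (simp add: Z_def)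
qed

text \<open>Spectral projections of \<open>S\<close> at spacing \<open>d\<close> cut the space into
  slices on which \<open>S\<close> is within \<open>d\<close> of a scalar. If \<open>Y\<close>
  commutes with them, it preserves the slices, and its commutator with \<open>S\<close> is at most 2
  d norm Y on each, hence on all together. Here \<open>e\<close> is the part not yet scanned, and
  \<G> depends on neither \<open>Y\<close> nor \<open>e\<close>.\<close>

lemma commutator_step:
  fixes S :: "'a::{real_inner,banach} oper"
  assumes S: "star S = S" and d: "0 < d"
  shows "norm S < t - d + real m * d \<Longrightarrow>
    \<exists>\<G>. finite \<G> \<and> \<G> \<subseteq> range (spec_proj S) \<and>
      (\<forall>Y e. (\<forall>g\<in>\<G>. g * Y = Y * g) \<longrightarrow> proj e \<longrightarrow> e * S = S * e \<longrightarrow> e * Y = Y * e \<longrightarrow>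
        (\<forall>x. (t - d) * (norm (ap e x))\<^sup>2 \<le> inner (ap S (ap e x)) (ap e x)) \<longrightarrow>
        norm ((Y * S - S * Y) * e) \<le> 2 * d * norm Y)"
proof (induction m arbitrary: t)
  case 0
  have "e = 0" if lo: "\<And>x. (t - d) * (norm (ap e x))\<^sup>2 \<le> inner (ap S (ap e x)) (ap e x)" for e
  proof (rule oper_eqI)
    fix x
    let ?y = "ap e x"
    have "inner (ap S ?y) ?y \<le> norm (ap S ?y) * norm ?y"
      by (rule norm_cauchy_schwarz)
    also have "\<dots> \<le> norm S * norm ?y * norm ?y"
      by (intro mult_right_mono norm_ap) simp
    finally have "(t - d) * (norm ?y)\<^sup>2 \<le> norm S * (norm ?y)\<^sup>2"
      using lo [of x] by (simp add: power2_eq_square)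
    then have "(t - d - norm S) * (norm ?y)\<^sup>2 \<le> 0"
      by (simp add: left_diff_distrib)
    then have "(norm ?y)\<^sup>2 \<le> 0"
      using 0 by (simp add: mult_le_0_iff)
    then show "ap e x = ap 0 x"
      by simp
  qed
  then show ?case
    using d by (intro exI [of _ "{}"]) fastforce
next
  case (Suc m)
  have "norm S < (t + d) - d + real m * d"
    using Suc.prems by (simp add: algebra_simps)
  from Suc.IH [OF this] obtain \<G> where \<G>: "finite \<G>" "\<G> \<subseteq> range (spec_proj S)"
    and IH: "\<And>Y e. \<lbrakk>\<forall>g\<in>\<G>. g * Y = Y * g; proj e; e * S = S * e; e * Y = Y * e;
        \<forall>x. (t + d - d) * (norm (ap e x))\<^sup>2 \<le> inner (ap S (ap e x)) (ap e x)\<rbrakk> \<Longrightarrow>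
        norm ((Y * S - S * Y) * e) \<le> 2 * d * norm Y"
    by metis
  define E where "E = spec_proj S t"
  have E: "proj E"
    unfolding E_def by (rule spec_proj_proj [OF S])
  have Ecomm: "Y * E = E * Y" if "Y * S = S * Y" for Y
    unfolding E_def by (rule spec_proj_commute [OF S that])
  have ES: "E * S = S * E"
    using Ecomm [of S] by simp
  have "norm ((Y * S - S * Y) * e) \<le> 2 * d * norm Y"
    if YG: "\<forall>g\<in>insert E \<G>. g * Y = Y * g" and e: "proj e" "e * S = S * e" "e * Y = Y * e"
      and lo: "\<forall>x. (t - d) * (norm (ap e x))\<^sup>2 \<le> inner (ap S (ap e x)) (ap e x)" for Y e
  proof (rule norm_le_split [OF E])
    have EY: "E * Y = Y * E"
      using YG by simp
    have eE: "e * E = E * e"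
      by (rule Ecomm [OF e(2)])
    define C where "C = Y * S - S * Y"
    have EC: "E * C = C * E"
      unfolding C_def using EY ES by (simp add: left_diff_distrib right_diff_distrib) (metis mult.assoc)
    show "E * ((Y * S - S * Y) * e) = (Y * S - S * Y) * e * E"
      unfolding C_def [symmetric] using EC eE by (metis mult.assoc)
    define Q where "Q = e * E"
    have Q: "proj Q"
      unfolding Q_def by (rule proj_mult [OF e(1) E eE])
    have QS: "Q * S = S * Q" and QY: "Q * Y = Y * Q"
      unfolding Q_def by (intro commute_mult e ES EY)+
    have close: "norm ((S - t *\<^sub>R 1) * Q) \<le> d"
    proof (rule norm_le_of_form_bounds [OF S Q QS])
      fix x
      have "ap e (ap Q x) = ap Q x"
        using projD(2) [OF e(1)] by (metis Q_def ap_simps(6) mult.assoc)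
      then show "(t - d) * (norm (ap Q x))\<^sup>2 \<le> inner (ap S (ap Q x)) (ap Q x)"
        using lo by metis
      have "ap E (ap Q x) = ap Q x"
        using projD(2) [OF E] eE by (metis Q_def ap_simps(6) mult.assoc)
      then have "inner (ap S (ap Q x)) (ap Q x) \<le> t * (norm (ap Q x))\<^sup>2"
        using spec_proj_upper [OF S, of t "ap Q x"] by (simp add: E_def)
      also have "\<dots> \<le> (t + d) * (norm (ap Q x))\<^sup>2"
        using d by (intro mult_right_mono) auto
      finally show "inner (ap S (ap Q x)) (ap Q x) \<le> (t + d) * (norm (ap Q x))\<^sup>2" .
    qed (use d in simp)
    have "(Y * S - S * Y) * e * E = Y * ((S - t *\<^sub>R 1) * Q) - ((S - t *\<^sub>R 1) * Q) * Y"
      using QY by (simp add: Q_def algebra_simps)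
    also have "norm \<dots> \<le> norm Y * norm ((S - t *\<^sub>R 1) * Q) + norm ((S - t *\<^sub>R 1) * Q) * norm Y"
      by (intro order_trans [OF norm_triangle_ineq4] add_mono norm_mult_ineq)
    also have "\<dots> \<le> 2 * d * norm Y"
      using mult_right_mono [OF close, of "norm Y"] by (simp add: mult.commute)
    finally show "norm ((Y * S - S * Y) * e * E) \<le> 2 * d * norm Y" .
    define e' where "e' = e * (1 - E)"
    have eE': "e * (1 - E) = (1 - E) * e"
      using eE by (simp add: algebra_simps)
    have "norm ((Y * S - S * Y) * e') \<le> 2 * d * norm Y"
    proof (rule IH)
      show "\<forall>g\<in>\<G>. g * Y = Y * g"
        using YG by simp
      show "proj e'"
        unfolding e'_def by (rule proj_mult [OF e(1) proj_compl [OF E] eE'])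
      show "e' * S = S * e'" "e' * Y = Y * e'"
        unfolding e'_def using ES EY by (intro commute_mult e; simp add: algebra_simps)+
      show "\<forall>x. (t + d - d) * (norm (ap e' x))\<^sup>2 \<le> inner (ap S (ap e' x)) (ap e' x)"
      proof
        fix x
        have "ap (1 - E) (ap e' x) = ap e' x"
          using projD(2) [OF proj_compl [OF E]] eE' by (metis e'_def ap_simps(6) mult.assoc)
        then show "(t + d - d) * (norm (ap e' x))\<^sup>2 \<le> inner (ap S (ap e' x)) (ap e' x)"
          using spec_proj_lower [OF S, of t "ap e' x"] by (simp add: E_def)
      qed
    qed
    then show "norm ((Y * S - S * Y) * e * (1 - E)) \<le> 2 * d * norm Y"
      by (simp add: e'_def mult.assoc)
  qed
  then show ?case
    using \<G> by (intro exI [of _ "insert E \<G>"]) (auto simp: E_def)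
qed

text \<open>Exact commutation with finitely many projections forces near commutation with
  \<open>S\<close>, which is why averaging over a finite group is enough.\<close>

lemma commutator_small:
  fixes S :: "'a::{real_inner,banach} oper"
  assumes S: "star S = S" and d: "0 < d"
  shows "\<exists>\<G>. finite \<G> \<and> \<G> \<subseteq> range (spec_proj S) \<and>
    (\<forall>Y. (\<forall>g\<in>\<G>. g * Y = Y * g) \<longrightarrow> norm (Y * S - S * Y) \<le> d * norm Y)"
proof -
  have d2: "0 < d / 2"
    using d by simp
  obtain m where m: "2 * norm S < real m * (d / 2)"
    using reals_Archimedean3 [OF d2] by blast
  then have "norm S < (d / 2 - norm S) - d / 2 + real m * (d / 2)"
    by simp
  from commutator_step [OF S d2 this] obtain \<G> where \<G>: "finite \<G>" "\<G> \<subseteq> range (spec_proj S)"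
    and bound: "\<And>Y e. \<lbrakk>\<forall>g\<in>\<G>. g * Y = Y * g; proj e; e * S = S * e; e * Y = Y * e;
        \<forall>x. ((d / 2 - norm S) - d / 2) * (norm (ap e x))\<^sup>2 \<le> inner (ap S (ap e x)) (ap e x)\<rbrakk> \<Longrightarrow>
        norm ((Y * S - S * Y) * e) \<le> 2 * (d / 2) * norm Y"
    by metis
  have lo: "((d / 2 - norm S) - d / 2) * (norm (ap 1 x))\<^sup>2 \<le> inner (ap S (ap 1 x)) (ap 1 x)" for x
  proof -
    have "- inner (ap S x) x \<le> norm (ap S x) * norm x"
      using Cauchy_Schwarz_ineq2 [of "ap S x" x] by linarith
    also have "\<dots> \<le> norm S * norm x * norm x"
      by (intro mult_right_mono norm_ap) simp
    finally show ?thesis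
      by (simp add: power2_eq_square)
  qed
  have "norm (Y * S - S * Y) \<le> d * norm Y" if "\<forall>g\<in>\<G>. g * Y = Y * g" for Y
    using bound [OF that, of 1] lo by (simp add: proj_def)
  then show ?thesis
    using \<G> by blast
qed

text \<open>Lists keep apart the products of different pairs when these coincide, as the sum of
  squares requires.\<close>

lemma sum_list_products:
  fixes \<rho>s \<sigma>s :: "'a::real_normed_vector oper list"
  assumes "\<And>\<rho> \<sigma>. \<rho> \<in> set \<rho>s \<Longrightarrow> \<sigma> \<in> set \<sigma>s \<Longrightarrow> \<rho> * \<sigma> = \<sigma> * \<rho>"
  shows "sum_list (map (\<lambda>\<rho>. \<rho> * \<rho>) (concat (map (\<lambda>\<rho>. map (\<lambda>\<sigma>. \<rho> * \<sigma>) \<sigma>s) \<rho>s))) =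
    sum_list (map (\<lambda>\<rho>. \<rho> * \<rho>) \<rho>s) * sum_list (map (\<lambda>\<rho>. \<rho> * \<rho>) \<sigma>s)"
  using assms
proof (induction \<rho>s)
  case (Cons \<rho> \<rho>s)
  have "sum_list (map (\<lambda>\<sigma>. (\<rho> * \<sigma>) * (\<rho> * \<sigma>)) \<sigma>s') = \<rho> * \<rho> * sum_list (map (\<lambda>\<sigma>. \<sigma> * \<sigma>) \<sigma>s')"
    if "\<And>\<sigma>. \<sigma> \<in> set \<sigma>s' \<Longrightarrow> \<rho> * \<sigma> = \<sigma> * \<rho>" for \<sigma>s'
    using that
  proof (induction \<sigma>s')
    case (Cons \<sigma> \<sigma>s')
    have "(\<rho> * \<sigma>) * (\<rho> * \<sigma>) = \<rho> * \<rho> * (\<sigma> * \<sigma>)"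
      using Cons.prems [of \<sigma>] by (metis list.set_intros(1) mult.assoc)
    then show ?case
      using Cons by (simp add: distrib_left)
  qed simp
  then have "sum_list (map (\<lambda>\<sigma>. (\<rho> * \<sigma>) * (\<rho> * \<sigma>)) \<sigma>s) = \<rho> * \<rho> * sum_list (map (\<lambda>\<sigma>. \<sigma> * \<sigma>) \<sigma>s)"
    using Cons.prems by simp
  moreover have "sum_list (map (\<lambda>\<rho>. \<rho> * \<rho>) (concat (map (\<lambda>\<rho>. map (\<lambda>\<sigma>. \<rho> * \<sigma>) \<sigma>s) \<rho>s))) =
      sum_list (map (\<lambda>\<rho>. \<rho> * \<rho>) \<rho>s) * sum_list (map (\<lambda>\<rho>. \<rho> * \<rho>) \<sigma>s)"
    using Cons.prems by (intro Cons.IH) (meson list.set_intros(2))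
  ultimately show ?case
    by (simp add: distrib_right o_def)
qed simp

section \<open>The commutative subalgebra, its relative bicommutant and partitions of unity\<close>

locale abelian_subalgebra = strong_algebra B
  for B :: "'a::{real_inner,banach} oper set" +
  fixes A :: "'a oper set"
  assumes sub: "A \<subseteq> B"
    and A_one [simp]: "1 \<in> A"
    and A_add [simp]: "X \<in> A \<Longrightarrow> Y \<in> A \<Longrightarrow> X + Y \<in> A"
    and A_scaleR [simp]: "X \<in> A \<Longrightarrow> r *\<^sub>R X \<in> A"
    and A_mult [simp]: "X \<in> A \<Longrightarrow> Y \<in> A \<Longrightarrow> X * Y \<in> A"
    and A_commute: "X \<in> A \<Longrightarrow> Y \<in> A \<Longrightarrow> X * Y = Y * X"
    and A_closed: "closed A"
begin

lemma A_poly: "X \<in> A \<Longrightarrow> poly_oper p X \<in> A"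
proof (induction p)
  case 0
  then show ?case
    using A_scaleR [OF A_one, of 0] by simp
qed auto

lemma A_calc:
  "X \<in> A \<Longrightarrow> star X = X \<Longrightarrow> continuous_on (spec_range X) f \<Longrightarrow> calc X f \<in> A"
  by (intro calc_in_closed A_closed A_poly)

text \<open>The bicommutant of \<open>A\<close> relative to \<open>B\<close>: a commutative home for
  the range and spectral projections of self-adjoint elements of \<open>A\<close>, which may lie
  outside \<open>A\<close>.\<close>

definition bicomm :: "'a oper set"
  where "bicomm = {X \<in> B. \<forall>Y\<in>B. (\<forall>S\<in>A. S * Y = Y * S) \<longrightarrow> X * Y = Y * X}"

lemma bicommD:
  "X \<in> bicomm \<Longrightarrow> X \<in> B"
  "X \<in> bicomm \<Longrightarrow> Y \<in> B \<Longrightarrow> (\<And>S. S \<in> A \<Longrightarrow> S * Y = Y * S) \<Longrightarrow> X * Y = Y * X"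
  by (auto simp: bicomm_def)

lemma bicomm_A: "X \<in> bicomm \<Longrightarrow> S \<in> A \<Longrightarrow> X * S = S * X"
  using bicommD(2) sub A_commute by blast

text \<open>\<open>A\<close> lies in its own commutant, so elements of the bicommutant commute with
  \<open>A\<close> and then, by definition, with each other.\<close>

lemma bicomm_commute: "X \<in> bicomm \<Longrightarrow> Y \<in> bicomm \<Longrightarrow> X * Y = Y * X"
  using bicommD bicomm_A by (metis (full_types))

lemma bicomm_rproj: "S \<in> A \<Longrightarrow> star S = S \<Longrightarrow> rproj S \<in> bicomm"
  unfolding bicomm_def
proof (intro CollectI conjI ballI impI)
  assume S: "S \<in> A" "star S = S"
  then show "rproj S \<in> B"
    using sub rproj_in by blast
  fix Y
  assume "Y \<in> B" "\<forall>S\<in>A. S * Y = Y * S"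
  then show "rproj S * Y = Y * rproj S"
    using rproj_commute [of S Y] S by simp
qed

lemma bicomm_spec_proj: "S \<in> A \<Longrightarrow> star S = S \<Longrightarrow> spec_proj S t \<in> bicomm"
  unfolding bicomm_def
proof (intro CollectI conjI ballI impI)
  assume S: "S \<in> A" "star S = S"
  then show "spec_proj S t \<in> B"
    using sub spec_proj_in by blast
  fix Y
  assume "Y \<in> B" "\<forall>S\<in>A. S * Y = Y * S"
  then show "spec_proj S t * Y = Y * spec_proj S t"
    using spec_proj_commute [of S Y] S by simp
qed

text \<open>The squares are overlapping tents \<open>c k - c (Suc k)\<close> of width 2 e, evaluated
  at \<open>S\<close>; they sum to 1 by telescoping. Near scalarity is expressed as (S - s) \<rho> =
  K \<rho> with a small \<open>K\<close> in \<open>A\<close>, a form that survives multiplication by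
  commuting factors and passes to range projections.\<close>

lemma partition_of_unity_single:
  assumes S: "S \<in> A" "star S = S" and e: "0 < e"
  shows "\<exists>\<rho>s. sum_list (map (\<lambda>\<rho>. \<rho> * \<rho>) \<rho>s) = 1 \<and>
    (\<forall>\<rho>\<in>set \<rho>s. \<rho> \<in> A \<and> star \<rho> = \<rho> \<and> (\<exists>s. \<exists>K\<in>A. norm K \<le> e \<and> (S - s *\<^sub>R 1) * \<rho> = K * \<rho>))"
proof -
  define r where "r = norm S"
  define c where "c = (\<lambda>(k::nat) u. min 1 (max 0 ((u + r) / e + 1 - real k)))"
  define \<rho> where "\<rho> = (\<lambda>k u. sqrt (c k u - c (Suc k) u))"
  have cc: "continuous_on (spec_range S) (c k)" for k
    unfolding c_def using e by (intro continuous_intros) auto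
  have c\<rho>: "continuous_on (spec_range S) (\<rho> k)" for k
    unfolding \<rho>_def by (intro continuous_intros cc)
  have mono: "c (Suc k) u \<le> c k u" for k u
    by (auto simp: c_def)
  have sq: "calc S (\<rho> k) * calc S (\<rho> k) = calc S (c k) - calc S (c (Suc k))" for k
  proof -
    have "calc S (\<rho> k) * calc S (\<rho> k) = calc S (\<lambda>u. \<rho> k u * \<rho> k u)"
      using calc_mult [OF S(2) c\<rho> c\<rho>] by simp
    also have "\<dots> = calc S (\<lambda>u. c k u - c (Suc k) u)"
      by (intro calc_cong [OF S(2)] continuous_intros c\<rho>) (simp add: \<rho>_def mono)
    also have "\<dots> = calc S (c k) - calc S (c (Suc k))"
      by (intro calc_diff [OF S(2)] cc)
    finally show ?thesis .
  qed
  define \<rho>s where "\<rho>s = (\<lambda>n. map (\<lambda>k. calc S (\<rho> k)) [0..<n])"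
  have tele: "sum_list (map (\<lambda>\<rho>. \<rho> * \<rho>) (\<rho>s n)) = calc S (c 0) - calc S (c n)" for n
    by (induction n) (simp_all add: \<rho>s_def sq)
  \<comment> \<open>Large enough for the ramp \<open>c n\<close> to vanish on the interval, where (u
    + r) / e is at most 2 r / e.\<close>
  obtain n where n: "2 * r / e + 1 < real n"
    using reals_Archimedean2 by blast
  have "calc S (c 0) = calc S (\<lambda>u. 1)"
  proof (rule calc_cong [OF S(2) cc])
    fix u :: real
    assume "\<bar>u\<bar> \<le> norm S"
    then have "0 \<le> (u + r) / e"
      using e by (simp add: r_def)
    then show "c 0 u = 1"
      by (simp add: c_def)
  qed
  moreover have "calc S (c n) = calc S (\<lambda>u. 0)"
  proof (rule calc_cong [OF S(2) cc])
    fix u :: real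
    assume "\<bar>u\<bar> \<le> norm S"
    then have "(u + r) / e \<le> 2 * r / e"
      using e by (intro divide_right_mono) (auto simp: r_def)
    then show "c n u = 0"
      using n by (simp add: c_def)
  qed
  ultimately have "sum_list (map (\<lambda>\<rho>. \<rho> * \<rho>) (\<rho>s n)) = 1"
    by (simp add: tele calc_const S)
  moreover have "\<exists>s. \<exists>K\<in>A. norm K \<le> e \<and> (S - s *\<^sub>R 1) * calc S (\<rho> k) = K * calc S (\<rho> k)" for k
  proof (intro exI bexI conjI)
    \<comment> \<open>\<open>s\<close> is the peak of the tent with index \<open>k\<close>, and
      \<kappa> is u - s truncated at - e and e; these differ only where the tent vanishes.\<close>
    define s where "s = real k * e - r"
    define \<kappa> where "\<kappa> = (\<lambda>u. max (- e) (min e (u - s)))"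
    have c\<kappa>: "continuous_on (spec_range S) \<kappa>"
      unfolding \<kappa>_def by (intro continuous_intros)
    show "calc S \<kappa> \<in> A"
      by (intro A_calc S c\<kappa>)
    show "norm (calc S \<kappa>) \<le> e"
      using e by (intro norm_calc_le [OF S(2) c\<kappa>]) (auto simp: \<kappa>_def)
    have "(S - s *\<^sub>R 1) * calc S (\<rho> k) = calc S (\<lambda>u. u - s) * calc S (\<rho> k)"
      using calc_diff [OF S(2), of "\<lambda>u. u" "\<lambda>u. s"]
      by (simp add: calc_id calc_const S continuous_intros)
    also have "\<dots> = calc S (\<lambda>u. (u - s) * \<rho> k u)"
      by (rule calc_mult [OF S(2), symmetric]) (intro continuous_intros c\<rho>)+
    also have "\<dots> = calc S (\<lambda>u. \<kappa> u * \<rho> k u)"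
    proof (rule calc_cong [OF S(2)])
      fix u :: real
      show "(u - s) * \<rho> k u = \<kappa> u * \<rho> k u"
      proof (cases "\<rho> k u = 0")
        case False
        then have "c k u \<noteq> c (Suc k) u"
          by (auto simp: \<rho>_def)
        then have "0 < (u + r) / e + 1 - real k \<and> (u + r) / e + 1 - real (Suc k) < 1"
          by (auto simp: c_def min_def max_def split: if_splits)
        then have "0 < (u + r) / e + 1 - real k" "(u + r) / e + 1 - real (Suc k) < 1"
          by auto
        then have "(real k - 1) * e < u + r" "u + r < (real k + 1) * e"
          using e by (simp_all add: field_simps)
        then have "- e \<le> u - s" "u - s \<le> e"
          by (simp_all add: s_def algebra_simps)
        then show ?thesis
          by (simp add: \<kappa>_def)
      qed simp
    qed (intro continuous_intros c\<rho>)
    also have "\<dots> = calc S \<kappa> * calc S (\<rho> k)"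
      by (rule calc_mult [OF S(2) c\<kappa> c\<rho>])
    finally show "(S - s *\<^sub>R 1) * calc S (\<rho> k) = calc S \<kappa> * calc S (\<rho> k)" .
  qed
  ultimately show ?thesis
    by (intro exI [of _ "\<rho>s n"]) (auto simp: \<rho>s_def A_calc S star_calc c\<rho>)
qed

text \<open>Products of the partitions belonging to single elements inherit near scalarity from
  either factor, by commutativity.\<close>

lemma partition_of_unity:
  assumes "finite F" "\<And>S. S \<in> F \<Longrightarrow> S \<in> A \<and> star S = S" and e: "0 < e"
  shows "\<exists>\<rho>s. sum_list (map (\<lambda>\<rho>. \<rho> * \<rho>) \<rho>s) = 1 \<and>
    (\<forall>\<rho>\<in>set \<rho>s. \<rho> \<in> A \<and> star \<rho> = \<rho> \<and>
      (\<forall>S\<in>F. \<exists>s. \<exists>K\<in>A. norm K \<le> e \<and> (S - s *\<^sub>R 1) * \<rho> = K * \<rho>))"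
  using assms(1,2)
proof (induction F)
  case empty
  show ?case
    by (intro exI [of _ "[1]"]) simp
next
  case (insert S F)
  have "\<exists>\<rho>s. sum_list (map (\<lambda>\<rho>. \<rho> * \<rho>) \<rho>s) = 1 \<and>
    (\<forall>\<rho>\<in>set \<rho>s. \<rho> \<in> A \<and> star \<rho> = \<rho> \<and>
      (\<forall>S\<in>F. \<exists>s. \<exists>K\<in>A. norm K \<le> e \<and> (S - s *\<^sub>R 1) * \<rho> = K * \<rho>))"
    by (rule insert.IH) (use insert.prems in simp)
  then obtain \<rho>s where \<rho>s: "sum_list (map (\<lambda>\<rho>. \<rho> * \<rho>) \<rho>s) = 1"
    "\<And>\<rho>. \<rho> \<in> set \<rho>s \<Longrightarrow> \<rho> \<in> A \<and> star \<rho> = \<rho>"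
    "\<And>\<rho> S. \<rho> \<in> set \<rho>s \<Longrightarrow> S \<in> F \<Longrightarrow> \<exists>s. \<exists>K\<in>A. norm K \<le> e \<and> (S - s *\<^sub>R 1) * \<rho> = K * \<rho>"
    by blast
  obtain \<sigma>s where \<sigma>s: "sum_list (map (\<lambda>\<rho>. \<rho> * \<rho>) \<sigma>s) = 1"
    "\<And>\<sigma>. \<sigma> \<in> set \<sigma>s \<Longrightarrow> \<sigma> \<in> A \<and> star \<sigma> = \<sigma>"
    "\<And>\<sigma>. \<sigma> \<in> set \<sigma>s \<Longrightarrow> \<exists>s. \<exists>K\<in>A. norm K \<le> e \<and> (S - s *\<^sub>R 1) * \<sigma> = K * \<sigma>"
    using partition_of_unity_single [OF _ _ e, of S] insert.prems by (meson insertI1)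
  define \<tau>s where "\<tau>s = concat (map (\<lambda>\<rho>. map (\<lambda>\<sigma>. \<rho> * \<sigma>) \<sigma>s) \<rho>s)"
  have "sum_list (map (\<lambda>\<rho>. \<rho> * \<rho>) \<tau>s) = 1"
    unfolding \<tau>s_def using \<rho>s(1,2) \<sigma>s(1,2) A_commute by (subst sum_list_products) auto
  moreover have "\<exists>s. \<exists>K\<in>A. norm K \<le> e \<and> (S' - s *\<^sub>R 1) * (\<rho> * \<sigma>) = K * (\<rho> * \<sigma>)"
    if \<rho>: "\<rho> \<in> set \<rho>s" and \<sigma>: "\<sigma> \<in> set \<sigma>s" and S': "S' \<in> insert S F" for \<rho> \<sigma> S'
  proof (cases "S' = S")
    case True
    obtain s K where K: "K \<in> A" "norm K \<le> e" "(S - s *\<^sub>R 1) * \<sigma> = K * \<sigma>"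
      using \<sigma>s(3) [OF \<sigma>] by blast
    have "\<rho> * \<sigma> = \<sigma> * \<rho>"
      using \<rho>s(2) [OF \<rho>] \<sigma>s(2) [OF \<sigma>] A_commute by blast
    then have "(S - s *\<^sub>R 1) * (\<rho> * \<sigma>) = K * (\<rho> * \<sigma>)"
      using K(3) by (metis mult.assoc)
    then show ?thesis
      using K True by blast
  next
    case False
    then obtain s K where "K \<in> A" "norm K \<le> e" "(S' - s *\<^sub>R 1) * \<rho> = K * \<rho>"
      using \<rho>s(3) [OF \<rho>, of S'] S' by blast
    then show ?thesis
      by (metis mult.assoc)
  qed
  moreover have "\<rho> * \<sigma> \<in> A \<and> star (\<rho> * \<sigma>) = \<rho> * \<sigma>" if "\<rho> \<in> set \<rho>s" "\<sigma> \<in> set \<sigma>s" for \<rho> \<sigma>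
    using \<rho>s(2) [OF that(1)] \<sigma>s(2) [OF that(2)] A_commute by auto
  ultimately show ?case
    by (intro exI [of _ \<tau>s]) (auto simp: \<tau>s_def)
qed

text \<open>
  Averaging over the group of symmetries generated by \<open>2 g - 1\<close>, \<open>g \<in> \<G>\<close>. Each conjugation by
  such a symmetry permutes the projections below a fixed \<open>f \<in> \<F>\<close>, so the commutator bound for
  these is inherited by the average.
\<close>

lemma compression:
  assumes T: "T \<in> B"
    and sym: "\<And>P. P \<in> bicomm \<Longrightarrow> proj P \<Longrightarrow> norm (T * P - P * T) \<le> s"
    and \<F>: "\<F> \<subseteq> bicomm"
    and local: "\<And>f P. f \<in> \<F> \<Longrightarrow> P \<in> B \<Longrightarrow> proj P \<Longrightarrow> f * P = P \<Longrightarrow> norm (T * P - P * T) \<le> s"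
    and \<G>: "finite \<G>" "\<And>g. g \<in> \<G> \<Longrightarrow> g \<in> bicomm \<and> proj g"
  shows "\<exists>X\<in>B. (\<forall>g\<in>\<G>. g * X = X * g) \<and> norm (T - X) \<le> 2 * s \<and>
    (\<forall>f\<in>\<F>. \<forall>P\<in>B. proj P \<longrightarrow> f * P = P \<longrightarrow> norm (X * P - P * X) \<le> s)"
proof -
  define \<U> where "\<U> = {u \<in> bicomm. star u = u \<and> u * u = 1}"
  have bic: "bicomm \<subseteq> B"
    using bicommD(1) by blast
  have norm_u: "norm u \<le> 1" if "u \<in> \<U>" for u
  proof -
    have "(norm u)\<^sup>2 \<le> 1"
      using that norm_star_mult [of u] norm_one_le [where 'a = 'a] by (simp add: \<U>_def)
    then show ?thesis
      by (simp add: abs_square_le_1)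
  qed
  have bicomm_add: "X + Y \<in> bicomm" if "X \<in> bicomm" "Y \<in> bicomm" for X Y
    using that unfolding bicomm_def by (auto simp: distrib_left distrib_right)
  have bicomm_scaleR: "r *\<^sub>R X \<in> bicomm" if "X \<in> bicomm" for r X
    using that unfolding bicomm_def by auto
  have bicomm_mult: "X * Y \<in> bicomm" if "X \<in> bicomm" "Y \<in> bicomm" for X Y
    using that unfolding bicomm_def by (auto intro!: commute_mult)
  have bicomm_1: "1 \<in> bicomm"
    by (simp add: bicomm_def)
  have conj_le: "norm (u * Z * u) \<le> norm Z" if "u \<in> \<U>" for u Z
  proof -
    have "norm (u * Z * u) \<le> norm u * norm Z * norm u"
      by (intro order_trans [OF norm_mult_ineq] mult_right_mono norm_mult_ineq) simp
    also have "\<dots> \<le> 1 * norm Z * 1"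
      using norm_u [OF that] by (intro mult_mono) auto
    finally show ?thesis
      by simp
  qed
  have \<U>mult: "u * v \<in> \<U>" if "u \<in> \<U>" "v \<in> \<U>" for u v
  proof -
    have uv: "u * v = v * u"
      using that bicomm_commute by (auto simp: \<U>_def)
    then have "u * v * (u * v) = (u * u) * (v * v)"
      by (metis mult.assoc)
    then have "u * v * (u * v) = 1"
      using that by (simp add: \<U>_def)
    then show ?thesis
      using that uv bicomm_mult by (simp add: \<U>_def)
  qed
  \<comment> \<open>With u = 2 P - 1 one has T - u T u = [T, u] u = 2 [T, P] u, whence the factor
    2.\<close>
  have base: "norm (T - u * T * u) \<le> 2 * s" if u: "u \<in> \<U>" for u
  proof -
    define P where "P = (1 / 2) *\<^sub>R (1 + u)"
    have uu: "u * u = 1" "star u = u"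
      using u by (auto simp: \<U>_def)
    have "P \<in> bicomm"
      unfolding P_def using u by (intro bicomm_add bicomm_scaleR bicomm_1) (simp add: \<U>_def)
    moreover have "proj P"
      by (simp add: proj_def P_def uu algebra_simps flip: scaleR_2)
    ultimately have "norm (T * P - P * T) \<le> s"
      by (rule sym)
    moreover have "T * P - P * T = (1 / 2) *\<^sub>R (T * u - u * T)"
      by (simp add: P_def algebra_simps)
    ultimately have "norm (T * u - u * T) \<le> 2 * s"
      by simp
    moreover have "T - u * T * u = (T * u - u * T) * u"
      by (simp add: left_diff_distrib mult.assoc uu)
    moreover have "norm ((T * u - u * T) * u) \<le> norm (T * u - u * T) * norm u"
      by (rule norm_mult_ineq)
    moreover have "\<dots> \<le> norm (T * u - u * T)"
      using norm_u [OF u] by (intro mult_left_le) auto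
    ultimately show ?thesis
      by simp
  qed
  \<comment> \<open>The bound is carried for all conjugates u X u with u \<in> \<U>: conjugates of
    the new average are averages of such conjugates, so the error stays 2 s however many
    \<open>g\<close> are used.\<close>
  have "\<exists>X\<in>B. (\<forall>g\<in>\<G>. g * X = X * g) \<and> (\<forall>u\<in>\<U>. norm (T - u * X * u) \<le> 2 * s) \<and>
    (\<forall>f\<in>\<F>. \<forall>P\<in>B. proj P \<longrightarrow> f * P = P \<longrightarrow> norm (X * P - P * X) \<le> s)"
    using \<G>
  proof (induction \<G>)
    case empty
    then show ?case
      using T base local by blast
  next
    case (insert g \<G>)
    then obtain X where X: "X \<in> B" "\<And>g. g \<in> \<G> \<Longrightarrow> g * X = X * g"
      "\<And>u. u \<in> \<U> \<Longrightarrow> norm (T - u * X * u) \<le> 2 * s"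
      "\<And>f P. f \<in> \<F> \<Longrightarrow> P \<in> B \<Longrightarrow> proj P \<Longrightarrow> f * P = P \<Longrightarrow> norm (X * P - P * X) \<le> s"
      by (metis insertCI)
    have g: "g \<in> bicomm" "proj g"
      using insert.prems by auto
    define v where "v = 2 *\<^sub>R g + (-1) *\<^sub>R 1"
    have vW: "v \<in> bicomm"
      unfolding v_def by (intro bicomm_add bicomm_scaleR bicomm_1 g)
    have vv: "v * v = 1" and vs: "star v = v"
      using projD [OF g(2)] by (simp_all add: v_def algebra_simps scaleR_2)
    have v: "v \<in> \<U>"
      by (simp add: \<U>_def vW vv vs)
    have vB: "v \<in> B"
      using vW bic by blast
    define X' where "X' = (1 / 2) *\<^sub>R (X + v * X * v)"
    have "X' \<in> B"
      by (simp add: X'_def X vB)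
    moreover have "g' * X' = X' * g'" if g': "g' \<in> insert g \<G>" for g'
    proof (cases "g' = g")
      case True
      have "v * X' = X' * v"
        by (simp add: X'_def distrib_left distrib_right mult.assoc vv)
          (simp add: vv add.commute flip: mult.assoc)
      then have "2 *\<^sub>R (g * X') = 2 *\<^sub>R (X' * g)"
        by (simp add: v_def left_diff_distrib right_diff_distrib)
      then show ?thesis
        using True by simp
    next
      case False
      then have g': "g' * X = X * g'" "g' * v = v * g'"
        using X(2) that insert.prems vW bicomm_commute by auto
      have "v * X * v * g' = g' * (v * X * v)"
        by (intro commute_mult) (simp_all add: g')
      then show ?thesis
        by (simp add: X'_def distrib_left distrib_right g'(1))
    qed
    moreover have "norm (T - u * X' * u) \<le> 2 * s" if u: "u \<in> \<U>" for u
    proof -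
      have uv: "u * v = v * u"
        using u vW bicomm_commute by (auto simp: \<U>_def)
      have "u * X' * u = (1 / 2) *\<^sub>R (u * X * u + (u * v) * X * (u * v))"
        unfolding X'_def by (subst (2) uv) (simp add: distrib_left distrib_right mult.assoc)
      then have "2 *\<^sub>R (T - u * X' * u) = (T - u * X * u) + (T - (u * v) * X * (u * v))"
        by (simp add: scaleR_diff_right scaleR_2)
      then have "2 * norm (T - u * X' * u) = norm ((T - u * X * u) + (T - (u * v) * X * (u * v)))"
        by (metis norm_scaleR abs_numeral)
      also have "\<dots> \<le> 2 * s + 2 * s"
        by (intro order_trans [OF norm_triangle_ineq] add_mono X(3) \<U>mult u v)
      finally show ?thesis
        by simp
    qed
    moreover have "norm (X' * P - P * X') \<le> s"
      if f: "f \<in> \<F>" and P: "P \<in> B" "proj P" "f * P = P" for f P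
    proof -
      have fv: "f * v = v * f"
        using \<F> f vW bicomm_commute by blast
      define P' where "P' = v * P * v"
      have "P' \<in> B"
        by (simp add: P'_def vB P)
      moreover have "proj P'"
        unfolding proj_def
      proof
        show "star P' = P'"
          by (simp add: P'_def vs projD(1) [OF P(2)] mult.assoc)
        have "P' * P' = v * P * (v * v) * P * v"
          by (simp add: P'_def mult.assoc)
        then show "P' * P' = P'"
          using projD(2) [OF P(2)] by (simp add: vv P'_def mult.assoc flip: mult.assoc [of P P])
      qed
      moreover have "f * P' = P'"
        unfolding P'_def using fv P(3) by (metis mult.assoc)
      ultimately have 1: "norm (X * P' - P' * X) \<le> s"
        using X(4) f by blast
      have "v * (X * P' - P' * X) * v = (v * X * v) * P * (v * v) - (v * v) * P * (v * X * v)"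
        by (simp add: P'_def left_diff_distrib right_diff_distrib mult.assoc)
      moreover have "X' * P - P * X' = (1 / 2) *\<^sub>R ((X * P - P * X) + ((v * X * v) * P - P * (v * X * v)))"
        by (simp add: X'_def algebra_simps)
      ultimately have "X' * P - P * X' = (1 / 2) *\<^sub>R ((X * P - P * X) + v * (X * P' - P' * X) * v)"
        by (simp only: vv mult_1_left mult_1_right)
      then have "2 * norm (X' * P - P * X') = norm ((X * P - P * X) + v * (X * P' - P' * X) * v)"
        by simp
      also have "\<dots> \<le> s + s"
        using X(4) [OF f P] 1 conj_le [OF v, of "X * P' - P' * X"]
        by (intro order_trans [OF norm_triangle_ineq] add_mono) auto
      finally show ?thesis
        by simp
    qed
    ultimately show ?case
      by blast
  qed
  moreover have "1 \<in> \<U>"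
    by (simp add: \<U>_def bicomm_1)
  ultimately show ?thesis
    by (metis mult_1_left mult_1_right)
qed

end

section \<open>The distance estimate\<close>

lemma norm_sum_list_le: "norm (sum_list (map f xs)) \<le> sum_list (map (\<lambda>x. norm (f x)) xs)"
  for f :: "'b \<Rightarrow> 'a::real_normed_vector"
  by (induction xs) (auto intro: order_trans [OF norm_triangle_ineq])

context abelian_subalgebra
begin

text \<open>Since each z is central, (h - z) \<rho>^2 = \<rho> (h - z) \<rho> + [h, \<rho>] \<rho>.
  The first terms are summed by \<open>norm_sum_sandwich_le\<close>, with one \<open>d\<close> from
  the central approximation; the others are summed by the triangle inequality and cost the second
  \<open>d\<close>.\<close>

lemma selfadjoint_approx:
  assumes h: "h \<in> B" "star h = h"
    and one: "sum_list (map (\<lambda>\<rho>. \<rho> * \<rho>) \<rho>s) = 1"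
    and \<rho>: "\<And>\<rho>. \<rho> \<in> set \<rho>s \<Longrightarrow> \<rho> \<in> A \<and> star \<rho> = \<rho>"
    and comm: "\<And>\<rho>. \<rho> \<in> set \<rho>s \<Longrightarrow> h * rproj \<rho> = rproj \<rho> * h"
    and small: "\<And>\<rho> P. \<rho> \<in> set \<rho>s \<Longrightarrow> P \<in> B \<Longrightarrow> proj P \<Longrightarrow> rproj \<rho> * P = P \<Longrightarrow>
      norm (h * P - P * h) \<le> s"
    and near: "sum_list (map (\<lambda>\<rho>. norm (h * \<rho> - \<rho> * h) * norm \<rho>) \<rho>s) \<le> d"
    and s: "0 \<le> s" and d: "0 < d"
  shows "\<exists>z. (\<forall>\<rho>\<in>set \<rho>s. z \<rho> \<in> B \<and> (\<forall>X\<in>B. z \<rho> * X = X * z \<rho>)) \<and>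
    norm (h - sum_list (map (\<lambda>\<rho>. z \<rho> * (\<rho> * \<rho>)) \<rho>s)) \<le> 2 * s + 2 * d"
proof -
  have "\<exists>z\<in>B. (\<forall>X\<in>B. z * X = X * z) \<and> norm ((h - z) * rproj \<rho>) \<le> 2 * s + d"
    if "\<rho> \<in> set \<rho>s" for \<rho>
    using \<rho> [OF that] sub comm [OF that] small [OF that]
    by (intro central_approx h rproj_in rproj(1) d) auto
  then obtain z where z: "\<And>\<rho>. \<rho> \<in> set \<rho>s \<Longrightarrow> z \<rho> \<in> B"
    "\<And>\<rho> X. \<rho> \<in> set \<rho>s \<Longrightarrow> X \<in> B \<Longrightarrow> z \<rho> * X = X * z \<rho>"
    "\<And>\<rho>. \<rho> \<in> set \<rho>s \<Longrightarrow> norm ((h - z \<rho>) * rproj \<rho>) \<le> 2 * s + d"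
    by metis
  define Y where "Y = (\<lambda>\<rho>. (h - z \<rho>) * rproj \<rho>)"
  have term_eq: "(h - z \<rho>) * (\<rho> * \<rho>) = \<rho> * Y \<rho> * \<rho> + (h * \<rho> - \<rho> * h) * \<rho>" if r: "\<rho> \<in> set \<rho>s" for \<rho>
  proof -
    have "z \<rho> * \<rho> = \<rho> * z \<rho>"
      using z(2) [OF r] \<rho> [OF r] sub by blast
    then have "(h - z \<rho>) * \<rho> = \<rho> * (h - z \<rho>) + (h * \<rho> - \<rho> * h)"
      by (simp add: left_diff_distrib right_diff_distrib)
    then have "(h - z \<rho>) * \<rho> * \<rho> = \<rho> * (h - z \<rho>) * \<rho> + (h * \<rho> - \<rho> * h) * \<rho>"
      by (simp only: distrib_right)
    moreover have "\<rho> * Y \<rho> * \<rho> = \<rho> * (h - z \<rho>) * \<rho>"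
      by (simp add: Y_def mult.assoc rproj(2))
    ultimately show ?thesis
      by (simp only: mult.assoc)
  qed
  have "h - sum_list (map (\<lambda>\<rho>. z \<rho> * (\<rho> * \<rho>)) \<rho>s)
      = h * sum_list (map (\<lambda>\<rho>. \<rho> * \<rho>) \<rho>s) - sum_list (map (\<lambda>\<rho>. z \<rho> * (\<rho> * \<rho>)) \<rho>s)"
    by (simp add: one)
  also have "\<dots> = sum_list (map (\<lambda>\<rho>. (h - z \<rho>) * (\<rho> * \<rho>)) \<rho>s)"
    by (simp add: sum_list_subtractf sum_list_const_mult left_diff_distrib)
  also have "\<dots> = sum_list (map (\<lambda>\<rho>. \<rho> * Y \<rho> * \<rho> + (h * \<rho> - \<rho> * h) * \<rho>) \<rho>s)"
    using term_eq by (metis (no_types, lifting) map_cong)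
  also have "\<dots> = sum_list (map (\<lambda>\<rho>. \<rho> * Y \<rho> * \<rho>) \<rho>s) + sum_list (map (\<lambda>\<rho>. (h * \<rho> - \<rho> * h) * \<rho>) \<rho>s)"
    by (rule sum_list_addf)
  also have "norm \<dots> \<le> (2 * s + d) + d"
  proof (intro order_trans [OF norm_triangle_ineq] add_mono)
    show "norm (sum_list (map (\<lambda>\<rho>. \<rho> * Y \<rho> * \<rho>) \<rho>s)) \<le> 2 * s + d"
      using \<rho> z(3) s d by (intro norm_sum_sandwich_le one) (auto simp: Y_def)
    have "norm (sum_list (map (\<lambda>\<rho>. (h * \<rho> - \<rho> * h) * \<rho>) \<rho>s))
        \<le> sum_list (map (\<lambda>\<rho>. norm (h * \<rho> - \<rho> * h) * norm \<rho>) \<rho>s)"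
      by (intro order_trans [OF norm_sum_list_le] sum_list_mono norm_mult_ineq)
    then show "norm (sum_list (map (\<lambda>\<rho>. (h * \<rho> - \<rho> * h) * \<rho>) \<rho>s)) \<le> d"
      using near by linarith
  qed
  finally show ?thesis
    using z(1,2) by (intro exI [of _ z]) auto
qed

end

text \<open>\<open>J\<close> is multiplication by the imaginary unit.\<close>

locale complex_abelian_subalgebra = abelian_subalgebra B A
  for B A :: "'a::{real_inner,banach} oper set" +
  fixes J :: "'a oper"
  assumes A_star: "X \<in> A \<Longrightarrow> star X \<in> A"
    and J_A: "J \<in> A" and J_commute: "X \<in> B \<Longrightarrow> J * X = X * J"
    and J_square: "J * J = - 1" and J_star: "star J = - J"
begin

lemma J_B: "J \<in> B"
  using J_A sub by blast

lemma norm_J_le: "norm J \<le> 1"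
proof -
  have "(norm J)\<^sup>2 \<le> 1"
    using norm_star_mult [of J] norm_one_le [where 'a = 'a] by (simp add: J_star J_square)
  then show ?thesis
    by (simp add: abs_square_le_1)
qed

lemma norm_J_mult_le: "norm (J * X) \<le> norm X"
proof -
  have "norm (J * X) \<le> norm J * norm X"
    by (rule norm_mult_ineq)
  also have "\<dots> \<le> norm X"
    using norm_J_le by (simp add: mult_left_le_one_le)
  finally show ?thesis .
qed

section \<open>Real and imaginary parts with respect to \<open>J\<close>\<close>

definition re_part :: "'a oper \<Rightarrow> 'a oper"
  where "re_part X = (1 / 2) *\<^sub>R (X + star X)"

text \<open>The factor - J / 2 stands for 1 / (2 i).\<close>

definition im_part :: "'a oper \<Rightarrow> 'a oper"
  where "im_part X = (- 1 / 2) *\<^sub>R (J * (X - star X))"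

lemma parts_decomp: "X = re_part X + J * im_part X"
proof -
  have "J * im_part X = (- 1 / 2) *\<^sub>R ((J * J) * (X - star X))"
    by (simp add: im_part_def mult.assoc)
  then have "re_part X + J * im_part X = (1 / 2) *\<^sub>R (X + star X) + (1 / 2) *\<^sub>R (X - star X)"
    by (simp add: J_square re_part_def scaleR_diff_right)
  also have "\<dots> = X"
    by (simp add: scaleR_diff_right scaleR_add_right flip: scaleR_add_left)
  finally show ?thesis
    by simp
qed

lemma star_parts: "star (re_part X) = re_part X" "X \<in> B \<Longrightarrow> star (im_part X) = im_part X"
proof -
  show "star (re_part X) = re_part X"
    by (simp add: re_part_def add.commute)
  assume "X \<in> B"
  then have "(X - star X) * J = J * (X - star X)"
    using J_commute [of "X - star X"] by simp
  then show "star (im_part X) = im_part X"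
    by (simp add: im_part_def J_star left_diff_distrib right_diff_distrib)
qed

lemma parts_in: "X \<in> B \<Longrightarrow> re_part X \<in> B" "X \<in> B \<Longrightarrow> im_part X \<in> B"
  using J_B by (simp_all add: re_part_def im_part_def)

lemma parts_in_A: "X \<in> A \<Longrightarrow> re_part X \<in> A" "X \<in> A \<Longrightarrow> im_part X \<in> A"
proof -
  assume X: "X \<in> A"
  then show "re_part X \<in> A"
    by (simp add: re_part_def A_star)
  have "X - star X = X + (-1) *\<^sub>R star X"
    by simp
  then have "X - star X \<in> A"
    using X A_star by (metis A_add A_scaleR)
  then show "im_part X \<in> A"
    unfolding im_part_def by (intro A_scaleR A_mult J_A)
qed

lemma norm_parts_le: "norm (re_part X) \<le> norm X" "norm (im_part X) \<le> norm X"
proof -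
  have "norm (X + star X) \<le> 2 * norm X" "norm (X - star X) \<le> 2 * norm X"
    using norm_triangle_ineq [of X "star X"] norm_triangle_ineq4 [of X "star X"] by simp_all
  then show "norm (re_part X) \<le> norm X" "norm (im_part X) \<le> norm X"
    using norm_J_mult_le [of "X - star X"] by (simp_all add: re_part_def im_part_def)
qed

text \<open>If C is the commutator of \<open>X\<close> with \<open>P\<close>, that of
  \<open>star X\<close> is - star C; the parts thus have commutators (C - star C) / 2 and - J (C +
  star C) / 2, of norm at most that of C.\<close>

lemma norm_parts_commutator_le:
  assumes X: "X \<in> B" and P: "P \<in> B" "proj P" and le: "norm (X * P - P * X) \<le> s"
  shows "norm (re_part X * P - P * re_part X) \<le> s" "norm (im_part X * P - P * im_part X) \<le> s"
proof -
  define C where "C = X * P - P * X"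
  have C': "star X * P - P * star X = - star C"
    by (simp add: C_def projD(1) [OF P(2)])
  have n: "norm (C - star C) \<le> 2 * s" "norm (C + star C) \<le> 2 * s"
    using norm_triangle_ineq [of C "star C"] norm_triangle_ineq4 [of C "star C"] le
    by (simp_all add: C_def [symmetric])
  have "re_part X * P - P * re_part X = (1 / 2) *\<^sub>R ((X * P - P * X) + (star X * P - P * star X))"
    by (simp add: re_part_def algebra_simps)
  also have "\<dots> = (1 / 2) *\<^sub>R (C - star C)"
    by (simp only: C' C_def [symmetric]) simp
  finally show "norm (re_part X * P - P * re_part X) \<le> s"
    using n by simp
  have JP: "P * (J * Y) = J * (P * Y)" for Y
    using J_commute [OF P(1)] by (metis mult.assoc)
  have "im_part X * P - P * im_part X = (- 1 / 2) *\<^sub>R (J * ((X * P - P * X) - (star X * P - P * star X)))"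
    by (simp add: im_part_def JP algebra_simps)
  also have "\<dots> = (- 1 / 2) *\<^sub>R (J * (C + star C))"
    by (simp only: C' C_def [symmetric]) simp
  finally show "norm (im_part X * P - P * im_part X) \<le> s"
    using n order_trans [OF norm_J_mult_le [of "C + star C"] n(2)] by simp
qed

lemma parts_commute:
  assumes "g * X = X * g" "star g = g" "g \<in> B"
  shows "re_part X * g = g * re_part X" "im_part X * g = g * im_part X"
proof -
  have s: "star X * g = g * star X"
    using assms(1,2) by (metis star_simps(3))
  then show "re_part X * g = g * re_part X"
    using assms(1) by (simp add: re_part_def distrib_left distrib_right)
  have "(J * (X - star X)) * g = g * (J * (X - star X))"
    using assms(1) s by (intro commute_mult J_commute assms(3)) (simp add: left_diff_distrib right_diff_distrib)
  then show "im_part X * g = g * im_part X"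
    by (simp add: im_part_def)
qed

lemma distance_bound:
  assumes T: "T \<in> B" and F: "finite F" "F \<subseteq> A" and e: "0 < e"
    and bound: "\<And>P. P \<in> B \<Longrightarrow> proj P \<Longrightarrow> (\<And>S. S \<in> F \<Longrightarrow> norm (S * P - P * S) \<le> e) \<Longrightarrow>
      norm (T * P - P * T) \<le> s"
    and \<eta>: "0 < \<eta>"
  shows "\<exists>\<rho>s z. (\<forall>\<rho>\<in>set \<rho>s. \<rho> \<in> A \<and> z \<rho> \<in> B \<and> (\<forall>X\<in>B. z \<rho> * X = X * z \<rho>)) \<and>
    norm (T - sum_list (map (\<lambda>\<rho>. z \<rho> * (\<rho> * \<rho>)) \<rho>s)) \<le> 6 * s + \<eta>"
proof -
  define F' where "F' = re_part ` F \<union> im_part ` F"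
  have "\<exists>\<rho>s. sum_list (map (\<lambda>\<rho>. \<rho> * \<rho>) \<rho>s) = 1 \<and>
    (\<forall>\<rho>\<in>set \<rho>s. \<rho> \<in> A \<and> star \<rho> = \<rho> \<and>
      (\<forall>S\<in>F'. \<exists>s. \<exists>K\<in>A. norm K \<le> e / 4 \<and> (S - s *\<^sub>R 1) * \<rho> = K * \<rho>))"
    using F e sub by (intro partition_of_unity) (auto simp: F'_def parts_in_A star_parts)
  then obtain \<rho>s where one: "sum_list (map (\<lambda>\<rho>. \<rho> * \<rho>) \<rho>s) = 1"
    and \<rho>: "\<And>\<rho>. \<rho> \<in> set \<rho>s \<Longrightarrow> \<rho> \<in> A \<and> star \<rho> = \<rho>"
    and K: "\<And>\<rho> S. \<rho> \<in> set \<rho>s \<Longrightarrow> S \<in> F' \<Longrightarrow>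
      \<exists>s. \<exists>K\<in>A. norm K \<le> e / 4 \<and> (S - s *\<^sub>R 1) * \<rho> = K * \<rho>"
    by blast
  have F'A: "S \<in> A" if "S \<in> F'" for S
    using that F by (auto simp: F'_def parts_in_A)
  have f: "rproj \<rho> \<in> bicomm" "proj (rproj \<rho>)" if "\<rho> \<in> set \<rho>s" for \<rho>
    using \<rho> [OF that] by (auto intro: bicomm_rproj rproj(1))
  \<comment> \<open>Below the range projection of \<rho>, each element of F' is a scalar up to some
    \<open>K\<close> of norm at most e / 4, so \<open>P\<close> nearly commutes with F' and thereby
    with \<open>F\<close>.\<close>
  have local: "norm (T * P - P * T) \<le> s"
    if r: "\<rho> \<in> set \<rho>s" and P: "P \<in> B" "proj P" "rproj \<rho> * P = P" for \<rho> P
  proof (rule bound [OF P(1,2)])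
    have le: "norm (S * P - P * S) \<le> e / 2" if S: "S \<in> F'" for S
    proof -
      obtain t K where K: "K \<in> A" "norm K \<le> e / 4" "(S - t *\<^sub>R 1) * \<rho> = K * \<rho>"
        using K [OF r S] by blast
      then have "(S - t *\<^sub>R 1 - K) * \<rho> = 0"
        by (simp add: left_diff_distrib)
      then have "(S - t *\<^sub>R 1 - K) * rproj \<rho> = 0"
        by (rule rproj_annihilate)
      then have Sf: "(S - t *\<^sub>R 1) * rproj \<rho> = K * rproj \<rho>"
        by (simp add: left_diff_distrib)
      have fS: "rproj \<rho> * (S - t *\<^sub>R 1) = (S - t *\<^sub>R 1) * rproj \<rho>"
        using bicomm_A [OF f(1) [OF r] F'A [OF S]] by (simp add: left_diff_distrib right_diff_distrib)
      have fK: "rproj \<rho> * K = K * rproj \<rho>"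
        by (rule bicomm_A [OF f(1) [OF r] K(1)])
      have Pf: "P * rproj \<rho> = P"
        using proj_fixes [OF f(2) [OF r] P(3)] projD(1) [OF P(2)] by simp
      have 1: "(S - t *\<^sub>R 1) * P = K * P"
        using Sf P(3) by (metis mult.assoc)
      have 2: "P * (S - t *\<^sub>R 1) = P * K"
        using Sf fS fK Pf by (metis mult.assoc)
      have "S * P - P * S = (S - t *\<^sub>R 1) * P - P * (S - t *\<^sub>R 1)"
        by (simp add: left_diff_distrib right_diff_distrib)
      also have "\<dots> = K * P - P * K"
        by (simp only: 1 2)
      also have "norm \<dots> \<le> norm K"
        by (rule norm_commutator_proj_le [OF P(2)])
      finally show ?thesis
        using K(2) e by linarith
    qed
    fix S
    assume S: "S \<in> F"
    then have SB: "S \<in> B"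
      using F sub by blast
    have "P * (J * Y) = J * (P * Y)" for Y
      using J_commute [OF P(1)] by (metis mult.assoc)
    then have "S * P - P * S = (re_part S * P - P * re_part S) + J * (im_part S * P - P * im_part S)"
      by (subst (1 2) parts_decomp [of S]) (simp add: algebra_simps)
    also have "norm \<dots> \<le> e / 2 + e / 2"
      using S by (intro order_trans [OF norm_triangle_ineq] add_mono order_trans [OF norm_J_mult_le] le)
        (auto simp: F'_def)
    finally show "norm (S * P - P * S) \<le> e"
      by simp
  qed
  \<comment> \<open>Elements of the bicommutant commute exactly with \<open>F\<close>.\<close>
  have sym: "norm (T * P - P * T) \<le> s" if P: "P \<in> bicomm" "proj P" for P
  proof (rule bound [OF bicommD(1) [OF P(1)] P(2)])
    fix S
    assume "S \<in> F"
    then show "norm (S * P - P * S) \<le> e"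
      using bicomm_A [OF P(1), of S] F e by auto
  qed
  have s: "0 \<le> s"
    using sym [of 1] by (simp add: bicomm_def proj_def)
  \<comment> \<open>Each part of X will contribute an error 2 \<delta>, in total \<eta>. The
    precision \<open>d\<close> keeps the sum of the norm [h, \<rho>] norm \<rho> within \<delta>,
    because norm h \<le> norm T + 2 s; the added ones make the denominator positive.\<close>
  define \<delta> where "\<delta> = \<eta> / 4"
  define C where "C = sum_list (map norm \<rho>s) + 1"
  define d where "d = \<delta> / ((norm T + 2 * s + 1) * C)"
  have sum_nonneg: "0 \<le> sum_list (map norm \<rho>s)"
    by (rule sum_list_nonneg) auto
  then have C: "C > 0"
    by (simp add: C_def)
  have d: "\<delta> > 0" "d > 0"
    unfolding d_def \<delta>_def using \<eta> C s by (auto intro!: divide_pos_pos mult_pos_pos add_nonneg_pos)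
  have "\<exists>\<G>. finite \<G> \<and> \<G> \<subseteq> range (spec_proj \<rho>) \<and>
    (\<forall>Y. (\<forall>g\<in>\<G>. g * Y = Y * g) \<longrightarrow> norm (Y * \<rho> - \<rho> * Y) \<le> d * norm Y)"
    if "\<rho> \<in> set \<rho>s" for \<rho>
    using commutator_small [OF _ d(2)] \<rho> [OF that] by blast
  then obtain G where G: "\<And>\<rho>. \<rho> \<in> set \<rho>s \<Longrightarrow> finite (G \<rho>)"
    "\<And>\<rho>. \<rho> \<in> set \<rho>s \<Longrightarrow> G \<rho> \<subseteq> range (spec_proj \<rho>)"
    "\<And>\<rho> Y. \<rho> \<in> set \<rho>s \<Longrightarrow> (\<And>g. g \<in> G \<rho> \<Longrightarrow> g * Y = Y * g) \<Longrightarrow> norm (Y * \<rho> - \<rho> * Y) \<le> d * norm Y"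
    by metis
  \<comment> \<open>The range projections are included for exact commutation with X, the spectral
    projections for near commutation with each \<rho>.\<close>
  define \<G> where "\<G> = rproj ` set \<rho>s \<union> (\<Union>\<rho>\<in>set \<rho>s. G \<rho>)"
  have \<G>: "g \<in> bicomm \<and> proj g" if "g \<in> \<G>" for g
  proof -
    consider \<rho> where "\<rho> \<in> set \<rho>s" "g = rproj \<rho>" | \<rho> t where "\<rho> \<in> set \<rho>s" "g = spec_proj \<rho> t"
      using \<open>g \<in> \<G>\<close> G(2) unfolding \<G>_def by blast
    then show ?thesis
      by cases (metis f, metis \<rho> bicomm_spec_proj spec_proj_proj)
  qed
  have "\<exists>X\<in>B. (\<forall>g\<in>\<G>. g * X = X * g) \<and> norm (T - X) \<le> 2 * s \<and>
    (\<forall>f\<in>rproj ` set \<rho>s. \<forall>P\<in>B. proj P \<longrightarrow> f * P = P \<longrightarrow> norm (X * P - P * X) \<le> s)"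
    using f local \<G> G(1) by (intro compression [OF T sym]) (auto simp: \<G>_def)
  then obtain X where X: "X \<in> B" "\<And>g. g \<in> \<G> \<Longrightarrow> g * X = X * g" "norm (T - X) \<le> 2 * s"
    "\<And>\<rho> P. \<rho> \<in> set \<rho>s \<Longrightarrow> P \<in> B \<Longrightarrow> proj P \<Longrightarrow> rproj \<rho> * P = P \<Longrightarrow> norm (X * P - P * X) \<le> s"
    by blast
  have nX: "norm X \<le> norm T + 2 * s"
    using norm_triangle_ineq4 [of T "T - X"] X(3) by simp
  have approx: "\<exists>z. (\<forall>\<rho>\<in>set \<rho>s. z \<rho> \<in> B \<and> (\<forall>X\<in>B. z \<rho> * X = X * z \<rho>)) \<and>
      norm (h - sum_list (map (\<lambda>\<rho>. z \<rho> * (\<rho> * \<rho>)) \<rho>s)) \<le> 2 * s + 2 * \<delta>"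
    if h: "h \<in> B" "star h = h" "norm h \<le> norm X" and hg: "\<And>g. g \<in> \<G> \<Longrightarrow> h * g = g * h"
      and hP: "\<And>P. P \<in> B \<Longrightarrow> proj P \<Longrightarrow> norm (X * P - P * X) \<le> s \<Longrightarrow> norm (h * P - P * h) \<le> s" for h
  proof (rule selfadjoint_approx [OF h(1,2) one \<rho>])
    show "h * rproj \<rho> = rproj \<rho> * h" if "\<rho> \<in> set \<rho>s" for \<rho>
      using that by (intro hg) (auto simp: \<G>_def)
    show "norm (h * P - P * h) \<le> s" if "\<rho> \<in> set \<rho>s" "P \<in> B" "proj P" "rproj \<rho> * P = P" for \<rho> P
      using that by (intro hP X(4))
    have "norm (h * \<rho> - \<rho> * h) * norm \<rho> \<le> d * norm h * norm \<rho>" if "\<rho> \<in> set \<rho>s" for \<rho>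
    proof (intro mult_right_mono G(3) that)
      show "g * h = h * g" if "g \<in> G \<rho>" for g
        using that \<open>\<rho> \<in> set \<rho>s\<close> by (intro hg [symmetric]) (auto simp: \<G>_def)
    qed simp
    then have "sum_list (map (\<lambda>\<rho>. norm (h * \<rho> - \<rho> * h) * norm \<rho>) \<rho>s)
        \<le> sum_list (map (\<lambda>\<rho>. d * norm h * norm \<rho>) \<rho>s)"
      by (rule sum_list_mono)
    also have "\<dots> = d * norm h * sum_list (map norm \<rho>s)"
      by (simp add: sum_list_const_mult)
    also have "\<dots> \<le> d * (norm T + 2 * s + 1) * C"
      using h(3) nX d s by (intro mult_mono) (auto simp: C_def sum_nonneg)
    also have "\<dots> = \<delta>"
    proof -
      have "norm T + 2 * s + 1 > 0"
        using s by (intro add_nonneg_pos) auto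
      then show ?thesis
        using C by (simp add: d_def)
    qed
    finally show "sum_list (map (\<lambda>\<rho>. norm (h * \<rho> - \<rho> * h) * norm \<rho>) \<rho>s) \<le> \<delta>" .
  qed (use s d in auto)
  have gstar: "star g = g" "g \<in> B" if "g \<in> \<G>" for g
    using \<G> [OF that] projD(1) bicommD(1) by auto
  have "\<exists>z. (\<forall>\<rho>\<in>set \<rho>s. z \<rho> \<in> B \<and> (\<forall>X\<in>B. z \<rho> * X = X * z \<rho>)) \<and>
      norm (re_part X - sum_list (map (\<lambda>\<rho>. z \<rho> * (\<rho> * \<rho>)) \<rho>s)) \<le> 2 * s + 2 * \<delta>"
  proof (rule approx)
    show "re_part X \<in> B" "star (re_part X) = re_part X" "norm (re_part X) \<le> norm X"
      by (intro parts_in star_parts norm_parts_le X(1))+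
    show "re_part X * g = g * re_part X" if "g \<in> \<G>" for g
      by (intro parts_commute X(2) gstar that)
    show "norm (re_part X * P - P * re_part X) \<le> s"
      if "P \<in> B" "proj P" "norm (X * P - P * X) \<le> s" for P
      by (intro norm_parts_commutator_le X(1) that)
  qed
  then obtain z1 where z1: "\<And>\<rho>. \<rho> \<in> set \<rho>s \<Longrightarrow> z1 \<rho> \<in> B \<and> (\<forall>X\<in>B. z1 \<rho> * X = X * z1 \<rho>)"
    "norm (re_part X - sum_list (map (\<lambda>\<rho>. z1 \<rho> * (\<rho> * \<rho>)) \<rho>s)) \<le> 2 * s + 2 * \<delta>"
    by blast
  have "\<exists>z. (\<forall>\<rho>\<in>set \<rho>s. z \<rho> \<in> B \<and> (\<forall>X\<in>B. z \<rho> * X = X * z \<rho>)) \<and>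
      norm (im_part X - sum_list (map (\<lambda>\<rho>. z \<rho> * (\<rho> * \<rho>)) \<rho>s)) \<le> 2 * s + 2 * \<delta>"
  proof (rule approx)
    show "im_part X \<in> B" "star (im_part X) = im_part X" "norm (im_part X) \<le> norm X"
      by (intro parts_in star_parts norm_parts_le X(1))+
    show "im_part X * g = g * im_part X" if "g \<in> \<G>" for g
      by (intro parts_commute X(2) gstar that)
    show "norm (im_part X * P - P * im_part X) \<le> s"
      if "P \<in> B" "proj P" "norm (X * P - P * X) \<le> s" for P
      by (intro norm_parts_commutator_le X(1) that)
  qed
  then obtain z2 where z2: "\<And>\<rho>. \<rho> \<in> set \<rho>s \<Longrightarrow> z2 \<rho> \<in> B \<and> (\<forall>X\<in>B. z2 \<rho> * X = X * z2 \<rho>)"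
    "norm (im_part X - sum_list (map (\<lambda>\<rho>. z2 \<rho> * (\<rho> * \<rho>)) \<rho>s)) \<le> 2 * s + 2 * \<delta>"
    by blast
  define z where "z = (\<lambda>\<rho>. z1 \<rho> + J * z2 \<rho>)"
  have "z \<rho> \<in> B \<and> (\<forall>X\<in>B. z \<rho> * X = X * z \<rho>)" if r: "\<rho> \<in> set \<rho>s" for \<rho>
  proof (intro conjI ballI)
    show "z \<rho> \<in> B"
      using z1(1) [OF r] z2(1) [OF r] J_B by (simp add: z_def)
    fix Y
    assume Y: "Y \<in> B"
    have "J * z2 \<rho> * Y = Y * (J * z2 \<rho>)"
      using z2(1) [OF r] Y by (intro commute_mult J_commute) auto
    moreover have "z1 \<rho> * Y = Y * z1 \<rho>"
      using z1(1) [OF r] Y by blast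
    ultimately show "z \<rho> * Y = Y * z \<rho>"
      by (simp add: z_def distrib_left distrib_right)
  qed
  moreover have "norm (T - sum_list (map (\<lambda>\<rho>. z \<rho> * (\<rho> * \<rho>)) \<rho>s)) \<le> 6 * s + \<eta>"
  proof -
    have "sum_list (map (\<lambda>\<rho>. z \<rho> * (\<rho> * \<rho>)) \<rho>s) =
        sum_list (map (\<lambda>\<rho>. z1 \<rho> * (\<rho> * \<rho>)) \<rho>s) + J * sum_list (map (\<lambda>\<rho>. z2 \<rho> * (\<rho> * \<rho>)) \<rho>s)"
      by (simp add: z_def distrib_right sum_list_addf mult.assoc sum_list_const_mult)
    then have "T - sum_list (map (\<lambda>\<rho>. z \<rho> * (\<rho> * \<rho>)) \<rho>s) = (T - X)
        + ((re_part X - sum_list (map (\<lambda>\<rho>. z1 \<rho> * (\<rho> * \<rho>)) \<rho>s))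
          + J * (im_part X - sum_list (map (\<lambda>\<rho>. z2 \<rho> * (\<rho> * \<rho>)) \<rho>s)))"
      using parts_decomp [of X] by (simp add: right_diff_distrib)
    also have "norm \<dots> \<le> 2 * s + ((2 * s + 2 * \<delta>) + (2 * s + 2 * \<delta>))"
      by (intro order_trans [OF norm_triangle_ineq] add_mono X(3) z1(2)
          order_trans [OF norm_J_mult_le] z2(2))
    also have "\<dots> = 6 * s + \<eta>"
      by (simp add: \<delta>_def)
    finally show ?thesis .
  qed
  ultimately show ?thesis
    using \<rho> by (intro exI [of _ \<rho>s] exI [of _ z]) auto
qed

end

section \<open>Von Neumann algebras on a complex Hilbert space\<close>

instance complex_hilbert_space \<subseteq> banach ..

lemma blinfun_of_simps [simp]:
  "blinfun_of (X + Y) = blinfun_of X + blinfun_of Y" "blinfun_of (X - Y) = blinfun_of X - blinfun_of Y"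
  "blinfun_of (X * Y) = blinfun_of X o\<^sub>L blinfun_of Y" "blinfun_of (r *\<^sub>R X) = r *\<^sub>R blinfun_of X"
  "blinfun_of (- X) = - blinfun_of X" "blinfun_of 0 = 0" "blinfun_of 1 = id_blinfun"
  "norm (blinfun_of X) = norm X" "blinfun_apply (blinfun_of X) = ap X" "blinfun_of (Oper S) = S"
  by (simp_all add: plus_oper.rep_eq minus_oper.rep_eq times_oper.rep_eq scaleR_oper.rep_eq
      uminus_oper.rep_eq zero_oper.rep_eq one_oper.rep_eq norm_oper.rep_eq ap.rep_eq Oper_inverse)

lemma scale_opr_of_real: "scale_opr (of_real r) S = r *\<^sub>R S"
  by (rule blinfun_eqI) (simp add: scaleC_of_real blinfun.scaleR_left)

text \<open>The imaginary part of an inner product is the real part after multiplication by - i, so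
  complex linearity turns the real adjoint identity into the complex one.\<close>

lemma adj_blinfun_of:
  fixes X :: "'h::complex_hilbert_space oper"
  assumes X: "blinfun_of X \<in> bounded_ops"
  shows "adj (blinfun_of X) = blinfun_of (star X)"
proof (rule adj_eqI)
  have Im: "Im (cinner u w) = inner ((- \<i>) *\<^sub>C u) w" for u w :: 'h
    by (simp add: cinner_scaleC_left flip: Re_cinner)
  fix x y
  show "cinner (blinfun_apply (blinfun_of X) x) y = cinner x (blinfun_apply (blinfun_of (star X)) y)"
  proof (rule complex_eqI)
    show "Re (cinner (blinfun_apply (blinfun_of X) x) y) = Re (cinner x (blinfun_apply (blinfun_of (star X)) y))"
      by (simp add: Re_cinner inner_star)
    have "(- \<i>) *\<^sub>C ap X x = ap X ((- \<i>) *\<^sub>C x)"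
      using X by (simp add: bounded_ops_def)
    then show "Im (cinner (blinfun_apply (blinfun_of X) x) y) = Im (cinner x (blinfun_apply (blinfun_of (star X)) y))"
      by (simp only: Im blinfun_of_simps inner_star [symmetric])
  qed
qed

lemma projection_blinfun_of:
  assumes "blinfun_of X \<in> bounded_ops"
  shows "projection (blinfun_of X) \<longleftrightarrow> proj X"
  using assms unfolding projection_def proj_def
  by (simp add: adj_blinfun_of blinfun_of_inject flip: blinfun_of_simps(3))

definition opers :: "'h::complex_hilbert_space opr set \<Rightarrow> 'h oper set"
  where "opers M = {X. blinfun_of X \<in> M}"

lemma star_subalgebra_opers:
  assumes "star_subalgebra M"
  shows "X \<in> opers M \<Longrightarrow> Y \<in> opers M \<Longrightarrow> X + Y \<in> opers M"
    and "X \<in> opers M \<Longrightarrow> r *\<^sub>R X \<in> opers M"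
    and "X \<in> opers M \<Longrightarrow> Y \<in> opers M \<Longrightarrow> X * Y \<in> opers M"
    and "X \<in> opers M \<Longrightarrow> star X \<in> opers M"
proof -
  have M: "M \<subseteq> bounded_ops" "\<And>S T. S \<in> M \<Longrightarrow> T \<in> M \<Longrightarrow> S + T \<in> M"
    "\<And>c T. T \<in> M \<Longrightarrow> scale_opr c T \<in> M" "\<And>S T. S \<in> M \<Longrightarrow> T \<in> M \<Longrightarrow> S o\<^sub>L T \<in> M"
    "\<And>T. T \<in> M \<Longrightarrow> adj T \<in> M"
    using assms by (auto simp: star_subalgebra_def)
  show "X \<in> opers M \<Longrightarrow> Y \<in> opers M \<Longrightarrow> X + Y \<in> opers M"
    "X \<in> opers M \<Longrightarrow> Y \<in> opers M \<Longrightarrow> X * Y \<in> opers M"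
    using M by (simp_all add: opers_def)
  show "X \<in> opers M \<Longrightarrow> r *\<^sub>R X \<in> opers M"
    using M(3) [of "blinfun_of X" "of_real r"] by (simp add: opers_def scale_opr_of_real)
  show "X \<in> opers M \<Longrightarrow> star X \<in> opers M"
    using M(1) M(5) [of "blinfun_of X"] adj_blinfun_of [of X] by (auto simp: opers_def)
qed

text \<open>The topology is pulled back from the product topology, where a basic neighbourhood
  restricts only finitely many coordinates.\<close>

lemma strong_operator_closure:
  fixes M :: "('a::real_normed_vector \<Rightarrow>\<^sub>L 'a) set"
  assumes closed: "closedin strong_operator_topology M"
    and approx: "\<And>F e. finite F \<Longrightarrow> 0 < e \<Longrightarrow> \<exists>Y\<in>M. \<forall>x\<in>F. norm (blinfun_apply Y x - blinfun_apply X x) < e"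
  shows "X \<in> M"
proof (rule ccontr)
  assume "X \<notin> M"
  have "openin strong_operator_topology (UNIV - M)"
    using closed by (simp add: closedin_def strong_operator_topology_topspace)
  then obtain U where U: "open U" "UNIV - M = blinfun_apply -` U"
    unfolding strong_operator_topology_def by (auto simp: openin_pullback_topology)
  then have "blinfun_apply X \<in> U"
    using \<open>X \<notin> M\<close> by auto
  then obtain V where V: "blinfun_apply X \<in> (\<Pi>\<^sub>E i\<in>UNIV. V i)" "\<And>i. open (V i)"
    "finite {i. V i \<noteq> UNIV}" "(\<Pi>\<^sub>E i\<in>UNIV. V i) \<subseteq> U"
    using product_topology_open_contains_basis [of "\<lambda>_. euclidean" UNIV U "blinfun_apply X"] U(1)
    by (simp add: open_fun_def) blast
  have "\<exists>e>0. ball (blinfun_apply X i) e \<subseteq> V i" for i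
    using V(1,2) by (metis PiE_mem UNIV_I openE)
  then obtain e where e: "\<And>i. e i > 0" "\<And>i. ball (blinfun_apply X i) (e i) \<subseteq> V i"
    by metis
  define F where "F = {i. V i \<noteq> UNIV}"
  \<comment> \<open>The 1 keeps the set nonempty when no coordinate is restricted.\<close>
  define d where "d = Min (insert 1 (e ` F))"
  have F: "finite F"
    using V(3) by (simp add: F_def)
  have d: "d > 0" "\<And>i. i \<in> F \<Longrightarrow> d \<le> e i"
    using F e(1) by (auto simp: d_def)
  obtain Y where Y: "Y \<in> M" "\<And>x. x \<in> F \<Longrightarrow> norm (blinfun_apply Y x - blinfun_apply X x) < d"
    using approx [OF F d(1)] by blast
  have "blinfun_apply Y i \<in> V i" for i
  proof (cases "i \<in> F")
    case True
    then have "dist (blinfun_apply X i) (blinfun_apply Y i) < e i"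
      using Y(2) d(2) by (metis dist_commute dist_norm less_le_trans)
    then show ?thesis
      using e(2) [of i] by auto
  qed (simp add: F_def)
  then have "blinfun_apply Y \<in> U"
    using V(4) by auto
  then show False
    using U(2) Y(1) by auto
qed

lemma closed_opers: "closed M \<Longrightarrow> closed (opers M)"
proof -
  assume M: "closed M"
  show ?thesis
    unfolding closed_sequential_limits
  proof (intro allI impI)
    fix X L
    assume X: "(\<forall>n. X n \<in> opers M) \<and> X \<longlonglongrightarrow> L"
    then have "(\<lambda>n. blinfun_of (X n)) \<longlonglongrightarrow> blinfun_of L"
      by (simp add: LIMSEQ_iff flip: blinfun_of_simps(2))
    then show "L \<in> opers M"
      using X closed_sequentially [OF M, of "\<lambda>n. blinfun_of (X n)"] by (simp add: opers_def)
  qed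
qed

lemma id_in_opers: "id_blinfun \<in> M \<Longrightarrow> 1 \<in> opers M"
  by (simp add: opers_def)

lemma strong_algebra_opers:
  assumes "von_neumann_algebra B"
  shows "strong_algebra (opers B)"
proof
  have B: "star_subalgebra B" "id_blinfun \<in> B" "closedin strong_operator_topology B"
    using assms by (auto simp: von_neumann_algebra_def)
  show "1 \<in> opers B"
    by (rule id_in_opers) (rule B)
  fix X
  assume "\<And>F e. finite F \<Longrightarrow> 0 < e \<Longrightarrow> \<exists>Y\<in>opers B. \<forall>x\<in>F. norm (ap Y x - ap X x) < e"
  note approx = this
  have "\<exists>Y\<in>B. \<forall>x\<in>F. norm (blinfun_apply Y x - blinfun_apply (blinfun_of X) x) < e"
    if Fe: "finite F" "0 < e" for F e
  proof -
    obtain Y where "Y \<in> opers B" "\<forall>x\<in>F. norm (ap Y x - ap X x) < e"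
      using approx [OF Fe] by blast
    then show ?thesis
      by (intro bexI [of _ "blinfun_of Y"]) (simp_all add: opers_def)
  qed
  then show "X \<in> opers B"
    using strong_operator_closure [OF B(3), of "blinfun_of X"] by (simp add: opers_def)
qed (use assms star_subalgebra_opers [of B] in \<open>auto simp: von_neumann_algebra_def\<close>)

lemma complex_abelian_subalgebra_opers:
  fixes A B :: "'h::complex_hilbert_space opr set"
  assumes B: "von_neumann_algebra B" and A: "cstar_algebra A" "A \<subseteq> B" "id_blinfun \<in> A" "commutative A"
  shows "complex_abelian_subalgebra (opers B) (opers A) (Oper (scale_opr \<i> id_blinfun))"
proof -
  interpret strong_algebra "opers B"
    by (rule strong_algebra_opers) (rule B)
  have A': "star_subalgebra A" "closed A"
    using A(1) by (auto simp: cstar_algebra_def)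
  note opersA = star_subalgebra_opers [OF A'(1)]
  have bdd: "B \<subseteq> bounded_ops"
    using B by (auto simp: von_neumann_algebra_def star_subalgebra_def)
  have J: "ap (Oper (scale_opr \<i> id_blinfun)) x = \<i> *\<^sub>C x" for x :: 'h
    by (simp flip: blinfun_of_simps(9))
  have JA: "Oper (scale_opr \<i> id_blinfun) \<in> opers A"
    using A'(1) A(3) by (simp add: opers_def star_subalgebra_def)
  show ?thesis
  proof
    show "opers A \<subseteq> opers B"
      using A(2) by (auto simp: opers_def)
    show "1 \<in> opers A"
      by (rule id_in_opers) (rule A)
    show "closed (opers A)"
      by (rule closed_opers) (rule A')
    show "X * Y = Y * X" if "X \<in> opers A" "Y \<in> opers A" for X Y
      using that A(4) by (simp add: opers_def commutative_def flip: blinfun_of_inject)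
    show "Oper (scale_opr \<i> id_blinfun) \<in> opers A"
      by (rule JA)
    show "Oper (scale_opr \<i> id_blinfun) * X = X * Oper (scale_opr \<i> id_blinfun)" if "X \<in> opers B" for X
    proof (rule oper_eqI)
      fix x
      show "ap (Oper (scale_opr \<i> id_blinfun) * X) x = ap (X * Oper (scale_opr \<i> id_blinfun)) x"
        using that bdd by (auto simp: opers_def bounded_ops_def J)
    qed
    have i2: "\<i> *\<^sub>C (\<i> *\<^sub>C x) = - x" for x :: 'h
      using scaleC_of_real [of "-1" x] by (simp add: scaleC_scaleC)
    show "Oper (scale_opr \<i> (id_blinfun :: 'h opr)) * Oper (scale_opr \<i> id_blinfun) = - 1"
      by (rule oper_eqI) (simp add: J i2)
    show "star (Oper (scale_opr \<i> (id_blinfun :: 'h opr))) = - Oper (scale_opr \<i> id_blinfun)"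
    proof (rule star_eqI)
      fix x y :: 'h
      have "cinner (\<i> *\<^sub>C x) y = cnj (- \<i> * cinner y x)"
        by (simp add: cinner_scaleC_left cinner_commute [of x y])
      also have "\<dots> = - cinner x (\<i> *\<^sub>C y)"
        by (simp add: cinner_commute [of x "\<i> *\<^sub>C y"] cinner_scaleC_left)
      finally show "inner (ap (Oper (scale_opr \<i> id_blinfun)) x) y
          = inner x (ap (- Oper (scale_opr \<i> id_blinfun)) y)"
        by (simp add: J flip: Re_cinner) (simp add: Re_cinner)
    qed
  qed (auto intro: opersA)
qed

text \<open>The approximant from \<open>distance_bound\<close> is a finite sum of products of
  elements of \<open>A\<close> and of the center, so it lies in every algebra of the intersection
  defining \<open>cstar_generated\<close>.\<close>

lemma infdist_cstar_generated_le:
  fixes A B :: "'h::complex_hilbert_space opr set"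
  assumes B: "von_neumann_algebra B" and A: "cstar_algebra A" "A \<subseteq> B" "id_blinfun \<in> A" "commutative A"
    and T: "T \<in> B" and F: "finite F" "F \<subseteq> A" and e: "0 < e"
    and bound: "\<And>P. P \<in> B \<Longrightarrow> projection P \<Longrightarrow> (\<And>S. S \<in> F \<Longrightarrow> norm (commutator S P) \<le> e) \<Longrightarrow>
      norm (commutator T P) \<le> s"
  shows "infdist T (cstar_generated B (A \<union> center B)) \<le> 6 * s"
proof (rule field_le_epsilon)
  fix \<eta> :: real
  assume \<eta>: "0 < \<eta>"
  interpret complex_abelian_subalgebra "opers B" "opers A" "Oper (scale_opr \<i> id_blinfun)"
    by (rule complex_abelian_subalgebra_opers) (rule B A)+
  have bdd: "B \<subseteq> bounded_ops"
    using B by (auto simp: von_neumann_algebra_def star_subalgebra_def)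
  have comm: "blinfun_of (X * P - P * X) = commutator (blinfun_of X) (blinfun_of P)" for X P :: "'h oper"
    by (simp add: commutator_def)
  have "\<exists>\<rho>s z. (\<forall>\<rho>\<in>set \<rho>s. \<rho> \<in> opers A \<and> z \<rho> \<in> opers B \<and> (\<forall>X\<in>opers B. z \<rho> * X = X * z \<rho>)) \<and>
    norm (Oper T - sum_list (map (\<lambda>\<rho>. z \<rho> * (\<rho> * \<rho>)) \<rho>s)) \<le> 6 * s + \<eta>"
  proof (rule distance_bound [of _ "Oper ` F", OF _ _ _ e _ \<eta>])
    fix P
    assume P: "P \<in> opers B" "proj P" "\<And>S. S \<in> Oper ` F \<Longrightarrow> norm (S * P - P * S) \<le> e"
    have "norm (commutator T (blinfun_of P)) \<le> s"
    proof (rule bound)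
      show "blinfun_of P \<in> B" "projection (blinfun_of P)"
        using P(1,2) bdd projection_blinfun_of [of P] by (auto simp: opers_def)
      show "norm (commutator S (blinfun_of P)) \<le> e" if "S \<in> F" for S
        using P(3) [of "Oper S"] that comm [of "Oper S" P]
        by (metis blinfun_of_simps(8,10) imageI)
    qed
    then show "norm (Oper T * P - P * Oper T) \<le> s"
      using comm [of "Oper T" P] by (metis blinfun_of_simps(8,10))
  qed (use T F in \<open>auto simp: opers_def\<close>)
  then obtain \<rho>s z where \<rho>: "\<And>\<rho>. \<rho> \<in> set \<rho>s \<Longrightarrow> \<rho> \<in> opers A"
    and z: "\<And>\<rho>. \<rho> \<in> set \<rho>s \<Longrightarrow> z \<rho> \<in> opers B" "\<And>\<rho> X. \<rho> \<in> set \<rho>s \<Longrightarrow> X \<in> opers B \<Longrightarrow> z \<rho> * X = X * z \<rho>"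
    and close: "norm (Oper T - sum_list (map (\<lambda>\<rho>. z \<rho> * (\<rho> * \<rho>)) \<rho>s)) \<le> 6 * s + \<eta>"
    by blast
  define W where "W = sum_list (map (\<lambda>\<rho>. z \<rho> * (\<rho> * \<rho>)) \<rho>s)"
  have zc: "blinfun_of (z \<rho>) \<in> center B" if "\<rho> \<in> set \<rho>s" for \<rho>
    unfolding center_def
  proof (intro CollectI conjI ballI)
    show "blinfun_of (z \<rho>) \<in> B"
      using z(1) [OF that] by (simp add: opers_def)
    fix S
    assume "S \<in> B"
    then have "z \<rho> * Oper S = Oper S * z \<rho>"
      by (intro z(2) that) (simp add: opers_def)
    then show "blinfun_of (z \<rho>) o\<^sub>L S = S o\<^sub>L blinfun_of (z \<rho>)"
      by (metis blinfun_of_simps(3,10))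
  qed
  have "blinfun_of W \<in> C" if C: "cstar_algebra C" "A \<union> center B \<subseteq> C" for C
  proof -
    have C': "0 \<in> C" "\<And>S T. S \<in> C \<Longrightarrow> T \<in> C \<Longrightarrow> S + T \<in> C" "\<And>S T. S \<in> C \<Longrightarrow> T \<in> C \<Longrightarrow> S o\<^sub>L T \<in> C"
      using C(1) by (auto simp: cstar_algebra_def star_subalgebra_def)
    have "blinfun_of (z \<rho> * (\<rho> * \<rho>)) \<in> C" if "\<rho> \<in> set \<rho>s" for \<rho>
    proof -
      have "blinfun_of (z \<rho>) \<in> C" "blinfun_of \<rho> \<in> C"
        using zc [OF that] \<rho> [OF that] C(2) by (auto simp: opers_def)
      then show ?thesis
        by (simp add: C'(3))
    qed
    then show ?thesis
      unfolding W_def by (induction \<rho>s) (auto simp: C' simp del: blinfun_of_simps(3))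
  qed
  then have "blinfun_of W \<in> cstar_generated B (A \<union> center B)"
    by (auto simp: cstar_generated_def)
  then have "infdist T (cstar_generated B (A \<union> center B)) \<le> dist T (blinfun_of W)"
    by (rule infdist_le)
  also have "\<dots> = norm (Oper T - W)"
    by (metis blinfun_of_simps(2,8,10) dist_norm)
  also have "\<dots> \<le> 6 * s + \<eta>"
    using close by (simp add: W_def)
  finally show "infdist T (cstar_generated B (A \<union> center B)) \<le> 6 * s + \<eta>" .
qed

section \<open>The net of almost optimal projections\<close>

lemma norm_commutator_le: "norm (commutator S T) \<le> 2 * norm S * norm T"
proof -
  have "norm (commutator S T) \<le> norm S * norm T + norm T * norm S"
    unfolding commutator_def
    by (intro order_trans [OF norm_triangle_ineq4] add_mono norm_blinfun_compose)
  then show ?thesis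
    by simp
qed

lemma norm_projection_le:
  fixes P :: "'h::complex_hilbert_space opr"
  assumes "projection P"
  shows "norm P \<le> 1"
proof -
  have "proj (Oper P)"
    using assms projection_blinfun_of [of "Oper P"] by (simp add: projection_def)
  then show ?thesis
    using norm_proj_le [of "Oper P"] by (metis blinfun_of_simps(8,10))
qed

theorem theorem3:
  fixes B A :: "'h::complex_hilbert_space opr set" and T :: "'h opr"
  assumes "von_neumann_algebra B"
    and "cstar_algebra A" and "A \<subseteq> B" and "id_blinfun \<in> A" and "commutative A"
    and "T \<in> B"
  shows "\<exists>(D :: 'h opr net_index set) R (P :: 'h opr net_index \<Rightarrow> 'h opr).
    directed_set D R \<and>
    (\<forall>i\<in>D. P i \<in> B \<and> projection (P i)) \<and>
    (\<forall>S\<in>A. ((\<lambda>i. norm (commutator S (P i))) \<longlongrightarrow> 0) (tails D R)) \<and>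
    (\<exists>L. ((\<lambda>i. norm (commutator T (P i))) \<longlongrightarrow> L) (tails D R) \<and>
         infdist T (cstar_generated B (A \<union> center B)) \<le> 10 * L)"
proof -
  define v where "v = (\<lambda>P. norm (commutator T P))"
  define N where "N = (\<lambda>F e. {P \<in> B. projection P \<and> (\<forall>S\<in>F. norm (commutator S P) \<le> e)})"
  define I where "I = {(F, e). finite F \<and> F \<subseteq> A \<and> 0 < (e::real)}"
  define s where "s = (\<lambda>(F, e). SUP P\<in>N F e. v P)"
  define L where "L = (INF i\<in>I. s i)"
  \<comment> \<open>Membership in \<open>N F e\<close> keeps the commutator with \<open>T\<close>
    below s (F, e), and the extra condition pushes it up to \<open>L\<close>. Such projections exist
    because the supremum s (F, e) is at least \<open>L\<close>, hence larger than L - e.\<close>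
  define U where "U = (\<lambda>(F, e). {P \<in> N F e. L - e < v P})"
  \<comment> \<open>An index is a projection together with some \<open>U i\<close> containing it;
    the net is \<open>fst\<close>.\<close>
  define D where "D = {(P, V). \<exists>i\<in>I. V = U i \<and> P \<in> V}"
  define R where "R = {(i, j). i \<in> D \<and> j \<in> D \<and> snd j \<subseteq> snd i}"
  have "0 \<in> B"
    using assms(1) by (simp add: von_neumann_algebra_def star_subalgebra_def)
  moreover have "projection (0 :: 'h opr)"
    using projection_blinfun_of [of "0 :: 'h oper"] assms(1) \<open>0 \<in> B\<close>
    by (auto simp: proj_def von_neumann_algebra_def star_subalgebra_def)
  ultimately have N0: "0 \<in> N F e" if "(F, e) \<in> I" for F e
    using that by (auto simp: N_def I_def commutator_def)
  have bdd: "bdd_above (v ` N F e)" for F e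
  proof (rule bdd_aboveI2)
    fix P
    assume "P \<in> N F e"
    then show "v P \<le> 2 * norm T * 1"
      unfolding v_def using norm_projection_le [of P]
      by (intro order_trans [OF norm_commutator_le] mult_left_mono) (auto simp: N_def)
  qed
  have v_le: "v P \<le> s (F, e)" if "P \<in> N F e" for P F e
    unfolding s_def using that by (auto intro: cSUP_upper bdd)
  have s0: "0 \<le> s i" if "i \<in> I" for i
  proof -
    obtain F e where i: "i = (F, e)"
      by (cases i)
    have "0 \<le> v 0"
      by (simp add: v_def)
    also have "\<dots> \<le> s (F, e)"
      using that i by (intro v_le N0) simp
    finally show ?thesis
      by (simp add: i)
  qed
  have I0: "({}, 1) \<in> I"
    by (simp add: I_def)
  have L_le: "L \<le> s i" if "i \<in> I" for i
    unfolding L_def by (rule cINF_lower [OF bdd_belowI2 that]) (rule s0)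
  have L0: "0 \<le> L"
    unfolding L_def using I0 s0 by (intro cINF_greatest) auto
  have U_ne: "\<exists>P. P \<in> U i" if "i \<in> I" for i
  proof -
    obtain F e where i: "i = (F, e)"
      by (cases i)
    have "L - e < (SUP P\<in>N F e. v P)"
      using L_le [OF that] that by (simp add: i s_def I_def)
    moreover have "N F e \<noteq> {}"
      using N0 that i by blast
    ultimately obtain P where "P \<in> N F e" "L - e < v P"
      using less_cSUP_iff [OF _ bdd] by metis
    then show ?thesis
      by (auto simp: U_def i)
  qed
  have U_mono: "U (F', e') \<subseteq> U (F, e)" if "F \<subseteq> F'" "e' \<le> e" for F F' e e'
    using that by (auto simp: U_def N_def intro: order_trans)
  have join: "\<exists>k\<in>I. U k \<subseteq> U i \<inter> U j" if "i \<in> I" "j \<in> I" for i j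
  proof (rule bexI)
    let ?k = "(fst i \<union> fst j, min (snd i) (snd j))"
    show "U ?k \<subseteq> U i \<inter> U j"
      using U_mono [of "fst i" "fst i \<union> fst j" "min (snd i) (snd j)" "snd i"]
        U_mono [of "fst j" "fst i \<union> fst j" "min (snd i) (snd j)" "snd j"] by simp
    show "?k \<in> I"
      using that by (auto simp: I_def)
  qed
  have dir: "directed_set D R"
    unfolding directed_set_def
  proof (intro conjI ballI)
    show "D \<noteq> {}"
      using U_ne [OF I0] I0 by (auto simp: D_def)
    show "preorder_on D R"
      by (auto simp: preorder_on_def refl_on_def trans_def R_def)
    fix x y
    assume xy: "x \<in> D" "y \<in> D"
    then obtain i j where ij: "i \<in> I" "snd x = U i" "j \<in> I" "snd y = U j"
      by (auto simp: D_def)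
    then obtain k where k: "k \<in> I" "U k \<subseteq> U i \<inter> U j"
      using join by blast
    then obtain P where "P \<in> U k"
      using U_ne by blast
    then have "(P, U k) \<in> D"
      using k(1) by (auto simp: D_def)
    then show "\<exists>z\<in>D. (x, z) \<in> R \<and> (y, z) \<in> R"
      using xy ij k(2) by (intro bexI [of _ "(P, U k)"]) (auto simp: R_def)
  qed
  have ev: "\<forall>\<^sub>F x in tails D R. fst x \<in> U i" if i: "i \<in> I" for i
  proof -
    obtain P where P: "P \<in> U i"
      using U_ne [OF i] by blast
    show ?thesis
      unfolding eventually_tails [OF dir]
    proof (intro bexI ballI impI)
      show "(P, U i) \<in> D"
        using P i by (auto simp: D_def)
      fix x
      assume "x \<in> D" "((P, U i), x) \<in> R"
      then show "fst x \<in> U i"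
        by (auto simp: R_def D_def)
    qed
  qed
  have conv_A: "((\<lambda>x. norm (commutator S (fst x))) \<longlongrightarrow> 0) (tails D R)" if S: "S \<in> A" for S
  proof (rule tendstoI)
    fix e :: real
    assume e: "0 < e"
    \<comment> \<open>Half of \<open>e\<close>, since membership in \<open>N\<close> gives only a
      weak inequality.\<close>
    have "({S}, e / 2) \<in> I"
      using S e by (simp add: I_def)
    from ev [OF this] show "\<forall>\<^sub>F x in tails D R. dist (norm (commutator S (fst x))) 0 < e"
      by (rule eventually_mono) (use e in \<open>auto simp: U_def N_def\<close>)
  qed
  have conv_T: "((\<lambda>x. norm (commutator T (fst x))) \<longlongrightarrow> L) (tails D R)"
  proof (rule tendstoI)
    fix e :: real
    assume e: "0 < e"
    have "Inf (s ` I) < L + e"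
      using e by (simp add: L_def)
    then obtain F d where Fd: "(F, d) \<in> I" "s (F, d) < L + e"
      using cInf_lessD [of "s ` I" "L + e"] I0 by (metis empty_iff image_iff old.prod.exhaust)
    \<comment> \<open>Here \<open>d\<close> yields the upper bound through s (F, d), and
      \<open>e\<close> the lower bound through the definition of \<open>U\<close>.\<close>
    have "(F, min d e) \<in> I"
      using Fd(1) e by (simp add: I_def)
    from ev [OF this] show "\<forall>\<^sub>F x in tails D R. dist (norm (commutator T (fst x))) L < e"
    proof (rule eventually_mono)
      fix x
      assume x: "fst x \<in> U (F, min d e)"
      then have "fst x \<in> N F d" "L - min d e < v (fst x)"
        by (auto simp: U_def N_def)
      then have "v (fst x) < L + e" "L - e < v (fst x)"
        using v_le Fd(2) by fastforce+
      then show "dist (norm (commutator T (fst x))) L < e"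
        by (simp add: v_def dist_real_def abs_less_iff)
    qed
  qed
  \<comment> \<open>Divided by 6, the distance is a lower bound of all \<open>s i\<close> and hence
    of their infimum; the passage from 6 to 10 then uses that \<open>L\<close> is
    nonnegative.\<close>
  have "infdist T (cstar_generated B (A \<union> center B)) / 6 \<le> L"
    unfolding L_def
  proof (rule cINF_greatest)
    fix i
    assume "i \<in> I"
    then obtain F e where i: "i = (F, e)" "finite F" "F \<subseteq> A" "0 < e"
      by (auto simp: I_def)
    have "infdist T (cstar_generated B (A \<union> center B)) \<le> 6 * s (F, e)"
      by (rule infdist_cstar_generated_le [OF assms i(2,3,4)]) (use v_le in \<open>auto simp: N_def v_def\<close>)
    then show "infdist T (cstar_generated B (A \<union> center B)) / 6 \<le> s i"
      by (simp add: i(1))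
  qed (use I0 in auto)
  then have "infdist T (cstar_generated B (A \<union> center B)) \<le> 10 * L"
    using L0 by simp
  moreover have "fst x \<in> B \<and> projection (fst x)" if "x \<in> D" for x
    using that by (auto simp: D_def U_def N_def)
  ultimately show ?thesis
    using dir conv_A conv_T by (intro exI [of _ D] exI [of _ R] exI [of _ fst]) blast
qed

end
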